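(* Let $F'/F$ be the unramified quadratic field extension (that is, the place is non-split), and let $a\in\mathfrak{C}_{\mathscr{M}}(\mathcal{O})$ be a point whose restriction to $F$ is invertible and strongly regular semisimple. Then the obstruction $\mathrm{Ob}(a)\in H^1(F,\mathrm{U}_n)$ is non-trivial if and only if $\mathrm{val}(\mathrm{Disc}(a))$ is odd.
   Context: $n\ge1$, $\kappa$ is a finite field with $\mathrm{char}(\kappa)>2n$, $\mathcal{O}=\kappa[[\pi]]$, $F=\kappa((\pi))$, $\kappa'/\kappa$ the quadratic field extension, $\mathcal{O}'=\mathcal{O}\otimes_\kappa\kappa'$, $F'=F\otimes_\kappa\kappa'$, $\sigma$ (or bar) the non-trivial automorphism. Universal monoid: $\mathbf{T}^{sc}\subset\mathrm{SL}_n$ the diagonal torus, $\alpha_i=t_i/t_{i+1}$, $\varpi_i=t_1\cdots t_i$, $V_i$ the $i$-th exterior power of the standard representation. $\mathbf{M}^\times=(\mathbf{T}^{sc}\times\mathrm{SL}_n)/\mu_n$ ($\mu_n$ anti-diagonal), and $\mathbf{M}$ is the normalization of the closure of the image of $(z,g)\mapsto(\alpha_i(z),\varpi_i(z)\wedge^ig)_{1\le i\le n-1}$ in $\mathbb{A}^{n-1}\oplus\bigoplus_i\mathrm{End}(V_i)$. For $x\in\mathbf{M}$, $(z_i)\in\mathbb{A}^{n-1}$ and $x_i\in\mathrm{End}(V_i)$ denote its components. $\tau$ is the involution of $\mathbf{M}$ extending $(z,g)\mapsto(\iota_A(z),{}^tg^{-1})$ with $\iota_A(\mathrm{diag}(t_1,\dots,t_n))=\mathrm{diag}(t_n^{-1},\dots,t_1^{-1})$.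 $\mathfrak{M}'(R)=\{x\in\mathbf{M}(R\otimes_{\mathcal{O}}\mathcal{O}'):\tau\sigma(x)=x\}$ for $\mathcal{O}$-algebras $R$; $\mathrm{U}_n(R)=\{g\in\mathrm{GL}_n(R\otimes\mathcal{O}'):{}^t\bar gg=1\}$ acts on $\mathfrak{M}'$ by conjugation. Invariants: to $(x,e,e^\vee)$ with $x\in\mathbf{M}$, $e$ a vector and $e^\vee$ a covector of the standard representation, attach $z_i$, $a_i=\mathrm{Tr}(x_i)$, $b_0=e^\vee e$, and $b_i$ ($1\le i\le n-1$) the trace of the composite $V_{i-1}\xrightarrow{e\wedge}V_i\xrightarrow{x_i}V_i\xrightarrow{e^\vee}V_{i-1}$, the last arrow being contraction $v_1\wedge\cdots\wedge v_i\mapsto\sum_j(-1)^{j-1}(e^\vee v_j)v_1\wedge\cdots\widehat{v_j}\cdots\wedge v_i$. Put $f_0=1$, $f_i=x_i(e\wedge f_{i-1})$ ($1\le i<n$), $f_n=e\wedge f_{n-1}$; $f_0^\vee=1$, $f_i^\vee=(f_{i-1}^\vee\wedge e^\vee)x_i$ ($1\le i<n$), $f_n^\vee=f_{n-1}^\vee\wedge e^\vee$. $\mathrm{Disc}=f_n^\vee f_n$ is a polynomial function of the invariants $(z,a,b)$. $\mathrm{Disc}_+$ is the conjugation-invariant function on $\mathbf{M}$ given on $(z,t)\in(\mathbf{T}^{sc}\times\mathbf{T}^{sc})/\mu_n$ by $z^{2\rho}\prod_\alpha(1-\alpha(t))$ (over all roots; $2\rho$ is the sum of the positive roots), a polynomial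 in $(z,a)$. $\mathfrak{C}_{\mathscr{M}}(R)$ is the set of $(z_i,a_i,b_i,b_0)\in(R\otimes\mathcal{O}')^{3n-2}$ ($1\le i\le n-1$) with $z_i=\sigma z_{n-i}$, $a_i=\sigma a_{n-i}$, $b_i=\sigma(b_0a_{n-i}-b_{n-i})$, $b_0\in R$. A point over $F$ is invertible if all $z_i\ne0$, and strongly regular semisimple if $\mathrm{Disc}_+\cdot\mathrm{Disc}\neq0$. Obstruction: given such $a$, there is, up to unique isomorphism, a unique triple $(\mathcal{E}',x',e')$ over $F$ with invariants $a$, where $\mathcal{E}'$ is a $\mathrm{U}_n$-torsor over $F$ (equivalently an $n$-dimensional Hermitian $F'$-space), $x'\in(\mathfrak{M}'\times^{\mathrm{U}_n}\mathcal{E}')(F)$ and $e'$ is a vector of the Hermitian space, the covector used in the invariants being the one obtained from $e'$ by the Hermitian form. $\mathrm{Ob}(a)\in H^1(F,\mathrm{U}_n)\cong\mathbb{Z}/2\mathbb{Z}$ is the class of $\mathcal{E}'$. *)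

theory Defs
  imports
    "HOL-Computational_Algebra.Formal_Laurent_Series"
    "HOL-Algebra.Algebraic_Closure_Type"
    "Jordan_Normal_Form.Determinant"
    "Jordan_Normal_Form.DL_Submatrix"
begin

no_notation fps_nth (infixl "$" 75)  \<comment> \<open>clashes with the entries of vectors\<close>

section \<open>The fields\<close>

definition quadratic_extension :: "('k::field \<Rightarrow> 'l::field) \<Rightarrow> bool" where
  "quadratic_extension \<iota> \<longleftrightarrow> field_hom \<iota> \<and>
     (\<exists>u v. \<forall>y. \<exists>!c. y = \<iota> (fst c) * u + \<iota> (snd c) * v)"

definition nontrivial_automorphism :: "('k::field \<Rightarrow> 'l::field) \<Rightarrow> ('l \<Rightarrow> 'l) \<Rightarrow> bool" where
  "nontrivial_automorphism \<iota> \<sigma> \<longleftrightarrow>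
     field_hom \<sigma> \<and> bij \<sigma> \<and> (\<forall>c. \<sigma> (\<iota> c) = \<iota> c) \<and> \<sigma> \<noteq> id"

text \<open>
  For the embedding \<open>\<iota>\<close> of \<open>\<kappa>\<close> into \<open>\<kappa>'\<close> and the involution \<open>\<sigma>\<close> of \<open>\<kappa>'\<close>, the coefficientwise
  maps below are the embeddings of \<open>\<O>\<close> into \<open>\<O>' = \<kappa>'[[\<pi>]]\<close>, and the induced involutions of
  \<open>\<O>'\<close> and \<open>F' = \<kappa>'((\<pi>))\<close>. They are only applied to maps that send \<open>0\<close> to \<open>0\<close>, so that the
  argument of \<^const>\<open>Abs_fls\<close> is a Laurent series.
\<close>

definition fps_map :: "('a::zero \<Rightarrow> 'b::zero) \<Rightarrow> 'a fps \<Rightarrow> 'b fps" where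
  "fps_map h x = Abs_fps (\<lambda>k. h (fps_nth x k))"

definition fls_map :: "('a::zero \<Rightarrow> 'b::zero) \<Rightarrow> 'a fls \<Rightarrow> 'b fls" where
  "fls_map h x = Abs_fls (\<lambda>k. h (fls_nth x k))"

section \<open>Exterior powers of the standard representation\<close>

text \<open>
  The exterior power \<open>V\<^sub>i\<close> has the basis \<open>e\<^sub>I\<close>, where \<open>I\<close> runs through the \<open>i\<close>-element subsets of
  \<open>{0,\<dots>,n-1}\<close> and \<open>e\<^sub>I\<close> is the wedge product of the \<open>e\<^sub>k\<close>, \<open>k \<in> I\<close>, in increasing order. Elements
  of \<open>V\<^sub>i\<close> (and of its dual, in the dual basis) are functions of \<open>I\<close>, endomorphisms are functions of
  two such subsets (row and column), and only the values at \<open>i\<close>-element subsets matter.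
\<close>

definition subsets_of_card :: "nat \<Rightarrow> nat \<Rightarrow> nat set set" where
  "subsets_of_card n i = {I. I \<subseteq> {..<n} \<and> card I = i}"

definition ext_basis :: "nat set \<Rightarrow> nat set \<Rightarrow> 'r::comm_ring_1" where
  "ext_basis J I = (if I = J then 1 else 0)"

definition ext_apply ::
  "nat \<Rightarrow> nat \<Rightarrow> (nat set \<Rightarrow> nat set \<Rightarrow> 'r::comm_ring_1) \<Rightarrow> (nat set \<Rightarrow> 'r) \<Rightarrow> nat set \<Rightarrow> 'r" where
  "ext_apply n i A v I = (\<Sum>J\<in>subsets_of_card n i. A I J * v J)"

definition ext_row_apply ::
  "nat \<Rightarrow> nat \<Rightarrow> (nat set \<Rightarrow> 'r::comm_ring_1) \<Rightarrow> (nat set \<Rightarrow> nat set \<Rightarrow> 'r) \<Rightarrow> nat set \<Rightarrow> 'r" where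
  "ext_row_apply n i w A J = (\<Sum>I\<in>subsets_of_card n i. w I * A I J)"

text \<open>The maps \<open>v \<mapsto> e \<and> v\<close> and \<open>w \<mapsto> w \<and> e\<^sup>\<or>\<close>, and the contraction with \<open>e\<^sup>\<or>\<close>.\<close>

definition wedge_left :: "'r::comm_ring_1 vec \<Rightarrow> (nat set \<Rightarrow> 'r) \<Rightarrow> nat set \<Rightarrow> 'r" where
  "wedge_left e v I = (\<Sum>k\<in>I. (-1) ^ card {j\<in>I. j < k} * e $ k * v (I - {k}))"

definition wedge_right :: "(nat set \<Rightarrow> 'r::comm_ring_1) \<Rightarrow> 'r vec \<Rightarrow> nat set \<Rightarrow> 'r" where
  "wedge_right w e' I = (\<Sum>k\<in>I. (-1) ^ card {j\<in>I. k < j} * w (I - {k}) * e' $ k)"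

definition contraction :: "nat \<Rightarrow> 'r::comm_ring_1 vec \<Rightarrow> (nat set \<Rightarrow> 'r) \<Rightarrow> nat set \<Rightarrow> 'r" where
  "contraction n e' v J =
     (\<Sum>k\<in>{..<n} - J. (-1) ^ card {j\<in>J. j < k} * e' $ k * v (insert k J))"

section \<open>The universal monoid\<close>

text \<open>
  Closed points of \<open>T\<^sup>s\<^sup>c \<times> SL\<^sub>n\<close>; a diagonal matrix is given by the vector of its diagonal entries.
  Vector and matrix indices start at \<open>0\<close>, so \<open>t\<^sub>i\<close> is \<^term>\<open>t $ (i - 1)\<close>.
\<close>

type_synonym 'r torus_sl = "'r vec \<times> 'r mat"

definition torus :: "nat \<Rightarrow> 'r::field vec set" where
  "torus n = {t \<in> carrier_vec n. (\<Prod>i<n. t $ i) = 1}"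

definition TSL :: "nat \<Rightarrow> 'r::field torus_sl set" where
  "TSL n = torus n \<times> {g \<in> carrier_mat n n. det g = 1}"

definition simple_root :: "nat \<Rightarrow> 'r::field vec \<Rightarrow> 'r" where
  "simple_root i t = t $ (i - 1) / t $ i"

definition fundamental_weight :: "nat \<Rightarrow> 'r::field vec \<Rightarrow> 'r" where
  "fundamental_weight i t = (\<Prod>j<i. t $ j)"

definition z_coord :: "nat \<Rightarrow> 'r::field torus_sl \<Rightarrow> 'r" where
  "z_coord i = (\<lambda>(t, g). simple_root i t)"

definition x_coord :: "nat \<Rightarrow> nat set \<Rightarrow> nat set \<Rightarrow> 'r::field torus_sl \<Rightarrow> 'r" where
  "x_coord i I J = (\<lambda>(t, g). fundamental_weight i t * det (submatrix g I J))"

text \<open>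
  Regular functions are represented as functions on closed points over an algebraically closed
  field, extended by zero to the whole type. The set \<open>k\<close> is the image of the field of
  coefficients.
\<close>

inductive_set generated_functions :: "'r::field set \<Rightarrow> ('p \<Rightarrow> 'r) set \<Rightarrow> ('p \<Rightarrow> 'r) set"
  for k :: "'r set" and G :: "('p \<Rightarrow> 'r) set" where
  const: "c \<in> k \<Longrightarrow> (\<lambda>_. c) \<in> generated_functions k G"
| gen: "f \<in> G \<Longrightarrow> f \<in> generated_functions k G"
| add: "f \<in> generated_functions k G \<Longrightarrow> g \<in> generated_functions k G \<Longrightarrow>
    (\<lambda>p. f p + g p) \<in> generated_functions k G"
| mult: "f \<in> generated_functions k G \<Longrightarrow> g \<in> generated_functions k G \<Longrightarrow>
    (\<lambda>p. f p * g p) \<in> generated_functions k G"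

definition on_TSL :: "nat \<Rightarrow> ('r::field torus_sl \<Rightarrow> 'r) \<Rightarrow> 'r torus_sl \<Rightarrow> 'r" where
  "on_TSL n f = (\<lambda>p. if p \<in> TSL n then f p else 0)"

text \<open>The coordinate ring of the closure of the image of \<open>M\<^sup>\<times>\<close>.\<close>

definition image_ring :: "nat \<Rightarrow> 'r::field set \<Rightarrow> ('r torus_sl \<Rightarrow> 'r) set" where
  "image_ring n k = on_TSL n ` generated_functions k
     ({z_coord i |i. i \<in> {1..<n}} \<union>
      {x_coord i I J |i I J. i \<in> {1..<n} \<and> I \<in> subsets_of_card n i \<and> J \<in> subsets_of_card n i})"

text \<open>The coordinate ring of \<open>M\<^sup>\<times> = (T\<^sup>s\<^sup>c \<times> SL\<^sub>n)/\<mu>\<^sub>n\<close>.\<close>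

definition unit_group_ring :: "nat \<Rightarrow> 'r::field set \<Rightarrow> ('r torus_sl \<Rightarrow> 'r) set" where
  "unit_group_ring n k =
     {f \<in> on_TSL n ` generated_functions k
            ({\<lambda>(t, g). t $ i |i. i < n} \<union> {\<lambda>(t, g). g $$ (i, j) |i j. i < n \<and> j < n}).
        \<forall>\<zeta> t g. \<zeta> ^ n = 1 \<longrightarrow> (t, g) \<in> TSL n \<longrightarrow>
          f (\<zeta> \<cdot>\<^sub>v t, inverse \<zeta> \<cdot>\<^sub>m g) = f (t, g)}"

text \<open>
  The coordinate ring of \<open>M\<close>: the elements of the fraction field of \<^const>\<open>image_ring\<close> that are
  integral over it. Since \<open>M\<^sup>\<times>\<close> is normal and contained in the closure of its image as an open subset,
  these elements are regular on \<open>M\<^sup>\<times>\<close>, so that they can be written as functions.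
\<close>

definition monoid_ring :: "nat \<Rightarrow> 'r::field set \<Rightarrow> ('r torus_sl \<Rightarrow> 'r) set" where
  "monoid_ring n k =
     {f \<in> unit_group_ring n k.
        (\<exists>p\<in>image_ring n k. \<exists>q\<in>image_ring n k. q \<noteq> (\<lambda>_. 0) \<and> (\<lambda>y. q y * f y) = p) \<and>
        (\<exists>m c. (\<forall>j<m. c j \<in> image_ring n k) \<and>
           (\<forall>y\<in>TSL n. f y ^ m + (\<Sum>j<m. c j y * f y ^ j) = 0))}"

text \<open>
  Points of \<open>M\<close> with values in a field \<open>'f\<close> containing \<open>\<kappa>\<close> are the \<open>'f\<close>-algebra homomorphisms to
  \<open>'f\<close> from the coordinate ring of the base change of \<open>M\<close> to \<open>'f\<close> (which is again the normalization,
  because \<open>\<kappa>\<close> is perfect).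
\<close>

type_synonym 'f point = "('f alg_closure torus_sl \<Rightarrow> 'f alg_closure) \<Rightarrow> 'f"

definition monoid_points :: "nat \<Rightarrow> 'f::field point set" where
  "monoid_points n =
     {\<phi>. (\<forall>c. \<phi> (on_TSL n (\<lambda>_. to_ac c)) = c) \<and>
         (\<forall>f\<in>monoid_ring n (range to_ac). \<forall>g\<in>monoid_ring n (range to_ac).
            \<phi> (\<lambda>y. f y + g y) = \<phi> f + \<phi> g \<and> \<phi> (\<lambda>y. f y * g y) = \<phi> f * \<phi> g)}"

definition point_z :: "nat \<Rightarrow> 'f::field point \<Rightarrow> nat \<Rightarrow> 'f" where
  "point_z n \<phi> i = \<phi> (on_TSL n (z_coord i))"

definition point_x :: "nat \<Rightarrow> 'f::field point \<Rightarrow> nat \<Rightarrow> nat set \<Rightarrow> nat set \<Rightarrow> 'f" where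
  "point_x n \<phi> i I J = \<phi> (on_TSL n (x_coord i I J))"

section \<open>Invariants and discriminants\<close>

text \<open>Tuples \<open>(z, a, b)\<close>: the indices of \<open>z\<close> and \<open>a\<close> are \<open>1,\<dots>,n-1\<close>, those of \<open>b\<close> are \<open>0,\<dots>,n-1\<close>.\<close>

type_synonym 'r invs = "(nat \<Rightarrow> 'r) \<times> (nat \<Rightarrow> 'r) \<times> (nat \<Rightarrow> 'r)"

definition inv_a :: "nat \<Rightarrow> (nat \<Rightarrow> nat set \<Rightarrow> nat set \<Rightarrow> 'r::comm_ring_1) \<Rightarrow> nat \<Rightarrow> 'r" where
  "inv_a n x i = (\<Sum>I\<in>subsets_of_card n i. x i I I)"

definition inv_b :: "nat \<Rightarrow> (nat \<Rightarrow> nat set \<Rightarrow> nat set \<Rightarrow> 'r::comm_ring_1) \<Rightarrow>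
    'r vec \<Rightarrow> 'r vec \<Rightarrow> nat \<Rightarrow> 'r" where
  "inv_b n x e e' i =
     (if i = 0 then e' \<bullet> e
      else (\<Sum>J\<in>subsets_of_card n (i - 1).
              contraction n e' (ext_apply n i (x i) (wedge_left e (ext_basis J))) J))"

definition has_invariants ::
  "nat \<Rightarrow> 'f::field point \<Rightarrow> 'f vec \<Rightarrow> 'f vec \<Rightarrow> 'f invs \<Rightarrow> bool" where
  "has_invariants n \<phi> e e' = (\<lambda>(z, a, b).
     (\<forall>i\<in>{1..<n}. z i = point_z n \<phi> i \<and> a i = inv_a n (point_x n \<phi>) i) \<and>
     (\<forall>i<n. b i = inv_b n (point_x n \<phi>) e e' i))"

primrec disc_vector :: "nat \<Rightarrow> (nat \<Rightarrow> nat set \<Rightarrow> nat set \<Rightarrow> 'r::comm_ring_1) \<Rightarrow>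
    'r vec \<Rightarrow> nat \<Rightarrow> nat set \<Rightarrow> 'r" where
  "disc_vector n x e 0 = ext_basis {}"
| "disc_vector n x e (Suc i) =
     (if Suc i < n then ext_apply n (Suc i) (x (Suc i)) (wedge_left e (disc_vector n x e i))
      else wedge_left e (disc_vector n x e i))"

primrec disc_covector :: "nat \<Rightarrow> (nat \<Rightarrow> nat set \<Rightarrow> nat set \<Rightarrow> 'r::comm_ring_1) \<Rightarrow>
    'r vec \<Rightarrow> nat \<Rightarrow> nat set \<Rightarrow> 'r" where
  "disc_covector n x e' 0 = ext_basis {}"
| "disc_covector n x e' (Suc i) =
     (if Suc i < n
      then ext_row_apply n (Suc i) (wedge_right (disc_covector n x e' i) e') (x (Suc i))
      else wedge_right (disc_covector n x e' i) e')"

text \<open>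
  The function Disc on the invariants is characterized by its pullback to triples \<open>(x, e, e\<^sup>\<or>)\<close>.
  Every tuple of invariants with all \<open>z\<^sub>i\<close> invertible comes from such a triple over the same field
  (take a companion matrix), so rational triples determine the value at these tuples, and the
  definition is used only there.
\<close>

definition disc :: "nat \<Rightarrow> 'f::field invs \<Rightarrow> 'f" where
  "disc n w =
     (THE d. \<exists>\<phi>\<in>monoid_points n. \<exists>e\<in>carrier_vec n. \<exists>e'\<in>carrier_vec n.
        has_invariants n \<phi> e e' w \<and>
        d = disc_covector n (point_x n \<phi>) e' n {..<n} * disc_vector n (point_x n \<phi>) e n {..<n})"

text \<open>
  The function \<open>Disc\<^sub>+\<close> is given on \<open>(T\<^sup>s\<^sup>c \<times> T\<^sup>s\<^sup>c)/\<mu>\<^sub>n\<close>; over the algebraic closure every \<open>(z, a)\<close> with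
  all \<open>z\<^sub>i\<close> invertible is the image of such a pair. The first product is the value of the sum of the
  positive roots.
\<close>

definition disc_plus :: "nat \<Rightarrow> 'f::field invs \<Rightarrow> 'f" where
  "disc_plus n = (\<lambda>(z, a, b).
     (THE d. \<exists>s\<in>torus n. \<exists>t\<in>torus n.
        (\<forall>i\<in>{1..<n}. to_ac (z i) = simple_root i s \<and>
           to_ac (a i) =
             inv_a n (\<lambda>i I J. x_coord i I J (s, mat n n (\<lambda>(k, l). if k = l then t $ k else 0))) i) \<and>
        to_ac d = (\<Prod>(i, j)\<in>{(i, j). i < j \<and> j < n}. s $ i / s $ j) *
                  (\<Prod>(i, j)\<in>{(i, j). i < n \<and> j < n \<and> i \<noteq> j}. 1 - t $ i / t $ j)))"

text \<open>
  \<open>\<CC>\<^sub>M(R)\<close>, where \<open>'r\<close> is \<open>R \<otimes> \<O>'\<close> with its involution \<open>s\<close>, and \<open>R\<close> is given as a subset of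
  \<open>'r\<close>.
\<close>

definition base_points :: "nat \<Rightarrow> ('r::comm_ring_1 \<Rightarrow> 'r) \<Rightarrow> 'r set \<Rightarrow> 'r invs set" where
  "base_points n s R = {(z, a, b).
     (\<forall>i\<in>{1..<n}. z i = s (z (n - i)) \<and> a i = s (a (n - i)) \<and>
        b i = s (b 0 * a (n - i) - b (n - i))) \<and> b 0 \<in> R}"

definition generic_fibre :: "'l::zero fps invs \<Rightarrow> 'l fls invs" where
  "generic_fibre = (\<lambda>(z, a, b).
     (\<lambda>i. fps_to_fls (z i), \<lambda>i. fps_to_fls (a i), \<lambda>i. fps_to_fls (b i)))"

definition invertible_invs :: "nat \<Rightarrow> 'f::field invs \<Rightarrow> bool" where
  "invertible_invs n = (\<lambda>(z, a, b). \<forall>i\<in>{1..<n}. z i \<noteq> 0)"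

definition strongly_regular_semisimple :: "nat \<Rightarrow> 'f::field invs \<Rightarrow> bool" where
  "strongly_regular_semisimple n w \<longleftrightarrow> disc_plus n w * disc n w \<noteq> 0"

section \<open>Hermitian spaces and the obstruction\<close>

text \<open>
  An \<open>n\<close>-dimensional Hermitian space over \<open>F'\<close> is given by a nondegenerate matrix \<open>H\<close>, the form being
  \<open>h(u, v) = \<^sup>t\<sigma>(u) H v\<close>. The group \<open>U\<^sub>n\<close> is the one of \<open>H = 1\<close>, so \<open>U\<^sub>n\<close>-torsors over \<open>F\<close> are Hermitian
  spaces, and their isomorphism classes are the classes of matrices \<open>H\<close> modulo change of basis.
\<close>

definition adjoint_mat :: "('f::field \<Rightarrow> 'f) \<Rightarrow> 'f mat \<Rightarrow> 'f mat" where
  "adjoint_mat s A = transpose_mat (map_mat s A)"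

definition hermitian_forms :: "nat \<Rightarrow> ('f::field \<Rightarrow> 'f) \<Rightarrow> 'f mat set" where
  "hermitian_forms n s = {H \<in> carrier_mat n n. adjoint_mat s H = H \<and> det H \<noteq> 0}"

definition isometric :: "nat \<Rightarrow> ('f::field \<Rightarrow> 'f) \<Rightarrow> ('f mat \<times> 'f mat) set" where
  "isometric n s = {(H, H'). H \<in> hermitian_forms n s \<and> H' \<in> hermitian_forms n s \<and>
     (\<exists>p\<in>carrier_mat n n. det p \<noteq> 0 \<and> H' = adjoint_mat s p * H * p)}"

definition H1_unitary :: "nat \<Rightarrow> ('f::field \<Rightarrow> 'f) \<Rightarrow> 'f mat set set" where
  "H1_unitary n s = hermitian_forms n s // isometric n s"

definition trivial_class :: "nat \<Rightarrow> ('f::field \<Rightarrow> 'f) \<Rightarrow> 'f mat set" where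
  "trivial_class n s = isometric n s `` {1\<^sub>m n}"

definition inverse_mat :: "'f::field mat \<Rightarrow> 'f mat" where
  "inverse_mat A = inverse (det A) \<cdot>\<^sub>m adj_mat A"

definition tau :: "nat \<Rightarrow> 'r::field torus_sl \<Rightarrow> 'r torus_sl" where
  "tau n = (\<lambda>(t, g). (vec n (\<lambda>i. inverse (t $ (n - 1 - i))), transpose_mat (inverse_mat g)))"

text \<open>
  The \<open>F\<close>-points of the twist of \<open>\<MM>'\<close> by the torsor of \<open>H\<close> are the \<open>x \<in> M(F')\<close> with
  \<open>H x H\<^sup>-\<^sup>1 = \<tau>\<sigma>(x)\<close>; for \<open>H = 1\<close> this is \<open>\<MM>'(F)\<close>, and on elements \<open>g\<close> of \<open>SL\<^sub>n\<close> it says that \<open>g\<close>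
  preserves the form. Both sides are \<open>F'\<close>-points of \<open>M\<close>, compared as homomorphisms on the
  coordinate ring over \<open>\<kappa>\<close>, on which \<open>\<sigma>(x)\<close> is the composition of \<open>x\<close> with \<open>\<sigma>\<close>. Here \<open>k\<close> is the image
  of \<open>\<kappa>\<close> in \<open>F'\<close>.
\<close>

definition twisted_points ::
  "nat \<Rightarrow> 'f::field set \<Rightarrow> ('f \<Rightarrow> 'f) \<Rightarrow> 'f mat \<Rightarrow> 'f point set" where
  "twisted_points n k s H = {\<phi> \<in> monoid_points n. \<forall>f\<in>monoid_ring n (to_ac ` k).
     \<phi> (on_TSL n (\<lambda>(t, g). f (t, map_mat to_ac H * g * map_mat to_ac (inverse_mat H)))) =
     s (\<phi> (on_TSL n (\<lambda>y. f (tau n y))))}"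

text \<open>The covector \<open>v \<mapsto> h(e, v)\<close>.\<close>

definition hermitian_covector :: "('f::field \<Rightarrow> 'f) \<Rightarrow> 'f mat \<Rightarrow> 'f vec \<Rightarrow> 'f vec" where
  "hermitian_covector s H e = transpose_mat H *\<^sub>v map_vec s e"

definition obstruction ::
  "nat \<Rightarrow> 'f::field set \<Rightarrow> ('f \<Rightarrow> 'f) \<Rightarrow> 'f invs \<Rightarrow> 'f mat set" where
  "obstruction n k s w =
     (THE c. c \<in> H1_unitary n s \<and>
        (\<exists>H\<in>c. \<exists>\<phi>\<in>twisted_points n k s H. \<exists>e\<in>carrier_vec n.
           has_invariants n \<phi> e (hermitian_covector s H e) w))"

end

theory Submission
  imports Defs "Jordan_Normal_Form.Char_Poly"
begin

text \<open>
  A point of the monoid with invertible \<open>z\<close> amounts to a matrix \<open>A = t\<^sub>1 g\<close>, its components \<open>x\<^sub>i\<close>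
  being the matrices of \<open>i\<close>-minors of \<open>A\<close> divided by \<open>c\<^sub>i = \<Prod>m<i. \<rho>\<^sub>m\<close>, where \<open>\<rho>\<^sub>m = z\<^sub>1 \<dots> z\<^sub>m\<close>. The
  condition defining the twisted form becomes \<open>A\<^sup>* H A = Z H\<close> with \<open>Z = \<rho>\<^sub>n\<^sub>-\<^sub>1\<close>. Up to sign and a
  square, Disc is the product of the determinants of the vectors \<open>A\<^sup>j e\<close> and of the covectors
  \<open>h(e, A\<^sup>j -)\<close>; the similitude relation expresses the latter determinant by the conjugate of the
  former and \<open>det H\<close>, so that Disc and \<open>det H\<close> have valuations of the same parity. Finally the norm
  is surjective on units, hence this parity classifies Hermitian forms of rank \<open>n\<close>. A companion
  matrix, with the form reconstructed from the moments \<open>h(e, A\<^sup>j e)\<close>, shows that a triple exists.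
\<close>

text \<open>On \<open>T^sc x SL_n\<close> the product \<open>z_1 ... z_m\<close> equals
  \<open>t_1 / t_{m+1}\<close>, so \<open>c_i\<close> times the i-th fundamental weight is
  \<open>t_1^i\<close>. This is the origin of \<open>c_i\<close>, and the reason why
  \<open>t_1 g\<close> alone carries all of x. Conversely, a matrix over F' of determinant
  \<open>c_n\<close> lifts to \<open>T^sc x SL_n\<close> only after an n-th root of the determinant
  is adjoined. Elements of the coordinate ring are \<mu>_n-invariant and n is invertible, so their
  values descend to F'. The link between invariants and matrices is the sequence of moments
  \<open>e^\<or> A^j e\<close>. The b_i are triangular combinations of them with coefficients from
  the characteristic polynomial, Cayley-Hamilton extends them to all j, and the two determinants in
  Disc multiply to their Hankel determinant. Uniqueness is proved for the isometry class only:
  triples with equal invariants have forms whose determinants agree in parity of valuation. Powers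
  of Z drop out of this parity because the determinant of the similitude relation gives
  \<open>n val(Z) = 2 val(det A)\<close>.\<close>

section \<open>Subsets of indices, minors and Laplace expansion\<close>

text \<open>This is the inverse of \<open>pick I\<close> and also the exponent in the signs of
  \<open>wedge_left\<close> and \<open>contraction\<close>, so that Laplace signs and exterior
  algebra signs match without conversion.\<close>

definition pos :: "nat set \<Rightarrow> nat \<Rightarrow> nat" where
  "pos I k = card {j \<in> I. j < k}"

lemma pick_pos: "k \<in> I \<Longrightarrow> pick I (pos I k) = k"
  unfolding pos_def by (rule pick_card_in_set)

lemma pos_pick: "p < card I \<Longrightarrow> pos I (pick I p) = p"
  unfolding pos_def by (rule card_pick_le)

lemma pos_less: "finite I \<Longrightarrow> k \<in> I \<Longrightarrow> pos I k < card I"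
  unfolding pos_def by (intro psubset_card_mono) auto

lemma pos_insert_self [simp]: "pos (insert l J) l = pos J l"
  unfolding pos_def by (rule arg_cong[of _ _ card]) auto

lemma pos_remove_self [simp]: "pos (J - {l}) l = pos J l"
  unfolding pos_def by (rule arg_cong[of _ _ card]) auto

lemma pick_bij_betw:
  assumes "finite I"
  shows "bij_betw (pick I) {..<card I} I"
  by (rule bij_betw_byWitness[where f' = "pos I"])
    (use assms in \<open>auto simp: pos_pick pick_pos pos_less pick_in_set_le\<close>)

text \<open>Removing an element lowers the positions of all later ones by one, which is the
  renumbering that \<open>mat_delete\<close> performs through \<open>insert_index\<close>.\<close>

lemma pick_remove:
  assumes "finite I" "k \<in> I" "i < card I - 1"
  shows "pick (I - {k}) i = pick I (insert_index (pos I k) i)"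
proof -
  let ?j = "insert_index (pos I k) i"
  let ?x = "pick I ?j"
  have j: "?j < card I"
    using assms(3) by (auto simp: insert_index_def)
  have x: "?x \<in> I"
    using j by (rule pick_in_set_le)
  have px: "pos I ?x = ?j"
    using j by (rule pos_pick)
  have ne: "?x \<noteq> k"
    using px by (auto simp: insert_index_def split: if_splits)
  have "pos (I - {k}) ?x = i"
  proof (cases "k < ?x")
    case True
    have "{j \<in> I - {k}. j < ?x} = {j \<in> I. j < ?x} - {k}" by auto
    then have c: "pos (I - {k}) ?x = ?j - 1"
      using True assms(1,2) px by (simp add: pos_def)
    have "pos I k < pos I ?x"
      using True assms(1,2) unfolding pos_def by (intro psubset_card_mono) auto
    then show ?thesis
      using c px by (auto simp: insert_index_def split: if_splits)
  next
    case False
    then have "{j \<in> I - {k}. j < ?x} = {j \<in> I. j < ?x}" by auto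
    then have "pos (I - {k}) ?x = pos I ?x" by (simp add: pos_def)
    moreover have "pos I ?x \<le> pos I k"
      using False assms(1) unfolding pos_def by (intro card_mono) auto
    ultimately show ?thesis
      using px by (auto simp: insert_index_def split: if_splits)
  qed
  then show ?thesis
    using pick_pos[of ?x "I - {k}"] x ne by auto
qed

text \<open>Only the rows are indexed by a subset; the columns are an arbitrary sequence. This
  covers minors, matrices with a repeated column, and coordinates of a wedge product of
  vectors.\<close>

definition row_det :: "nat set \<Rightarrow> (nat \<Rightarrow> nat \<Rightarrow> 'r::comm_ring_1) \<Rightarrow> 'r" where
  "row_det I M = det (mat (card I) (card I) (\<lambda>(p, q). M (pick I p) q))"

lemma row_det_laplace:
  assumes I: "finite I" and q: "q < card I"
  shows "row_det I M = (\<Sum>k\<in>I. (-1) ^ (pos I k + q) * M k q *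
           row_det (I - {k}) (\<lambda>k' q'. M k' (insert_index q q')))"
proof -
  let ?A = "mat (card I) (card I) (\<lambda>(p, q). M (pick I p) q)"
  have "row_det I M = (\<Sum>p<card I. ?A $$ (p, q) * cofactor ?A p q)"
    unfolding row_det_def using q by (intro laplace_expansion_column) auto
  also have "\<dots> = (\<Sum>p<card I. (-1) ^ (pos I (pick I p) + q) * M (pick I p) q *
           row_det (I - {pick I p}) (\<lambda>k' q'. M k' (insert_index q q')))"
  proof (rule sum.cong[OF refl])
    fix p assume "p \<in> {..<card I}"
    then have p: "p < card I" by simp
    have pp: "pos I (pick I p) = p" and pin: "pick I p \<in> I"
      using p by (auto simp: pos_pick pick_in_set_le)
    have "mat_delete ?A p q = mat (card (I - {pick I p})) (card (I - {pick I p}))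
       (\<lambda>(p', q'). M (pick (I - {pick I p}) p') (insert_index q q'))"
      unfolding mat_delete_def
      by (rule eq_matI) (use p q pin I in \<open>auto simp: pick_remove pp insert_index_def\<close>)
    then show "?A $$ (p, q) * cofactor ?A p q = (-1) ^ (pos I (pick I p) + q) * M (pick I p) q *
           row_det (I - {pick I p}) (\<lambda>k' q'. M k' (insert_index q q'))"
      unfolding cofactor_def row_det_def using p q by (simp add: pp mult_ac)
  qed
  also have "\<dots> = (\<Sum>k\<in>I. (-1) ^ (pos I k + q) * M k q *
           row_det (I - {k}) (\<lambda>k' q'. M k' (insert_index q q')))"
    by (rule sum.reindex_bij_betw[OF pick_bij_betw[OF I]])
  finally show ?thesis .
qed

lemma row_det_cong:
  assumes "finite I" "\<And>k q. k \<in> I \<Longrightarrow> q < card I \<Longrightarrow> M k q = M' k q"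
  shows "row_det I M = row_det I M'"
proof -
  have "mat (card I) (card I) (\<lambda>(p, q). M (pick I p) q) = mat (card I) (card I) (\<lambda>(p, q). M' (pick I p) q)"
    by (rule eq_matI) (use assms in \<open>auto simp: pick_in_set_le\<close>)
  then show ?thesis by (simp add: row_det_def)
qed

lemma row_det_eq_cols:
  assumes "p < card I" "q < card I" "p \<noteq> q" "\<And>k. k \<in> I \<Longrightarrow> M k p = M k q"
  shows "row_det I M = 0"
  unfolding row_det_def
  by (rule det_identical_columns[of _ "card I" p q])
    (use assms in \<open>auto intro!: eq_vecI simp: pick_in_set_le\<close>)

abbreviation minor :: "'r::comm_ring_1 mat \<Rightarrow> nat set \<Rightarrow> nat set \<Rightarrow> 'r" where
  "minor A I J \<equiv> det (submatrix A I J)"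

lemma submatrix_subset:
  assumes "A \<in> carrier_mat n n" "I \<subseteq> {..<n}" "J \<subseteq> {..<n}"
  shows "submatrix A I J = mat (card I) (card J) (\<lambda>(p, q). A $$ (pick I p, pick J q))"
proof -
  have "{i. i < n \<and> i \<in> I} = I" "{i. i < n \<and> i \<in> J} = J" using assms by auto
  then show ?thesis using assms(1) unfolding submatrix_def by auto
qed

lemma minor_row_det:
  assumes "A \<in> carrier_mat n n" "I \<subseteq> {..<n}" "J \<subseteq> {..<n}" "card I = card J"
  shows "minor A I J = row_det I (\<lambda>k q. A $$ (k, pick J q))"
  using assms by (simp add: submatrix_subset row_det_def)

lemma minor_laplace:
  assumes A: "A \<in> carrier_mat n n" and I: "I \<subseteq> {..<n}" and J: "J \<subseteq> {..<n}"
    and c: "card I = card J" and l: "l \<in> J"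
  shows "minor A I J = (\<Sum>k\<in>I. (-1) ^ (pos I k + pos J l) * A $$ (k, l) * minor A (I - {k}) (J - {l}))"
proof -
  have fin: "finite I" "finite J" using finite_subset[OF I] finite_subset[OF J] by simp_all
  have pl: "pos J l < card J" using fin(2) l by (rule pos_less)
  have "minor A I J = (\<Sum>k\<in>I. (-1) ^ (pos I k + pos J l) * A $$ (k, pick J (pos J l)) *
        row_det (I - {k}) (\<lambda>k' q'. A $$ (k', pick J (insert_index (pos J l) q'))))"
    using row_det_laplace[OF fin(1), of "pos J l"] pl c minor_row_det[OF A I J c] by simp
  also have "\<dots> = (\<Sum>k\<in>I. (-1) ^ (pos I k + pos J l) * A $$ (k, l) * minor A (I - {k}) (J - {l}))"
  proof (rule sum.cong[OF refl])
    fix k assume k: "k \<in> I"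
    have "minor A (I - {k}) (J - {l}) = row_det (I - {k}) (\<lambda>k' q. A $$ (k', pick (J - {l}) q))"
      by (rule minor_row_det[OF A]) (use I J c k l fin in auto)
    also have "\<dots> = row_det (I - {k}) (\<lambda>k' q'. A $$ (k', pick J (insert_index (pos J l) q')))"
      by (rule row_det_cong) (use fin k l c in \<open>auto simp: pick_remove\<close>)
    finally show "(-1) ^ (pos I k + pos J l) * A $$ (k, pick J (pos J l)) *
        row_det (I - {k}) (\<lambda>k' q'. A $$ (k', pick J (insert_index (pos J l) q'))) =
        (-1) ^ (pos I k + pos J l) * A $$ (k, l) * minor A (I - {k}) (J - {l})"
      by (simp add: pick_pos[OF l])
  qed
  finally show ?thesis .
qed

text \<open>Expansion with foreign cofactors: the sum is the determinant of a matrix in which column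
  \<open>l\<close> occurs twice.\<close>

lemma minor_laplace_zero:
  assumes A: "A \<in> carrier_mat n n" and I: "I \<subseteq> {..<n}" and J: "J \<subseteq> {..<n}"
    and c: "card I = Suc (card J)" and l: "l \<in> J"
  shows "(\<Sum>k\<in>I. (-1) ^ pos I k * A $$ (k, l) * minor A (I - {k}) J) = 0"
proof -
  have fin: "finite I" "finite J" using finite_subset[OF I] finite_subset[OF J] by simp_all
  have pl: "pos J l < card J" using fin(2) l by (rule pos_less)
  \<comment> \<open>Column 0 is the extra copy of column \<open>l\<close>; the columns of
    \<open>J\<close> follow, shifted by one, so the original copy sits at
    \<open>Suc (pos J l)\<close>.\<close>
  define M where "M = (\<lambda>k q. if q = 0 then A $$ (k, l) else A $$ (k, pick J (q - 1)))"
  have "row_det I M = 0"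
    by (rule row_det_eq_cols[of 0 _ "Suc (pos J l)"])
      (use pl c in \<open>auto simp: M_def pick_pos[OF l]\<close>)
  moreover have "row_det I M = (\<Sum>k\<in>I. (-1) ^ (pos I k + 0) * M k 0 *
           row_det (I - {k}) (\<lambda>k' q'. M k' (insert_index 0 q')))"
    by (rule row_det_laplace) (use fin c in auto)
  moreover have "\<dots> = (\<Sum>k\<in>I. (-1) ^ pos I k * A $$ (k, l) * minor A (I - {k}) J)"
  proof (rule sum.cong[OF refl])
    fix k assume k: "k \<in> I"
    have "minor A (I - {k}) J = row_det (I - {k}) (\<lambda>k' q. A $$ (k', pick J q))"
      by (rule minor_row_det[OF A]) (use I J c k l fin in auto)
    then show "(-1) ^ (pos I k + 0) * M k 0 *
           row_det (I - {k}) (\<lambda>k' q'. M k' (insert_index 0 q')) =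
        (-1) ^ pos I k * A $$ (k, l) * minor A (I - {k}) J"
      by (simp add: M_def insert_index_def)
  qed
  ultimately show ?thesis by simp
qed

section \<open>Exterior powers of a matrix, wedge and contraction\<close>

lemma finite_subsets_of_card [simp]: "finite (subsets_of_card n i)"
  by (rule finite_subset[of _ "Pow {..<n}"]) (auto simp: subsets_of_card_def)

lemma subsets_of_cardD:
  assumes "I \<in> subsets_of_card n i"
  shows "I \<subseteq> {..<n}" "card I = i" "finite I"
  using assms finite_subset[of I "{..<n}"] by (simp_all add: subsets_of_card_def)

text \<open>Flags \<open>J - {l}\<close> inside \<open>J\<close> can be counted from the larger or
  from the smaller set. This is the combinatorial core of the duality between wedging with a vector
  and contracting.\<close>

lemma sum_subsets_of_card_Suc:
  "(\<Sum>J\<in>subsets_of_card n (Suc i). \<Sum>l\<in>J. f J l) =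
   (\<Sum>J\<in>subsets_of_card n i. \<Sum>l\<in>{..<n} - J. f (insert l J) l)"
proof -
  let ?S = "SIGMA J:subsets_of_card n (Suc i). J"
  let ?T = "SIGMA J:subsets_of_card n i. {..<n} - J"
  have "bij_betw (\<lambda>(J, l). (insert l J, l)) ?T ?S"
  proof (rule bij_betw_byWitness[where f' = "\<lambda>(J, l). (J - {l}, l)"])
    show "\<forall>a\<in>?T. (\<lambda>(J, l). (J - {l}, l)) ((\<lambda>(J, l). (insert l J, l)) a) = a"
      by auto
    show "\<forall>a\<in>?S. (\<lambda>(J, l). (insert l J, l)) ((\<lambda>(J, l). (J - {l}, l)) a) = a"
      by auto
    show "(\<lambda>(J, l). (insert l J, l)) ` ?T \<subseteq> ?S"
      by (auto simp: subsets_of_card_def dest: finite_subset[OF _ finite_lessThan])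
    show "(\<lambda>(J, l). (J - {l}, l)) ` ?S \<subseteq> ?T"
      by (auto simp: subsets_of_card_def dest: finite_subset[OF _ finite_lessThan])
  qed
  from sum.reindex_bij_betw[OF this, of "\<lambda>(J, l). f J l"]
  have "(\<Sum>(J, l)\<in>?S. f J l) = (\<Sum>(J, l)\<in>?T. f (insert l J) l)"
    by (simp add: case_prod_unfold)
  then show ?thesis
    by (subst (1 2) sum.Sigma) (simp_all add: subsets_of_cardD)
qed

lemmas wedge_left_pos = wedge_left_def[folded pos_def]
lemmas contraction_pos = contraction_def[folded pos_def]

lemma wedge_left_cong:
  assumes "\<And>k. k \<in> I \<Longrightarrow> v (I - {k}) = w (I - {k})"
  shows "wedge_left e v I = wedge_left e w I"
  unfolding wedge_left_def by (rule sum.cong) (use assms in auto)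

lemma contraction_cong:
  assumes "\<And>k. k \<in> {..<n} - J \<Longrightarrow> v (insert k J) = w (insert k J)"
  shows "contraction n e v J = contraction n e w J"
  unfolding contraction_def by (rule sum.cong) (use assms in auto)

text \<open>Functoriality of exterior powers, one factor at a time. Comparing coefficients of
  \<open>e $ l * v J\<close> reduces it to Laplace expansion of a minor along column
  \<open>l\<close>.\<close>

lemma ext_apply_wedge_left:
  assumes A: "A \<in> carrier_mat n n" and e: "e \<in> carrier_vec n" and I: "I \<in> subsets_of_card n (Suc i)"
  shows "ext_apply n (Suc i) (minor A) (wedge_left e v) I =
         wedge_left (A *\<^sub>v e) (ext_apply n i (minor A) v) I"
proof -
  have In: "I \<subseteq> {..<n}" and cI: "card I = Suc i" and fI: "finite I"
    using subsets_of_cardD[OF I] .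
  \<comment> \<open>For \<open>l\<close> outside \<open>J\<close> this is the genuine Laplace
    expansion; for \<open>l\<close> in \<open>J\<close> the cofactors are foreign and the wedge
    product vanishes as well.\<close>
  have key: "(\<Sum>k\<in>I. (-1) ^ pos I k * A $$ (k, l) * minor A (I - {k}) J) =
      (if l \<in> J then 0 else (-1) ^ pos J l * minor A I (insert l J))"
    if J: "J \<in> subsets_of_card n i" and l: "l < n" for J l
  proof -
    have Jn: "J \<subseteq> {..<n}" and cJ: "card J = i" and fJ: "finite J"
      using subsets_of_cardD[OF J] .
    show ?thesis
    proof (cases "l \<in> J")
      case True
      then show ?thesis using minor_laplace_zero[OF A In Jn _ True] cI cJ by simp
    next
      case False
      have "insert l J - {l} = J" using False by simp
      then have "minor A I (insert l J) = (\<Sum>k\<in>I. (-1) ^ (pos I k + pos J l) * A $$ (k, l) * minor A (I - {k}) J)"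
        using minor_laplace[OF A In _ _ insertI1, of l J, unfolded pos_insert_self]
          Jn l False fJ cI cJ by simp
      then have "(-1) ^ pos J l * minor A I (insert l J) = (\<Sum>k\<in>I. (-1) ^ pos J l *
         ((-1) ^ (pos I k + pos J l) * A $$ (k, l) * minor A (I - {k}) J))"
        by (simp only: sum_distrib_left)
      also have "\<dots> = (\<Sum>k\<in>I. (-1) ^ pos I k * A $$ (k, l) * minor A (I - {k}) J)"
        by (rule sum.cong[OF refl]) (simp add: power_add mult.assoc mult.left_commute[of "(-1) ^ pos J l"])
      finally have "(-1) ^ pos J l * minor A I (insert l J) =
        (\<Sum>k\<in>I. (-1) ^ pos I k * A $$ (k, l) * minor A (I - {k}) J)" .
      then show ?thesis using False by simp
    qed
  qed
  have "ext_apply n (Suc i) (minor A) (wedge_left e v) I =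
     (\<Sum>J\<in>subsets_of_card n (Suc i). \<Sum>l\<in>J. minor A I J * ((-1) ^ pos J l * e $ l * v (J - {l})))"
    unfolding ext_apply_def wedge_left_pos by (simp add: sum_distrib_left)
  also have "\<dots> = (\<Sum>J\<in>subsets_of_card n i. \<Sum>l\<in>{..<n} - J.
       e $ l * v J * ((-1) ^ pos J l * minor A I (insert l J)))"
    unfolding sum_subsets_of_card_Suc
    by (rule sum.cong[OF refl], rule sum.cong[OF refl]) (simp add: mult_ac)
  also have "\<dots> = (\<Sum>J\<in>subsets_of_card n i. \<Sum>l<n.
       e $ l * v J * (\<Sum>k\<in>I. (-1) ^ pos I k * A $$ (k, l) * minor A (I - {k}) J))"
  proof (rule sum.cong[OF refl])
    fix J assume J: "J \<in> subsets_of_card n i"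
    have "(\<Sum>l<n. e $ l * v J * (\<Sum>k\<in>I. (-1) ^ pos I k * A $$ (k, l) * minor A (I - {k}) J)) =
       (\<Sum>l<n. e $ l * v J * (if l \<in> J then 0 else (-1) ^ pos J l * minor A I (insert l J)))"
      by (rule sum.cong[OF refl]) (simp only: key[OF J] lessThan_iff)
    also have "\<dots> = (\<Sum>l\<in>{..<n} - J. e $ l * v J * ((-1) ^ pos J l * minor A I (insert l J)))"
      by (rule sum.mono_neutral_cong_right) simp_all
    finally show "(\<Sum>l\<in>{..<n} - J. e $ l * v J * ((-1) ^ pos J l * minor A I (insert l J))) =
        (\<Sum>l<n. e $ l * v J * (\<Sum>k\<in>I. (-1) ^ pos I k * A $$ (k, l) * minor A (I - {k}) J))"
      by (rule sym)
  qed
  also have "\<dots> = (\<Sum>J\<in>subsets_of_card n i. \<Sum>k\<in>I. \<Sum>l<n.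
       e $ l * v J * ((-1) ^ pos I k * A $$ (k, l) * minor A (I - {k}) J))"
    unfolding sum_distrib_left by (rule sum.cong[OF refl], rule sum.swap)
  also have "\<dots> = (\<Sum>k\<in>I. \<Sum>J\<in>subsets_of_card n i. \<Sum>l<n.
       e $ l * v J * ((-1) ^ pos I k * A $$ (k, l) * minor A (I - {k}) J))"
    by (rule sum.swap)
  also have "\<dots> = (\<Sum>k\<in>I. (-1) ^ pos I k * (A *\<^sub>v e) $ k * ext_apply n i (minor A) v (I - {k}))"
  proof (rule sum.cong[OF refl])
    fix k assume k: "k \<in> I"
    have "(A *\<^sub>v e) $ k = (\<Sum>l<n. A $$ (k, l) * e $ l)"
      using k In A e by (auto simp: scalar_prod_def lessThan_atLeast0)
    then have "(-1) ^ pos I k * (A *\<^sub>v e) $ k * ext_apply n i (minor A) v (I - {k}) =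
       (-1) ^ pos I k * ((\<Sum>J\<in>subsets_of_card n i. minor A (I - {k}) J * v J) * (\<Sum>l<n. A $$ (k, l) * e $ l))"
      by (simp only: ext_apply_def mult_ac)
    also have "\<dots> = (\<Sum>J\<in>subsets_of_card n i. \<Sum>l<n.
       e $ l * v J * ((-1) ^ pos I k * A $$ (k, l) * minor A (I - {k}) J))"
      by (subst sum_product) (simp only: sum_distrib_left mult_ac)
    finally show "(\<Sum>J\<in>subsets_of_card n i. \<Sum>l<n.
       e $ l * v J * ((-1) ^ pos I k * A $$ (k, l) * minor A (I - {k}) J)) =
       (-1) ^ pos I k * (A *\<^sub>v e) $ k * ext_apply n i (minor A) v (I - {k})"
      by (rule sym)
  qed
  finally show ?thesis by (simp add: wedge_left_pos)
qed

text \<open>The Clifford relation: contraction is an antiderivation. Removing the index just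
  inserted yields the scalar product, and the mixed terms \<open>T k l\<close> of the two composites
  cancel.\<close>

lemma contraction_wedge_left:
  assumes J: "J \<subseteq> {..<n}" and e: "e \<in> carrier_vec n"
  shows "contraction n e' (wedge_left e v) J + wedge_left e (contraction n e' v) J = (e' \<bullet> e) * v J"
proof -
  have fJ: "finite J" using finite_subset[OF J] by simp
  let ?C = "{..<n} - J"
  define T where "T k l = (-1) ^ (pos J k + pos (insert k J) l) * e' $ k * e $ l * v (insert k J - {l})" for k l
  have "contraction n e' (wedge_left e v) J = (\<Sum>k\<in>?C. e' $ k * e $ k * v J + (\<Sum>l\<in>J. T k l))"
    unfolding contraction_pos wedge_left_pos
  proof (rule sum.cong[OF refl])
    fix k assume k: "k \<in> ?C"
    then have "insert k J - {k} = J" by auto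
    then have "(\<Sum>l\<in>insert k J. (-1) ^ pos (insert k J) l * e $ l * v (insert k J - {l})) =
       (-1) ^ pos J k * e $ k * v J +
       (\<Sum>l\<in>J. (-1) ^ pos (insert k J) l * e $ l * v (insert k J - {l}))"
      using k by (subst sum.insert[OF fJ]) (simp, simp only: pos_insert_self)
    moreover have "(-1) ^ pos J k * e' $ k * ((-1) ^ pos J k * e $ k * v J) =
        (-1) ^ (pos J k + pos J k) * e' $ k * e $ k * v J"
      by (simp add: power_add mult_ac)
    ultimately show "(-1) ^ pos J k * e' $ k *
         (\<Sum>l\<in>insert k J. (-1) ^ pos (insert k J) l * e $ l * v (insert k J - {l})) =
         e' $ k * e $ k * v J + (\<Sum>l\<in>J. T k l)"
      by (simp add: distrib_left sum_distrib_left T_def power_add mult_ac)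
  qed
  moreover have "wedge_left e (contraction n e' v) J = (\<Sum>l\<in>J. e' $ l * e $ l * v J - (\<Sum>k\<in>?C. T k l))"
    unfolding contraction_pos wedge_left_pos
  proof (rule sum.cong[OF refl])
    fix l assume l: "l \<in> J"
    have C: "{..<n} - (J - {l}) = insert l ?C" using l J by blast
    have "(\<Sum>k\<in>{..<n} - (J - {l}). (-1) ^ pos (J - {l}) k * e' $ k * v (insert k (J - {l}))) =
       (-1) ^ pos (J - {l}) l * e' $ l * v (insert l (J - {l})) +
       (\<Sum>k\<in>?C. (-1) ^ pos (J - {l}) k * e' $ k * v (insert k (J - {l})))"
      unfolding C by (rule sum.insert) (use l in auto)
    then have eq: "(\<Sum>k\<in>{..<n} - (J - {l}). (-1) ^ pos (J - {l}) k * e' $ k * v (insert k (J - {l}))) =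
       (-1) ^ pos J l * e' $ l * v J +
       (\<Sum>k\<in>?C. (-1) ^ pos (J - {l}) k * e' $ k * v (insert k (J - {l})))"
      by (simp only: pos_remove_self insert_Diff[OF l])
    have h1: "(-1) ^ pos J l * e $ l * ((-1) ^ pos J l * e' $ l * v J) =
        e' $ l * e $ l * v J"
      by (simp add: power_add mult_ac)
    have h2: "(\<Sum>k\<in>?C. (-1) ^ pos J l * e $ l * ((-1) ^ pos (J - {l}) k * e' $ k * v (insert k (J - {l})))) =
        (\<Sum>k\<in>?C. - T k l)"
    proof (rule sum.cong[OF refl])
      fix k assume k: "k \<in> ?C"
      have s: "insert k (J - {l}) = insert k J - {l}" using k l by auto
      \<comment> \<open>Inserting \<open>k\<close> or removing \<open>l\<close> moves the position
        of the larger of the two indices by one; this single shift is the sign that makes the mixed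
        terms cancel.\<close>
      have sg: "(-1::'a) ^ (pos J l + pos (J - {l}) k) = - ((-1) ^ (pos J k + pos (insert k J) l))"
      proof (cases "k < l")
        case True
        have "{j \<in> insert k J. j < l} = insert k {j \<in> J. j < l}" using True by auto
        then have "pos (insert k J) l = Suc (pos J l)" using k fJ by (simp add: pos_def)
        moreover have "pos (J - {l}) k = pos J k"
          unfolding pos_def by (rule arg_cong[of _ _ card]) (use True in auto)
        ultimately show ?thesis by (simp add: power_add mult_ac)
      next
        case False
        then have lk: "l < k" using k l by (cases "k = l") auto
        have "{j \<in> J. j < k} = insert l {j \<in> J - {l}. j < k}" using lk l by auto
        then have "pos J k = Suc (pos (J - {l}) k)" using fJ by (simp add: pos_def)
        moreover have "pos (insert k J) l = pos J l"
          unfolding pos_def by (rule arg_cong[of _ _ card]) (use lk in auto)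
        ultimately show ?thesis by (simp add: power_add mult_ac)
      qed
      have "(-1) ^ pos J l * e $ l * ((-1) ^ pos (J - {l}) k * e' $ k * v (insert k (J - {l}))) =
         (-1) ^ (pos J l + pos (J - {l}) k) * (e' $ k * e $ l * v (insert k (J - {l})))"
        by (simp only: power_add mult_ac)
      also have "\<dots> = - ((-1) ^ (pos J k + pos (insert k J) l) * (e' $ k * e $ l * v (insert k (J - {l}))))"
        by (subst sg) (rule mult_minus_left)
      also have "\<dots> = - T k l"
        unfolding s T_def by (simp only: mult.assoc)
      finally show "(-1) ^ pos J l * e $ l * ((-1) ^ pos (J - {l}) k * e' $ k * v (insert k (J - {l}))) = - T k l" .
    qed
    have "(-1) ^ pos J l * e $ l *
        (\<Sum>k\<in>{..<n} - (J - {l}). (-1) ^ pos (J - {l}) k * e' $ k * v (insert k (J - {l}))) =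
        (-1) ^ pos J l * e $ l * ((-1) ^ pos J l * e' $ l * v J) +
        (\<Sum>k\<in>?C. (-1) ^ pos J l * e $ l * ((-1) ^ pos (J - {l}) k * e' $ k * v (insert k (J - {l}))))"
      by (subst eq, subst distrib_left, subst sum_distrib_left) (rule refl)
    from trans[OF this arg_cong2[OF h1 h2, of "(+)"]]
    show "(-1) ^ pos J l * e $ l *
        (\<Sum>k\<in>{..<n} - (J - {l}). (-1) ^ pos (J - {l}) k * e' $ k * v (insert k (J - {l}))) =
        e' $ l * e $ l * v J - (\<Sum>k\<in>?C. T k l)"
      by (simp only: sum_negf add_uminus_conv_diff)
  qed
  moreover have "(\<Sum>l\<in>J. \<Sum>k\<in>?C. T k l) = (\<Sum>k\<in>?C. \<Sum>l\<in>J. T k l)"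
    by (rule sum.swap)
  moreover have "(\<Sum>k\<in>?C. e' $ k * e $ k * v J) + (\<Sum>l\<in>J. e' $ l * e $ l * v J) = (e' \<bullet> e) * v J"
  proof -
    have "(e' \<bullet> e) = (\<Sum>k\<in>{..<n}. e' $ k * e $ k)"
      using e by (simp add: scalar_prod_def lessThan_atLeast0)
    also have "\<dots> = (\<Sum>k\<in>?C. e' $ k * e $ k) + (\<Sum>k\<in>J. e' $ k * e $ k)"
      by (rule sum.subset_diff[OF J]) simp
    finally show ?thesis by (simp add: sum_distrib_right distrib_right)
  qed
  ultimately show ?thesis by (simp add: sum.distrib sum_subtractf)
qed

section \<open>Invariants as traces, Krylov vectors and Cayley-Hamilton\<close>

text \<open>The trace of the i-th exterior power of \<open>A\<close>, that is, a coefficient of the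
  characteristic polynomial up to sign.\<close>

definition principal_sum :: "nat \<Rightarrow> 'r::comm_ring_1 mat \<Rightarrow> nat \<Rightarrow> 'r" where
  "principal_sum n A i = (\<Sum>I\<in>subsets_of_card n i. minor A I I)"

definition krylov :: "'r::comm_ring_1 mat \<Rightarrow> 'r vec \<Rightarrow> nat \<Rightarrow> 'r vec" where
  "krylov A f j = (mult_mat_vec A ^^ j) f"

text \<open>The index is one less than in \<open>inv_b\<close>: the trace is taken on the i-th
  exterior power, and the value corresponds to the invariant b of index \<open>i + 1\<close> before
  scaling.\<close>

definition bordered_trace :: "nat \<Rightarrow> 'r::comm_ring_1 mat \<Rightarrow> 'r vec \<Rightarrow> 'r vec \<Rightarrow> nat \<Rightarrow> 'r" where
  "bordered_trace n A e' f i = (\<Sum>J\<in>subsets_of_card n i.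
     contraction n e' (ext_apply n (Suc i) (minor A) (wedge_left f (ext_basis J))) J)"

lemma krylov_0 [simp]: "krylov A f 0 = f"
  by (simp add: krylov_def)

lemma krylov_Suc: "krylov A f (Suc j) = A *\<^sub>v krylov A f j"
  by (simp add: krylov_def)

lemma krylov_mult: "krylov A (A *\<^sub>v f) j = krylov A f (Suc j)"
  by (simp add: krylov_def funpow_swap1)

lemma krylov_carrier [simp]:
  "A \<in> carrier_mat n n \<Longrightarrow> f \<in> carrier_vec n \<Longrightarrow> krylov A f j \<in> carrier_vec n"
  by (induction j) (auto simp: krylov_Suc)

lemma ext_apply_basis:
  "J \<in> subsets_of_card n i \<Longrightarrow> ext_apply n i M (ext_basis J) I = M I J"
  by (simp add: ext_apply_def ext_basis_def if_distrib[of "\<lambda>x. _ * x"] cong: if_cong)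

lemma ext_apply_wedge_left_basis:
  assumes J: "J \<in> subsets_of_card n i"
  shows "ext_apply n (Suc i) M (wedge_left f (ext_basis J)) I =
         (\<Sum>l\<in>{..<n} - J. (-1) ^ pos J l * f $ l * M I (insert l J))"
proof -
  have "ext_apply n (Suc i) M (wedge_left f (ext_basis J)) I =
     (\<Sum>K\<in>subsets_of_card n (Suc i). \<Sum>l\<in>K. M I K * ((-1) ^ pos K l * f $ l * ext_basis J (K - {l})))"
    by (simp add: ext_apply_def wedge_left_pos sum_distrib_left)
  also have "\<dots> = (\<Sum>K\<in>subsets_of_card n i. \<Sum>l\<in>{..<n} - K.
      M I (insert l K) * ((-1) ^ pos K l * f $ l * ext_basis J K))"
    unfolding sum_subsets_of_card_Suc by (rule sum.cong[OF refl], rule sum.cong[OF refl]) simp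
  also have "\<dots> = (\<Sum>K\<in>subsets_of_card n i. if K = J then
      (\<Sum>l\<in>{..<n} - J. (-1) ^ pos J l * f $ l * M I (insert l J)) else 0)"
    by (rule sum.cong[OF refl]) (simp add: ext_basis_def mult_ac)
  also have "\<dots> = (\<Sum>l\<in>{..<n} - J. (-1) ^ pos J l * f $ l * M I (insert l J))"
    using J by simp
  finally show ?thesis .
qed

lemma contraction_sum:
  "contraction n e' (\<lambda>I. \<Sum>l\<in>L. c l * M l I) J = (\<Sum>l\<in>L. c l * contraction n e' (M l) J)"
proof -
  have "contraction n e' (\<lambda>I. \<Sum>l\<in>L. c l * M l I) J =
     (\<Sum>k\<in>{..<n} - J. \<Sum>l\<in>L. (-1) ^ pos J k * e' $ k * (c l * M l (insert k J)))"
    by (simp only: contraction_pos sum_distrib_left)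
  also have "\<dots> = (\<Sum>l\<in>L. \<Sum>k\<in>{..<n} - J. (-1) ^ pos J k * e' $ k * (c l * M l (insert k J)))"
    by (rule sum.swap)
  also have "\<dots> = (\<Sum>l\<in>L. c l * contraction n e' (M l) J)"
    by (simp only: contraction_pos sum_distrib_left mult_ac)
  finally show ?thesis .
qed

text \<open>Cyclicity of the trace: wedging with \<open>g\<close> moves from the left end of the
  composite to the right end, so the trace passes from degree \<open>i + 1\<close> to degree
  \<open>i\<close>.\<close>

lemma bordered_trace_cyclic:
  "(\<Sum>J\<in>subsets_of_card n (Suc i). wedge_left g (contraction n e' (\<lambda>I. minor A I J)) J) =
   bordered_trace n A e' g i"
proof -
  have "(\<Sum>J\<in>subsets_of_card n (Suc i). wedge_left g (contraction n e' (\<lambda>I. minor A I J)) J) =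
     (\<Sum>J\<in>subsets_of_card n i. \<Sum>l\<in>{..<n} - J.
        (-1) ^ pos J l * g $ l * contraction n e' (\<lambda>I. minor A I (insert l J)) J)"
    unfolding wedge_left_pos sum_subsets_of_card_Suc
    by (rule sum.cong[OF refl], rule sum.cong[OF refl]) simp
  also have "\<dots> = bordered_trace n A e' g i"
    unfolding bordered_trace_def
  proof (rule sum.cong[OF refl])
    fix J assume J: "J \<in> subsets_of_card n i"
    show "(\<Sum>l\<in>{..<n} - J. (-1) ^ pos J l * g $ l * contraction n e' (\<lambda>I. minor A I (insert l J)) J) =
       contraction n e' (ext_apply n (Suc i) (minor A) (wedge_left g (ext_basis J))) J"
      unfolding contraction_sum[symmetric]
      by (rule contraction_cong) (rule ext_apply_wedge_left_basis[OF J, symmetric])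
  qed
  finally show ?thesis .
qed

text \<open>Functoriality replaces wedging with \<open>f\<close> before \<open>A\<close> by wedging
  with \<open>A f\<close> after it; the Clifford relation then exchanges this wedge with the
  contraction. The remaining sum is, by cyclicity, a bordered trace of lower degree.\<close>

lemma bordered_trace_eq:
  assumes A: "A \<in> carrier_mat n n" and f: "f \<in> carrier_vec n"
  shows "bordered_trace n A e' f i = principal_sum n A i * (e' \<bullet> (A *\<^sub>v f)) -
     (\<Sum>J\<in>subsets_of_card n i. wedge_left (A *\<^sub>v f) (contraction n e' (\<lambda>I. minor A I J)) J)"
proof -
  have "bordered_trace n A e' f i = (\<Sum>J\<in>subsets_of_card n i. (e' \<bullet> (A *\<^sub>v f)) * minor A J J -
     wedge_left (A *\<^sub>v f) (contraction n e' (\<lambda>I. minor A I J)) J)"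
    unfolding bordered_trace_def
  proof (rule sum.cong[OF refl])
    fix J assume J: "J \<in> subsets_of_card n i"
    note Jd = subsets_of_cardD[OF J]
    have "contraction n e' (ext_apply n (Suc i) (minor A) (wedge_left f (ext_basis J))) J =
       contraction n e' (wedge_left (A *\<^sub>v f) (ext_apply n i (minor A) (ext_basis J))) J"
    proof (rule contraction_cong)
      fix k assume "k \<in> {..<n} - J"
      then have "insert k J \<in> subsets_of_card n (Suc i)"
        using Jd by (simp add: subsets_of_card_def)
      then show "ext_apply n (Suc i) (minor A) (wedge_left f (ext_basis J)) (insert k J) =
        wedge_left (A *\<^sub>v f) (ext_apply n i (minor A) (ext_basis J)) (insert k J)"
        by (rule ext_apply_wedge_left[OF A f])
    qed
    also have "\<dots> = contraction n e' (wedge_left (A *\<^sub>v f) (\<lambda>I. minor A I J)) J"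
      by (rule contraction_cong, rule wedge_left_cong, rule ext_apply_basis[OF J])
    also have "\<dots> = (e' \<bullet> (A *\<^sub>v f)) * minor A J J -
       wedge_left (A *\<^sub>v f) (contraction n e' (\<lambda>I. minor A I J)) J"
      using contraction_wedge_left[OF Jd(1), of "A *\<^sub>v f" e' "\<lambda>I. minor A I J"] A f
      by (simp add: eq_diff_eq)
    finally show "contraction n e' (ext_apply n (Suc i) (minor A) (wedge_left f (ext_basis J))) J =
       (e' \<bullet> (A *\<^sub>v f)) * minor A J J - wedge_left (A *\<^sub>v f) (contraction n e' (\<lambda>I. minor A I J)) J" .
  qed
  then show ?thesis
    by (simp add: sum_subtractf sum_distrib_left[symmetric] principal_sum_def mult.commute[of "principal_sum n A i" for i]
        mult.commute[of "sum f S" for f S])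
qed

lemma subsets_of_card_0: "subsets_of_card n 0 = {{}}"
  by (auto simp: subsets_of_card_def dest: finite_subset[OF _ finite_lessThan])

text \<open>Iterating the previous identity replaces \<open>f\<close> by \<open>A f\<close> and
  flips the sign at each step. Since \<open>principal_sum n A 0 = 1\<close>, the invariants b and
  the moments determine each other triangularly.\<close>

lemma bordered_trace_krylov:
  assumes A: "A \<in> carrier_mat n n" and f: "f \<in> carrier_vec n"
  shows "bordered_trace n A e' f i =
     (\<Sum>j\<le>i. (-1) ^ j * principal_sum n A (i - j) * (e' \<bullet> krylov A f (Suc j)))"
  using f
proof (induction i arbitrary: f)
  case 0
  then show ?case
    by (subst bordered_trace_eq[OF A]) (simp_all add: subsets_of_card_0 wedge_left_def krylov_Suc)
next
  case (Suc i)
  have "bordered_trace n A e' f (Suc i) =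
      principal_sum n A (Suc i) * (e' \<bullet> (A *\<^sub>v f)) - bordered_trace n A e' (A *\<^sub>v f) i"
    by (simp only: bordered_trace_eq[OF A Suc.prems] bordered_trace_cyclic)
  also have "bordered_trace n A e' (A *\<^sub>v f) i =
      (\<Sum>j\<le>i. (-1) ^ j * principal_sum n A (i - j) * (e' \<bullet> krylov A f (Suc (Suc j))))"
    using Suc.IH[of "A *\<^sub>v f"] A Suc.prems by (simp add: krylov_mult)
  finally show ?case
    by (simp only: sum.atMost_Suc_shift) (simp add: sum_negf krylov_Suc)
qed

lemma principal_sum_0 [simp]: "principal_sum n A 0 = 1"
  by (simp add: principal_sum_def subsets_of_card_0 submatrix_def)

lemma subsets_of_card_self: "subsets_of_card n n = {{..<n}}"
  using card_subset_eq[of "{..<n}"] by (auto simp: subsets_of_card_def)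

lemma submatrix_self:
  assumes "A \<in> carrier_mat n n"
  shows "submatrix A {..<n} {..<n} = A"
proof -
  have p: "pick {..<n} i = i" if "i < n" for i
  proof -
    have "{j \<in> {..<n}. j < i} = {..<i}" using that by auto
    then have "pos {..<n} i = i" by (simp add: pos_def)
    then show ?thesis using pick_pos[of i "{..<n}"] that by simp
  qed
  show ?thesis
    using assms by (intro eq_matI) (auto simp: submatrix_subset[OF assms] p)
qed

lemma principal_sum_self: "A \<in> carrier_mat n n \<Longrightarrow> principal_sum n A n = det A"
  by (simp add: principal_sum_def subsets_of_card_self submatrix_self)

text \<open>The case \<open>i = n\<close> of the trace formula, where the exterior power of degree
  \<open>n + 1\<close> vanishes. The shift \<open>Suc j\<close> means that the relation is
  multiplied by one extra factor \<open>A\<close>.\<close>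

lemma cayley_hamilton_krylov:
  assumes A: "A \<in> carrier_mat n n" and f: "f \<in> carrier_vec n"
  shows "(\<Sum>j\<le>n. (-1) ^ j * principal_sum n A (n - j) * (e' \<bullet> krylov A f (Suc j))) = 0"
  by (subst bordered_trace_krylov[OF A f, symmetric])
    (simp add: bordered_trace_def subsets_of_card_self contraction_def)

section \<open>The vectors and covectors of the discriminant\<close>

definition wedges :: "'r::comm_ring_1 vec list \<Rightarrow> nat set \<Rightarrow> 'r" where
  "wedges vs = foldr wedge_left vs (ext_basis {})"

text \<open>Prepending a vector to the wedge product is Laplace expansion along the first
  column.\<close>

lemma wedges_row_det:
  assumes "finite I" "card I = length vs"
  shows "wedges vs I = row_det I (\<lambda>k q. vs ! q $ k)"
  using assms
proof (induction vs arbitrary: I)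
  case Nil
  then show ?case by (simp add: wedges_def ext_basis_def row_det_def)
next
  case (Cons v vs)
  have "wedges (v # vs) I = (\<Sum>k\<in>I. (-1) ^ pos I k * v $ k * wedges vs (I - {k}))"
    by (simp add: wedges_def wedge_left_pos)
  also have "\<dots> = (\<Sum>k\<in>I. (-1) ^ (pos I k + 0) * (v # vs) ! 0 $ k *
      row_det (I - {k}) (\<lambda>k' q'. (v # vs) ! insert_index 0 q' $ k'))"
    using Cons by (intro sum.cong refl) (simp add: insert_index_def)
  also have "\<dots> = row_det I (\<lambda>k q. (v # vs) ! q $ k)"
    by (rule row_det_laplace[symmetric]) (use Cons.prems in auto)
  finally show ?case .
qed

lemma ext_apply_wedges:
  assumes A: "A \<in> carrier_mat n n"
  shows "set vs \<subseteq> carrier_vec n \<Longrightarrow> I \<in> subsets_of_card n (length vs) \<Longrightarrow>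
     ext_apply n (length vs) (minor A) (wedges vs) I = wedges (map (mult_mat_vec A) vs) I"
proof (induction vs arbitrary: I)
  case Nil
  then show ?case
    by (simp add: wedges_def ext_apply_def subsets_of_card_0 submatrix_def)
next
  case (Cons v vs)
  have I: "I \<in> subsets_of_card n (Suc (length vs))" using Cons.prems by simp
  have "ext_apply n (Suc (length vs)) (minor A) (wedge_left v (wedges vs)) I =
     wedge_left (A *\<^sub>v v) (ext_apply n (length vs) (minor A) (wedges vs)) I"
    by (rule ext_apply_wedge_left[OF A _ I]) (use Cons.prems in simp)
  also have "\<dots> = wedge_left (A *\<^sub>v v) (wedges (map (mult_mat_vec A) vs)) I"
  proof (rule wedge_left_cong)
    fix k assume "k \<in> I"
    then have "I - {k} \<in> subsets_of_card n (length vs)"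
      using subsets_of_cardD[OF I] by (auto simp: subsets_of_card_def)
    then show "ext_apply n (length vs) (minor A) (wedges vs) (I - {k}) = wedges (map (mult_mat_vec A) vs) (I - {k})"
      using Cons by simp
  qed
  finally show ?case by (simp add: wedges_def)
qed

text \<open>Each step puts \<open>e\<close> in front and then applies \<open>A\<close> to every
  factor, so the factors become \<open>A e, ..., A^i e\<close>, and one scalar \<open>d j\<close> is
  collected per application.\<close>

lemma disc_vector_wedges:
  fixes A :: "'r::comm_ring_1 mat"
  assumes A: "A \<in> carrier_mat n n" and e: "e \<in> carrier_vec n"
    and x: "\<And>i I J. i \<in> {1..<n} \<Longrightarrow> I \<in> subsets_of_card n i \<Longrightarrow> J \<in> subsets_of_card n i \<Longrightarrow>
              x i I J = d i * minor A I J"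
  shows "i < n \<Longrightarrow> I \<in> subsets_of_card n i \<Longrightarrow>
     disc_vector n x e i I = (\<Prod>j\<in>{1..i}. d j) * wedges (map (\<lambda>j. krylov A e (Suc j)) [0..<i]) I"
proof (induction i arbitrary: I)
  case 0
  then show ?case by (simp add: wedges_def)
next
  case (Suc i)
  let ?vs = "map (\<lambda>j. krylov A e (Suc j)) [0..<i]"
  let ?c = "\<Prod>j\<in>{1..i}. d j"
  have wl: "wedge_left e (disc_vector n x e i) J = ?c * wedges (e # ?vs) J"
    if J: "J \<in> subsets_of_card n (Suc i)" for J
  proof -
    have "wedge_left e (disc_vector n x e i) J = wedge_left e (\<lambda>I. ?c * wedges ?vs I) J"
    proof (rule wedge_left_cong)
      fix k assume "k \<in> J"
      then have "J - {k} \<in> subsets_of_card n i"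
        using subsets_of_cardD[OF J] by (auto simp: subsets_of_card_def)
      then show "disc_vector n x e i (J - {k}) = ?c * wedges ?vs (J - {k})"
        using Suc by simp
    qed
    also have "\<dots> = ?c * wedge_left e (wedges ?vs) J"
      by (simp only: wedge_left_pos sum_distrib_left mult_ac)
    finally show ?thesis by (simp add: wedges_def)
  qed
  have "disc_vector n x e (Suc i) I = ext_apply n (Suc i) (x (Suc i)) (wedge_left e (disc_vector n x e i)) I"
    using Suc.prems by simp
  also have "\<dots> = (\<Sum>J\<in>subsets_of_card n (Suc i). d (Suc i) * minor A I J * (?c * wedges (e # ?vs) J))"
    unfolding ext_apply_def using Suc.prems by (intro sum.cong refl) (simp add: wl x)
  also have "\<dots> = d (Suc i) * ?c * ext_apply n (length (e # ?vs)) (minor A) (wedges (e # ?vs)) I"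
    by (simp add: ext_apply_def sum_distrib_left mult_ac)
  also have "\<dots> = d (Suc i) * ?c * wedges (map (mult_mat_vec A) (e # ?vs)) I"
    using Suc.prems A e by (subst ext_apply_wedges[OF A]) auto
  also have "map (mult_mat_vec A) (e # ?vs) = map (\<lambda>j. krylov A e (Suc j)) [0..<Suc i]"
    unfolding upt_conv_Cons[OF zero_less_Suc] map_Suc_upt[symmetric]
    by (simp add: krylov_Suc)
  also have "d (Suc i) * ?c = (\<Prod>j\<in>{1..Suc i}. d j)"
    by (simp add: mult.commute)
  finally show ?case .
qed

definition krylov_mat :: "nat \<Rightarrow> 'r::comm_ring_1 mat \<Rightarrow> 'r vec \<Rightarrow> 'r mat" where
  "krylov_mat n A e = mat n n (\<lambda>(p, q). krylov A e q $ p)"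

text \<open>The last step of the recursion only wedges with \<open>e\<close> and applies no
  endomorphism; hence the exponents are \<open>0, ..., n - 1\<close> and the scalars stop at
  \<open>n - 1\<close>.\<close>

lemma disc_vector_krylov:
  fixes A :: "'r::comm_ring_1 mat"
  assumes A: "A \<in> carrier_mat n n" and e: "e \<in> carrier_vec n"
    and x: "\<And>i I J. i \<in> {1..<n} \<Longrightarrow> I \<in> subsets_of_card n i \<Longrightarrow> J \<in> subsets_of_card n i \<Longrightarrow>
              x i I J = d i * minor A I J"
    and n: "n \<ge> 1"
  shows "disc_vector n x e n {..<n} = (\<Prod>j\<in>{1..<n}. d j) * det (krylov_mat n A e)"
proof -
  obtain m where m: "n = Suc m" using n by (cases n) auto
  let ?vs = "map (\<lambda>j. krylov A e (Suc j)) [0..<m]"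
  have "disc_vector n x e n {..<n} = wedge_left e (disc_vector n x e m) {..<n}"
    by (simp add: m)
  also have "\<dots> = wedge_left e (\<lambda>I. (\<Prod>j\<in>{1..m}. d j) * wedges ?vs I) {..<n}"
  proof (rule wedge_left_cong)
    fix k assume "k \<in> {..<n}"
    then have "{..<n} - {k} \<in> subsets_of_card n m"
      by (auto simp: subsets_of_card_def m)
    then show "disc_vector n x e m ({..<n} - {k}) = (\<Prod>j\<in>{1..m}. d j) * wedges ?vs ({..<n} - {k})"
      using disc_vector_wedges[OF A e x, where i = m and I = "{..<n} - {k}"] m by simp
  qed
  also have "\<dots> = (\<Prod>j\<in>{1..m}. d j) * wedge_left e (wedges ?vs) {..<n}"
    by (simp only: wedge_left_pos sum_distrib_left mult_ac)
  also have "wedge_left e (wedges ?vs) = wedges (map (krylov A e) [0..<n])"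
    unfolding m upt_conv_Cons[OF zero_less_Suc] map_Suc_upt[symmetric]
    by (simp add: wedges_def o_def)
  also have "wedges (map (krylov A e) [0..<n]) {..<n} = row_det {..<n} (\<lambda>k q. krylov A e q $ k)"
    by (subst wedges_row_det) (auto intro!: row_det_cong)
  also have "\<dots> = det (krylov_mat n A e)"
  proof -
    have p: "pick {..<n} i = i" if "i < n" for i
    proof -
      have "{j \<in> {..<n}. j < i} = {..<i}" using that by auto
      then have "pos {..<n} i = i" by (simp add: pos_def)
      then show ?thesis using pick_pos[of i "{..<n}"] that by simp
    qed
    show ?thesis
      unfolding row_det_def krylov_mat_def
      by (rule arg_cong[of _ _ det], rule eq_matI) (auto simp: p)
  qed
  also have "{1..m} = {1..<n}" by (auto simp: m)
  finally show ?thesis .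
qed

lemma inv_a_scaled_minor:
  assumes "\<And>I J. I \<in> subsets_of_card n i \<Longrightarrow> J \<in> subsets_of_card n i \<Longrightarrow> x i I J = d * minor A I J"
  shows "inv_a n x i = d * principal_sum n A i"
  using assms by (simp add: inv_a_def principal_sum_def sum_distrib_left)

lemma inv_b_scaled_minor:
  assumes x: "\<And>I J. I \<in> subsets_of_card n (Suc i) \<Longrightarrow> J \<in> subsets_of_card n (Suc i) \<Longrightarrow>
    x (Suc i) I J = d * minor A I J"
  shows "inv_b n x e e' (Suc i) = d * bordered_trace n A e' e i"
proof -
  have "contraction n e' (ext_apply n (Suc i) (x (Suc i)) w) J =
      d * contraction n e' (ext_apply n (Suc i) (minor A) w) J"
    if J: "J \<in> subsets_of_card n i" for w J
  proof -
    have "contraction n e' (ext_apply n (Suc i) (x (Suc i)) w) J =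
       contraction n e' (\<lambda>I. d * ext_apply n (Suc i) (minor A) w I) J"
    proof (rule contraction_cong)
      fix k assume "k \<in> {..<n} - J"
      then have "insert k J \<in> subsets_of_card n (Suc i)"
        using subsets_of_cardD[OF J] by (simp add: subsets_of_card_def)
      then show "ext_apply n (Suc i) (x (Suc i)) w (insert k J) =
          d * ext_apply n (Suc i) (minor A) w (insert k J)"
        by (simp add: ext_apply_def x sum_distrib_left mult_ac)
    qed
    also have "\<dots> = d * contraction n e' (ext_apply n (Suc i) (minor A) w) J"
      by (simp only: contraction_def sum_distrib_left mult_ac)
    finally show ?thesis .
  qed
  then show ?thesis
    by (simp add: inv_b_def bordered_trace_def sum_distrib_left)
qed

text \<open>Moving the new factor from the right end to the left end passes \<open>i\<close>
  factors.\<close>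

lemma wedge_right_eq:
  fixes e' :: "'r::comm_ring_1 vec"
  assumes "finite I" "card I = Suc i"
  shows "wedge_right w e' I = (-1) ^ i * wedge_left e' w I"
proof -
  have s: "(-1 :: 'r) ^ card {j \<in> I. k < j} = (-1) ^ i * (-1) ^ pos I k" if k: "k \<in> I" for k
  proof -
    have "I = insert k ({j \<in> I. j < k} \<union> {j \<in> I. k < j})" using k by auto
    moreover have "card (insert k ({j \<in> I. j < k} \<union> {j \<in> I. k < j})) =
        Suc (card ({j \<in> I. j < k} \<union> {j \<in> I. k < j}))"
      using assms(1) by (intro card_insert_disjoint) auto
    ultimately have "card I = Suc (card ({j \<in> I. j < k} \<union> {j \<in> I. k < j}))"
      by (simp only:)
    also have "card ({j \<in> I. j < k} \<union> {j \<in> I. k < j}) = pos I k + card {j \<in> I. k < j}"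
      unfolding pos_def using assms(1) by (intro card_Un_disjoint) auto
    finally have "i = pos I k + card {j \<in> I. k < j}" using assms(2) by simp
    then show ?thesis by (simp add: power_add mult.commute[of _ "(-1) ^ pos I k"])
  qed
  have "wedge_right w e' I = (\<Sum>k\<in>I. (-1) ^ i * ((-1) ^ pos I k * e' $ k * w (I - {k})))"
    unfolding wedge_right_def by (rule sum.cong[OF refl]) (simp add: s mult_ac)
  then show ?thesis by (simp only: wedge_left_pos sum_distrib_left)
qed

text \<open>Reduces covectors to vectors: a row vector times \<open>x\<close> is the transpose of
  \<open>x\<close> applied to a column, and the wedge order contributes one sign
  \<open>(-1) ^ j\<close> for each degree.\<close>

lemma disc_covector_eq:
  fixes e' :: "'r::comm_ring_1 vec"
  shows "i \<le> n \<Longrightarrow> I \<in> subsets_of_card n i \<Longrightarrow>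
   disc_covector n x e' i I = (\<Prod>j<i. (-1) ^ j) * disc_vector n (\<lambda>i I J. x i J I) e' i I"
proof (induction i arbitrary: I)
  case 0
  then show ?case by simp
next
  case (Suc i)
  let ?v = "disc_vector n (\<lambda>i I J. x i J I) e' i"
  let ?c = "\<Prod>j<i. (-1 :: 'r) ^ j"
  have w: "wedge_right (disc_covector n x e' i) e' J = (\<Prod>j<Suc i. (-1) ^ j) * wedge_left e' ?v J"
    if J: "J \<in> subsets_of_card n (Suc i)" for J
  proof -
    have "wedge_right (disc_covector n x e' i) e' J = (-1) ^ i * wedge_left e' (disc_covector n x e' i) J"
      using subsets_of_cardD[OF J] by (intro wedge_right_eq)
    also have "wedge_left e' (disc_covector n x e' i) J = wedge_left e' (\<lambda>I. ?c * ?v I) J"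
    proof (rule wedge_left_cong)
      fix k assume "k \<in> J"
      then have "J - {k} \<in> subsets_of_card n i"
        using subsets_of_cardD[OF J] by (auto simp: subsets_of_card_def)
      then show "disc_covector n x e' i (J - {k}) = ?c * ?v (J - {k})"
        using Suc by simp
    qed
    also have "\<dots> = ?c * wedge_left e' ?v J"
      by (simp only: wedge_left_pos sum_distrib_left mult_ac)
    finally show ?thesis by (simp add: mult_ac)
  qed
  show ?case
  proof (cases "Suc i < n")
    case True
    then have "disc_covector n x e' (Suc i) I =
       (\<Sum>J\<in>subsets_of_card n (Suc i). (\<Prod>j<Suc i. (-1) ^ j) * wedge_left e' ?v J * x (Suc i) J I)"
      by (simp add: ext_row_apply_def w)
    also have "\<dots> = (\<Prod>j<Suc i. (-1) ^ j) * disc_vector n (\<lambda>i I J. x i J I) e' (Suc i) I"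
      using True by (simp only: disc_vector.simps if_True ext_apply_def sum_distrib_left mult_ac)
    finally show ?thesis .
  next
    case False
    then show ?thesis using w[OF Suc.prems(2)] by simp
  qed
qed

lemma minor_transpose:
  assumes A: "A \<in> carrier_mat n n" and I: "I \<in> subsets_of_card n i" and J: "J \<in> subsets_of_card n i"
  shows "minor A\<^sup>T I J = minor A J I"
proof -
  note Id = subsets_of_cardD[OF I] and Jd = subsets_of_cardD[OF J]
  have "submatrix A\<^sup>T I J = (submatrix A J I)\<^sup>T"
    unfolding submatrix_subset[OF A Jd(1) Id(1)]
      submatrix_subset[OF transpose_carrier_mat[THEN iffD2, OF A] Id(1) Jd(1)]
  proof (rule eq_matI)
    fix p q assume "p < dim_row (mat (card J) (card I) (\<lambda>(p, q). A $$ (pick J p, pick I q)))\<^sup>T"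
      "q < dim_col (mat (card J) (card I) (\<lambda>(p, q). A $$ (pick J p, pick I q)))\<^sup>T"
    then have pq: "p < card I" "q < card J" by auto
    then have "pick I p < n" "pick J q < n"
      using Id(1) Jd(1) pick_in_set_le[of p I] pick_in_set_le[of q J] by auto
    then show "mat (card I) (card J) (\<lambda>(p, q). A\<^sup>T $$ (pick I p, pick J q)) $$ (p, q) =
       (mat (card J) (card I) (\<lambda>(p, q). A $$ (pick J p, pick I q)))\<^sup>T $$ (p, q)"
      using pq A by simp
  qed auto
  then show ?thesis
    using det_transpose[of "submatrix A J I" i] Id Jd by (simp add: submatrix_subset[OF A Jd(1) Id(1)])
qed

section \<open>Moments and the recursions that determine them\<close>

lemma krylov_transpose_scalar_prod:
  fixes A :: "'r::comm_ring_1 mat"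
  assumes A: "A \<in> carrier_mat n n" and u: "u \<in> carrier_vec n" and v: "v \<in> carrier_vec n"
  shows "krylov A\<^sup>T u i \<bullet> krylov A v j = u \<bullet> krylov A v (i + j)"
proof (induction i arbitrary: j)
  case (Suc i)
  have "krylov A\<^sup>T u (Suc i) \<bullet> krylov A v j = krylov A\<^sup>T u i \<bullet> krylov A v (Suc j)"
    unfolding krylov_Suc by (rule transpose_vec_mult_scalar[OF A]) (use A u v in simp_all)
  then show ?case using Suc[of "Suc j"] by simp
qed simp

text \<open>The product is the determinant of the Gram matrix between the two Krylov bases. Its
  entries depend on \<open>i + j\<close> only, so it is a Hankel determinant of moments and sees
  nothing else of \<open>A\<close>, \<open>u\<close> and \<open>v\<close>.\<close>

lemma krylov_gram:
  fixes A :: "'r::comm_ring_1 mat"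
  assumes A: "A \<in> carrier_mat n n" and u: "u \<in> carrier_vec n" and v: "v \<in> carrier_vec n"
  shows "det (krylov_mat n A\<^sup>T u) * det (krylov_mat n A v) =
         det (mat n n (\<lambda>(i, j). u \<bullet> krylov A v (i + j)))"
proof -
  have c: "krylov_mat n B w \<in> carrier_mat n n" for B :: "'r mat" and w by (simp add: krylov_mat_def)
  have "(krylov_mat n A\<^sup>T u)\<^sup>T * krylov_mat n A v = mat n n (\<lambda>(i, j). u \<bullet> krylov A v (i + j))"
  proof (rule eq_matI)
    fix i j assume "i < dim_row (mat n n (\<lambda>(i, j). u \<bullet> krylov A v (i + j)))"
      "j < dim_col (mat n n (\<lambda>(i, j). u \<bullet> krylov A v (i + j)))"
    then have ij: "i < n" "j < n" by auto
    have cols: "col (krylov_mat n B w) k = krylov B w k"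
      if "B \<in> carrier_mat n n" "w \<in> carrier_vec n" "k < n" for B :: "'r mat" and w k
      using that by (intro eq_vecI) (simp_all add: krylov_mat_def carrier_vecD[OF krylov_carrier[of B n w]])
    show "((krylov_mat n A\<^sup>T u)\<^sup>T * krylov_mat n A v) $$ (i, j) =
      mat n n (\<lambda>(i, j). u \<bullet> krylov A v (i + j)) $$ (i, j)"
      using ij c[of A v] c[of "A\<^sup>T" u] A u v cols
      by (simp add: krylov_transpose_scalar_prod[OF A u v])
  qed (auto simp: krylov_mat_def)
  then show ?thesis
    using det_mult[of "(krylov_mat n A\<^sup>T u)\<^sup>T" n "krylov_mat n A v"] c det_transpose[OF c]
    by simp
qed

definition moment :: "'r::comm_ring_1 mat \<Rightarrow> 'r vec \<Rightarrow> 'r vec \<Rightarrow> nat \<Rightarrow> 'r" where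
  "moment A e' e m = e' \<bullet> krylov A e m"

lemma disc_product_krylov:
  fixes A :: "'r::comm_ring_1 mat"
  assumes A: "A \<in> carrier_mat n n" and e: "e \<in> carrier_vec n" and e': "e' \<in> carrier_vec n"
    and x: "\<And>i I J. i \<in> {1..<n} \<Longrightarrow> I \<in> subsets_of_card n i \<Longrightarrow> J \<in> subsets_of_card n i \<Longrightarrow>
              x i I J = d i * minor A I J"
    and n: "n \<ge> 1"
  shows "disc_covector n x e' n {..<n} * disc_vector n x e n {..<n} =
    (\<Prod>j<n. (-1) ^ j) * (\<Prod>j\<in>{1..<n}. d j) ^ 2 * (det (krylov_mat n A\<^sup>T e') * det (krylov_mat n A e))"
proof -
  have "disc_vector n (\<lambda>i I J. x i J I) e' n {..<n} = (\<Prod>j\<in>{1..<n}. d j) * det (krylov_mat n A\<^sup>T e')"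
    by (rule disc_vector_krylov) (use A e' n x in \<open>auto simp: minor_transpose[OF A]\<close>)
  then have "disc_covector n x e' n {..<n} =
      (\<Prod>j<n. (-1) ^ j) * ((\<Prod>j\<in>{1..<n}. d j) * det (krylov_mat n A\<^sup>T e'))"
    by (subst disc_covector_eq) (simp_all add: subsets_of_card_self)
  moreover have "disc_vector n x e n {..<n} = (\<Prod>j\<in>{1..<n}. d j) * det (krylov_mat n A e)"
    by (rule disc_vector_krylov[OF A e x n])
  ultimately show ?thesis by (simp only: power2_eq_square mult_ac)
qed

text \<open>In equation \<open>i\<close> the unknown of highest index, \<open>mu (Suc i)\<close>,
  has coefficient \<open>(-1) ^ i * p 0\<close>, a unit.\<close>

lemma triangular_recursion_unique:
  fixes mu nu p :: "nat \<Rightarrow> 'f::comm_ring_1"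
  assumes p: "p 0 = 1" and zero: "mu 0 = nu 0"
    and rec: "\<And>i. Suc i < n \<Longrightarrow> (\<Sum>j\<le>i. (-1) ^ j * p (i - j) * mu (Suc j)) =
                (\<Sum>j\<le>i. (-1) ^ j * p (i - j) * nu (Suc j))"
  shows "m < n \<Longrightarrow> mu m = nu m"
proof (induction m rule: less_induct)
  case (less m)
  show ?case
  proof (cases m)
    case 0
    then show ?thesis using zero by simp
  next
    case (Suc i)
    have "(\<Sum>j<i. (-1) ^ j * p (i - j) * mu (Suc j)) = (\<Sum>j<i. (-1) ^ j * p (i - j) * nu (Suc j))"
      using less Suc by (intro sum.cong refl) simp
    moreover have "(\<Sum>j\<le>i. (-1) ^ j * p (i - j) * mu (Suc j)) = (\<Sum>j\<le>i. (-1) ^ j * p (i - j) * nu (Suc j))"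
      by (rule rec) (use less Suc in simp)
    ultimately have "(-1) ^ i * mu m = (-1) ^ i * nu m"
      by (simp add: lessThan_Suc_atMost[symmetric] p Suc)
    then have "(-1) ^ i * ((-1) ^ i * mu m) = (-1) ^ i * ((-1) ^ i * nu m)" by simp
    then show ?thesis by simp
  qed
qed

lemma linear_recurrence_unique:
  fixes mu nu p :: "nat \<Rightarrow> 'f::comm_ring_1"
  assumes p: "p 0 = 1"
    and init: "\<And>m. m < n \<Longrightarrow> mu m = nu m"
    and mu: "\<And>m. (\<Sum>j\<le>n. (-1) ^ j * p (n - j) * mu (m + j)) = 0"
    and nu: "\<And>m. (\<Sum>j\<le>n. (-1) ^ j * p (n - j) * nu (m + j)) = 0"
  shows "mu m = nu m"
proof (induction m rule: less_induct)
  case (less m)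
  show ?case
  proof (cases "m < n")
    case True
    then show ?thesis by (rule init)
  next
    case False
    define k where "k = m - n"
    then have m: "m = k + n" using False by simp
    have "(\<Sum>j<n. (-1) ^ j * p (n - j) * mu (k + j)) = (\<Sum>j<n. (-1) ^ j * p (n - j) * nu (k + j))"
    proof (rule sum.cong[OF refl])
      fix j assume "j \<in> {..<n}"
      then have "k + j < m" using m by simp
      then show "(-1) ^ j * p (n - j) * mu (k + j) = (-1) ^ j * p (n - j) * nu (k + j)"
        by (simp only: less.IH)
    qed
    then have "(-1) ^ n * mu m = (-1) ^ n * nu m"
      using mu[of k] nu[of k] by (simp add: lessThan_Suc_atMost[symmetric] p m add_eq_0_iff)
    then have "(-1) ^ n * ((-1) ^ n * mu m) = (-1) ^ n * ((-1) ^ n * nu m)" by simp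
    then show ?thesis by simp
  qed
qed

lemma mat_mult_vec_surj:
  fixes A :: "'f::field mat"
  assumes A: "A \<in> carrier_mat n n" and d: "det A \<noteq> 0" and f: "f \<in> carrier_vec n"
  obtains g where "g \<in> carrier_vec n" "A *\<^sub>v g = f"
proof
  show "(inverse (det A) \<cdot>\<^sub>m adj_mat A) *\<^sub>v f \<in> carrier_vec n"
    by (intro mult_mat_vec_carrier[of _ n n] smult_carrier_mat adj_mat(1)[OF A] f)
  have "A *\<^sub>v ((inverse (det A) \<cdot>\<^sub>m adj_mat A) *\<^sub>v f) = (A * (inverse (det A) \<cdot>\<^sub>m adj_mat A)) *\<^sub>v f"
    by (rule assoc_mult_mat_vec[symmetric, OF A smult_carrier_mat[OF adj_mat(1)[OF A]] f])
  also have "A * (inverse (det A) \<cdot>\<^sub>m adj_mat A) = inverse (det A) \<cdot>\<^sub>m (A * adj_mat A)"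
    by (rule mult_smult_distrib[OF A adj_mat(1)[OF A]])
  also have "\<dots> = 1\<^sub>m n"
    unfolding adj_mat(2)[OF A] using d by (intro eq_matI) auto
  finally show "A *\<^sub>v ((inverse (det A) \<cdot>\<^sub>m adj_mat A) *\<^sub>v f) = f" using f by simp
qed

text \<open>Writing \<open>f = A g\<close> absorbs the extra factor \<open>A\<close> in the relation
  obtained from the trace formula; this is where invertibility of \<open>A\<close> enters.\<close>

lemma cayley_hamilton_moment:
  fixes A :: "'f::field mat"
  assumes A: "A \<in> carrier_mat n n" and d: "det A \<noteq> 0" and f: "f \<in> carrier_vec n"
  shows "(\<Sum>j\<le>n. (-1) ^ j * principal_sum n A (n - j) * moment A e' f j) = 0"
proof -
  obtain g where g: "g \<in> carrier_vec n" "A *\<^sub>v g = f"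
    using mat_mult_vec_surj[OF A d f] .
  then show ?thesis
    using cayley_hamilton_krylov[OF A g(1), of e'] by (simp add: moment_def krylov_mult[symmetric])
qed

lemma krylov_add: "krylov A (krylov A f m) j = krylov A f (m + j)"
  by (induction m arbitrary: f) (simp_all add: krylov_mult[symmetric] krylov_def funpow_swap1)

text \<open>The invariants b fix the first \<open>n\<close> moments, and Cayley-Hamilton, with the
  same coefficients on both sides, propagates the equality to all of them.\<close>

lemma moment_unique:
  fixes A B :: "'f::field mat"
  assumes A: "A \<in> carrier_mat n n" "det A \<noteq> 0" "e \<in> carrier_vec n"
    and B: "B \<in> carrier_mat n n" "det B \<noteq> 0" "f \<in> carrier_vec n"
    and p: "\<And>i. i \<le> n \<Longrightarrow> principal_sum n A i = principal_sum n B i"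
    and zero: "e' \<bullet> e = f' \<bullet> f"
    and b: "\<And>i. Suc i < n \<Longrightarrow> bordered_trace n A e' e i = bordered_trace n B f' f i"
  shows "moment A e' e m = moment B f' f m"
proof (rule linear_recurrence_unique[where p = "principal_sum n A" and n = n])
  show "moment A e' e m = moment B f' f m" if "m < n" for m
    using that
  proof (rule triangular_recursion_unique[where p = "principal_sum n A" and n = n, rotated 3])
    show "(\<Sum>j\<le>i. (-1) ^ j * principal_sum n A (i - j) * moment A e' e (Suc j)) =
        (\<Sum>j\<le>i. (-1) ^ j * principal_sum n A (i - j) * moment B f' f (Suc j))" if i: "Suc i < n" for i
      using b[OF i] i unfolding bordered_trace_krylov[OF A(1,3)] bordered_trace_krylov[OF B(1,3)]
      by (simp add: moment_def p)
  qed (use zero in \<open>simp_all add: moment_def\<close>)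
  show "(\<Sum>j\<le>n. (-1) ^ j * principal_sum n A (n - j) * moment A e' e (m + j)) = 0" for m
    using cayley_hamilton_moment[OF A(1,2), of "krylov A e m" e'] A
    by (simp add: moment_def krylov_add)
  show "(\<Sum>j\<le>n. (-1) ^ j * principal_sum n A (n - j) * moment B f' f (m + j)) = 0" for m
    using cayley_hamilton_moment[OF B(1,2), of "krylov B f m" f'] B
    by (simp add: moment_def krylov_add p)
qed simp

section \<open>Functions on \<open>T^sc x SL_n\<close> and the coordinate ring of the monoid\<close>

definition rho :: "(nat \<Rightarrow> 'f::comm_ring_1) \<Rightarrow> nat \<Rightarrow> 'f" where
  "rho z m = (\<Prod>j\<in>{1..m}. z j)"

text \<open>On the torus this is the i-th power of the first diagonal entry divided by the i-th
  fundamental weight: the ratio between the i-minors of \<open>t_1 g\<close> and the component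
  \<open>x_i\<close>.\<close>

definition weight_factor :: "(nat \<Rightarrow> 'f::comm_ring_1) \<Rightarrow> nat \<Rightarrow> 'f" where
  "weight_factor z i = (\<Prod>m<i. rho z m)"

definition monoid_gens :: "nat \<Rightarrow> ('r::field torus_sl \<Rightarrow> 'r) set" where
  "monoid_gens n = {z_coord i |i. i \<in> {1..<n}} \<union>
     {x_coord i I J |i I J. i \<in> {1..<n} \<and> I \<in> subsets_of_card n i \<and> J \<in> subsets_of_card n i}"

definition unit_gens :: "nat \<Rightarrow> ('r::field torus_sl \<Rightarrow> 'r) set" where
  "unit_gens n = {\<lambda>(t, g). t $ i |i. i < n} \<union> {\<lambda>(t, g). g $$ (i, j) |i j. i < n \<and> j < n}"

lemma generated_functions_sum:
  assumes "0 \<in> k" "\<And>i. i \<in> S \<Longrightarrow> f i \<in> generated_functions k G"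
  shows "(\<lambda>p. \<Sum>i\<in>S. f i p) \<in> generated_functions k G"
  using assms(2)
proof (induction S rule: infinite_finite_induct)
  case (insert i S)
  then show ?case
    using generated_functions.add[of "f i" k G "\<lambda>p. \<Sum>i\<in>S. f i p"] by simp
qed (use generated_functions.const[OF assms(1)] in auto)

lemma generated_functions_prod:
  assumes "1 \<in> k" "\<And>i. i \<in> S \<Longrightarrow> f i \<in> generated_functions k G"
  shows "(\<lambda>p. \<Prod>i\<in>S. f i p) \<in> generated_functions k G"
  using assms(2)
proof (induction S rule: infinite_finite_induct)
  case (insert i S)
  then show ?case
    using generated_functions.mult[of "f i" k G "\<lambda>p. \<Prod>i\<in>S. f i p"] by simp
qed (use generated_functions.const[OF assms(1)] in auto)

lemma on_TSL_eqI:
  "(\<And>t g. (t, g) \<in> TSL n \<Longrightarrow> f (t, g) = f' (t, g)) \<Longrightarrow> on_TSL n f = on_TSL n f'"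
  by (auto simp: on_TSL_def)

lemma TSL_iff:
  "(t, g) \<in> TSL n \<longleftrightarrow> t \<in> carrier_vec n \<and> (\<Prod>i<n. t $ i) = 1 \<and> g \<in> carrier_mat n n \<and> det g = 1"
  by (auto simp: TSL_def torus_def)

lemma TSL_nonzero: "(t, g) \<in> TSL n \<Longrightarrow> i < n \<Longrightarrow> t $ i \<noteq> 0"
  using prod_zero[of "{..<n}" "\<lambda>i. t $ i"] by (auto simp: TSL_iff)

lemma one_in_TSL: "(vec n (\<lambda>_. 1), 1\<^sub>m n) \<in> TSL n"
  by (auto simp: TSL_iff)

lemma det_submatrix_Leibniz:
  assumes "g \<in> carrier_mat n n" "I \<in> subsets_of_card n i" "J \<in> subsets_of_card n i"
  shows "minor g I J = (\<Sum>p | p permutes {0..<i}. signof p * (\<Prod>q\<in>{0..<i}. g $$ (pick I q, pick J (p q))))"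
proof -
  note Id = subsets_of_cardD[OF assms(2)] and Jd = subsets_of_cardD[OF assms(3)]
  have "minor g I J = (\<Sum>p | p permutes {0..<i}. signof p *
      (\<Prod>q\<in>{0..<i}. mat i i (\<lambda>(p, q). g $$ (pick I p, pick J q)) $$ (q, p q)))"
    unfolding submatrix_subset[OF assms(1) Id(1) Jd(1)] Id(2) Jd(2) by (rule det_def') simp
  also have "\<dots> = (\<Sum>p | p permutes {0..<i}. signof p * (\<Prod>q\<in>{0..<i}. g $$ (pick I q, pick J (p q))))"
  proof (rule sum.cong[OF refl])
    fix p assume "p \<in> {p. p permutes {0..<i}}"
    then have "p q < i" if "q < i" for q
      using permutes_in_image[of p "{0..<i}" q] that by simp
    then show "signof p * (\<Prod>q\<in>{0..<i}. mat i i (\<lambda>(p, q). g $$ (pick I p, pick J q)) $$ (q, p q)) =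
        signof p * (\<Prod>q\<in>{0..<i}. g $$ (pick I q, pick J (p q)))"
      by (intro arg_cong2[where f = "(*)"] refl prod.cong) auto
  qed
  finally show ?thesis .
qed

lemma signof_in:
  assumes "1 \<in> k" "-1 \<in> k"
  shows "signof p \<in> (k :: 'r::comm_ring_1 set)"
  using assms by (auto simp: sign_def)

lemma pick_less:
  assumes "I \<in> subsets_of_card n i" "q < i"
  shows "pick I q < n"
  using subsets_of_cardD[OF assms(1)] pick_in_set_le[of q I] assms(2) by auto

lemma torus_inverse:
  assumes "(t, g) \<in> TSL n" "i < n"
  shows "inverse (t $ i) = (\<Prod>j\<in>{..<n} - {i}. t $ j)"
proof -
  have "t $ i * (\<Prod>j\<in>{..<n} - {i}. t $ j) = 1"
    using assms by (subst prod.remove[symmetric]) (auto simp: TSL_iff)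
  then show ?thesis by (rule inverse_unique)
qed

text \<open>The generators are rational expressions, but on \<open>TSL\<close> they agree with
  polynomials in the entries: minors by the Leibniz formula, and inverses of torus entries as
  products of the other entries.\<close>

lemma monoid_gens_subset_unit:
  assumes k: "0 \<in> k" "1 \<in> k" "-1 \<in> k" and f: "f \<in> generated_functions k (monoid_gens n)"
  shows "\<exists>f'\<in>generated_functions k (unit_gens n). on_TSL n f = on_TSL n f'"
  using f
proof induction
  case (const c)
  then show ?case using generated_functions.const by blast
next
  case (add f g)
  then obtain f' g' where fg: "f' \<in> generated_functions k (unit_gens n)" "on_TSL n f = on_TSL n f'"
    "g' \<in> generated_functions k (unit_gens n)" "on_TSL n g = on_TSL n g'" by blast
  then have "on_TSL n (\<lambda>p. f p + g p) = on_TSL n (\<lambda>p. f' p + g' p)"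
    by (auto simp: on_TSL_def fun_eq_iff split: if_splits)
  then show ?case using fg generated_functions.add by blast
next
  case (mult f g)
  then obtain f' g' where fg: "f' \<in> generated_functions k (unit_gens n)" "on_TSL n f = on_TSL n f'"
    "g' \<in> generated_functions k (unit_gens n)" "on_TSL n g = on_TSL n g'" by blast
  then have "on_TSL n (\<lambda>p. f p * g p) = on_TSL n (\<lambda>p. f' p * g' p)"
    by (auto simp: on_TSL_def fun_eq_iff split: if_splits)
  then show ?case using fg generated_functions.mult by blast
next
  case (gen f)
  have t: "(\<lambda>p. fst p $ i) \<in> generated_functions k (unit_gens n)" if "i < n" for i
    by (rule generated_functions.gen) (use that in \<open>auto simp: unit_gens_def case_prod_unfold\<close>)
  have g: "(\<lambda>p. snd p $$ (i, j)) \<in> generated_functions k (unit_gens n)" if "i < n" "j < n" for i j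
    by (rule generated_functions.gen) (use that in \<open>auto simp: unit_gens_def case_prod_unfold\<close>)
  from gen consider i where "i \<in> {1..<n}" "f = z_coord i"
    | i I J where "i \<in> {1..<n}" "f = x_coord i I J" "I \<in> subsets_of_card n i" "J \<in> subsets_of_card n i"
    by (auto simp: monoid_gens_def)
  then show ?case
  proof cases
    case (1 i)
    \<comment> \<open>The product over \<open>j \<noteq> i\<close> stands for
      \<open>1 / t $ i\<close>, because the entries of a torus element multiply to 1.\<close>
    let ?f = "\<lambda>p. fst p $ (i - 1) * (\<Prod>j\<in>{..<n} - {i}. fst p $ j)"
    have "?f \<in> generated_functions k (unit_gens n)"
      by (intro generated_functions.mult generated_functions_prod t k) (use 1 in auto)
    moreover have "on_TSL n f = on_TSL n ?f"
      by (rule on_TSL_eqI)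
        (use 1 in \<open>simp add: z_coord_def simple_root_def torus_inverse[symmetric] divide_inverse\<close>)
    ultimately show ?thesis by blast
  next
    case (2 i I J)
    let ?f = "\<lambda>y. (\<Prod>j<i. fst y $ j) *
       (\<Sum>p | p permutes {0..<i}. signof p * (\<Prod>q\<in>{0..<i}. snd y $$ (pick I q, pick J (p q))))"
    have "?f \<in> generated_functions k (unit_gens n)"
    proof (intro generated_functions.mult generated_functions_sum generated_functions_prod
        generated_functions.const t g k signof_in)
      fix p q assume "p \<in> {p. p permutes {0..<i}}" "q \<in> {0..<i}"
      then have "q < i" "p q < i" using permutes_in_image[of p "{0..<i}" q] by auto
      then show "pick I q < n" "pick J (p q) < n" using 2 pick_less by auto
    qed (use 2 in auto)
    moreover have "on_TSL n f = on_TSL n ?f"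
      by (rule on_TSL_eqI)
        (use 2 in \<open>simp add: x_coord_def fundamental_weight_def det_submatrix_Leibniz[where n = n and i = i] TSL_iff\<close>)
    ultimately show ?thesis by blast
  qed
qed

lemma smult_TSL:
  assumes "(t, g) \<in> TSL n" "\<zeta> ^ n = 1"
  shows "(\<zeta> \<cdot>\<^sub>v t, inverse \<zeta> \<cdot>\<^sub>m g) \<in> TSL n"
proof -
  have "(\<Prod>i<n. (\<zeta> \<cdot>\<^sub>v t) $ i) = (\<Prod>i<n. \<zeta> * t $ i)"
    using assms by (intro prod.cong) (auto simp: TSL_iff)
  also have "\<dots> = 1" using assms by (simp add: prod.distrib TSL_iff)
  finally show ?thesis
    using assms by (auto simp: TSL_iff power_inverse carrier_matD)
qed

lemma minor_smult:
  assumes "g \<in> carrier_mat n n" "I \<in> subsets_of_card n i" "J \<in> subsets_of_card n i"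
  shows "minor (c \<cdot>\<^sub>m g) I J = c ^ i * minor g I J"
proof -
  note Id = subsets_of_cardD[OF assms(2)] and Jd = subsets_of_cardD[OF assms(3)]
  have "submatrix (c \<cdot>\<^sub>m g) I J = c \<cdot>\<^sub>m submatrix g I J"
    unfolding submatrix_subset[OF assms(1) Id(1) Jd(1)]
      submatrix_subset[OF smult_carrier_mat[OF assms(1)] Id(1) Jd(1)]
    using assms pick_less by (intro eq_matI) (auto simp: Id Jd)
  then show ?thesis
    using Jd by (simp add: submatrix_subset[OF assms(1) Id(1) Jd(1)])
qed

text \<open>Simple roots have degree 0 in \<open>t\<close>, while \<open>x_coord i\<close> has
  degree \<open>i\<close> both in \<open>t\<close> and in \<open>g\<close>; the factors \<zeta> and
  its inverse cancel.\<close>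

lemma monoid_functions_invariant:
  assumes f: "f \<in> generated_functions k (monoid_gens n)" and tg: "(t, g) \<in> TSL n"
    and \<zeta>: "\<zeta> ^ n = 1" and n: "n \<ge> 1"
  shows "f (\<zeta> \<cdot>\<^sub>v t, inverse \<zeta> \<cdot>\<^sub>m g) = f (t, g)"
  using f
proof induction
  case (gen f)
  have \<zeta>0: "\<zeta> \<noteq> 0" using \<zeta> n by (auto simp: power_0_left)
  from gen consider i where "i \<in> {1..<n}" "f = z_coord i"
    | i I J where "i \<in> {1..<n}" "f = x_coord i I J" "I \<in> subsets_of_card n i" "J \<in> subsets_of_card n i"
    by (auto simp: monoid_gens_def)
  then show ?case
  proof cases
    case (1 i)
    then show ?thesis using tg \<zeta>0 by (auto simp: z_coord_def simple_root_def TSL_iff)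
  next
    case (2 i I J)
    have "(\<Prod>j<i. (\<zeta> \<cdot>\<^sub>v t) $ j) = (\<Prod>j<i. \<zeta> * t $ j)"
      using 2 tg by (intro prod.cong) (auto simp: TSL_iff)
    moreover have "minor (inverse \<zeta> \<cdot>\<^sub>m g) I J = inverse \<zeta> ^ i * minor g I J"
      by (rule minor_smult) (use 2 tg in \<open>auto simp: TSL_iff\<close>)
    ultimately show ?thesis
      using 2 \<zeta>0 by (simp add: x_coord_def fundamental_weight_def prod.distrib power_inverse)
  qed
qed auto

text \<open>An element of the image ring belongs to its normalization with denominator 1 and the
  monic linear equation \<open>f - f = 0\<close>. What has to be checked is that it is a
  \<mu>_n-invariant polynomial function on \<open>TSL\<close>.\<close>

lemma image_ring_subset_monoid_ring:
  fixes f :: "'r::field torus_sl \<Rightarrow> 'r"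
  assumes k: "0 \<in> k" "1 \<in> k" "-1 \<in> k" and n: "n \<ge> 1"
    and f: "f \<in> generated_functions k (monoid_gens n)"
  shows "on_TSL n f \<in> monoid_ring n k"
proof -
  have im: "on_TSL n h \<in> image_ring n k" if "h \<in> generated_functions k (monoid_gens n)" for h
    using that by (auto simp: image_ring_def monoid_gens_def)
  obtain f' where f': "f' \<in> generated_functions k (unit_gens n)" "on_TSL n f = on_TSL n f'"
    using monoid_gens_subset_unit[OF k f] by blast
  have "on_TSL n f \<in> unit_group_ring n k"
    unfolding unit_group_ring_def unit_gens_def[symmetric]
  proof (intro CollectI conjI allI impI)
    show "on_TSL n f \<in> on_TSL n ` generated_functions k (unit_gens n)"
      using f' by blast
  next
    fix \<zeta> :: 'r and t :: "'r vec" and g :: "'r mat"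
    assume "\<zeta> ^ n = 1" "(t, g) \<in> TSL n"
    then show "on_TSL n f (\<zeta> \<cdot>\<^sub>v t, inverse \<zeta> \<cdot>\<^sub>m g) = on_TSL n f (t, g)"
      using monoid_functions_invariant[OF f _ _ n] by (simp add: on_TSL_def smult_TSL)
  qed
  moreover have "\<exists>p\<in>image_ring n k. \<exists>q\<in>image_ring n k. q \<noteq> (\<lambda>_. 0) \<and> (\<lambda>y. q y * on_TSL n f y) = p"
  proof (intro bexI conjI)
    show "on_TSL n (\<lambda>_. 1) \<noteq> (\<lambda>_. 0)"
      using one_in_TSL[of n] by (auto simp: on_TSL_def fun_eq_iff)
    show "(\<lambda>y. on_TSL n (\<lambda>_. 1) y * on_TSL n f y) = on_TSL n f"
      by (auto simp: on_TSL_def)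
  qed (use im[OF f] im[OF generated_functions.const[OF k(2)]] in auto)
  moreover have "\<exists>m c. (\<forall>j<m. c j \<in> image_ring n k) \<and>
           (\<forall>y\<in>TSL n. on_TSL n f y ^ m + (\<Sum>j<m. c j y * on_TSL n f y ^ j) = 0)"
  proof (intro exI conjI allI impI ballI)
    show "on_TSL n (\<lambda>y. -1 * f y) \<in> image_ring n k" for j :: nat
      by (intro im generated_functions.mult generated_functions.const k f)
    show "on_TSL n f y ^ 1 + (\<Sum>j<1. on_TSL n (\<lambda>y. -1 * f y) y * on_TSL n f y ^ j) = 0" for y
      by (auto simp: on_TSL_def)
  qed
  ultimately show ?thesis by (simp add: monoid_ring_def)
qed

section \<open>Evaluation at a point of the monoid and the matrix of the point\<close>

lemma to_ac_range: "0 \<in> range to_ac" "1 \<in> range to_ac" "-1 \<in> range to_ac"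
  by (metis rangeI to_ac_0) (metis rangeI to_ac_1, metis rangeI to_ac_1 to_ac_minus)

text \<open>The truncation \<open>on_TSL\<close> is built into the evaluation, so that an identity
  of functions may be transferred as soon as it holds on \<open>TSL\<close>.\<close>

definition ev :: "nat \<Rightarrow> 'f::field point \<Rightarrow> ('f alg_closure torus_sl \<Rightarrow> 'f alg_closure) \<Rightarrow> 'f" where
  "ev n \<phi> f = \<phi> (on_TSL n f)"

abbreviation monoid_functions :: "nat \<Rightarrow> ('f::field alg_closure torus_sl \<Rightarrow> 'f alg_closure) set" where
  "monoid_functions n \<equiv> generated_functions (range to_ac) (monoid_gens n)"

lemma ev_const: "\<phi> \<in> monoid_points n \<Longrightarrow> ev n \<phi> (\<lambda>_. to_ac c) = c"
  by (simp add: ev_def monoid_points_def)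

lemma ev_add:
  assumes "\<phi> \<in> monoid_points n" "n \<ge> 1" "f \<in> monoid_functions n" "g \<in> monoid_functions n"
  shows "ev n \<phi> (\<lambda>y. f y + g y) = ev n \<phi> f + ev n \<phi> g"
proof -
  have "on_TSL n (\<lambda>y. f y + g y) = (\<lambda>y. on_TSL n f y + on_TSL n g y)"
    by (auto simp: on_TSL_def)
  moreover have "on_TSL n f \<in> monoid_ring n (range to_ac)" "on_TSL n g \<in> monoid_ring n (range to_ac)"
    using image_ring_subset_monoid_ring[OF to_ac_range assms(2)] assms(3,4) by blast+
  ultimately show ?thesis
    using assms(1) unfolding ev_def monoid_points_def by auto
qed

lemma ev_mult:
  assumes "\<phi> \<in> monoid_points n" "n \<ge> 1" "f \<in> monoid_functions n" "g \<in> monoid_functions n"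
  shows "ev n \<phi> (\<lambda>y. f y * g y) = ev n \<phi> f * ev n \<phi> g"
proof -
  have "on_TSL n (\<lambda>y. f y * g y) = (\<lambda>y. on_TSL n f y * on_TSL n g y)"
    by (auto simp: on_TSL_def)
  moreover have "on_TSL n f \<in> monoid_ring n (range to_ac)" "on_TSL n g \<in> monoid_ring n (range to_ac)"
    using image_ring_subset_monoid_ring[OF to_ac_range assms(2)] assms(3,4) by blast+
  ultimately show ?thesis
    using assms(1) unfolding ev_def monoid_points_def by auto
qed

lemma ev_sum:
  assumes p: "\<phi> \<in> monoid_points n" "n \<ge> 1" and f: "\<And>i. i \<in> S \<Longrightarrow> f i \<in> monoid_functions n"
  shows "ev n \<phi> (\<lambda>y. \<Sum>i\<in>S. f i y) = (\<Sum>i\<in>S. ev n \<phi> (f i))"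
  using f
proof (induction S rule: infinite_finite_induct)
  case (insert i S)
  then have "(\<lambda>y. \<Sum>i\<in>S. f i y) \<in> monoid_functions n"
    by (intro generated_functions_sum to_ac_range) auto
  with insert show ?case by (simp add: ev_add[OF p])
qed (use ev_const[OF p(1), of 0] in simp_all)

lemma ev_prod:
  assumes p: "\<phi> \<in> monoid_points n" "n \<ge> 1" and f: "\<And>i. i \<in> S \<Longrightarrow> f i \<in> monoid_functions n"
  shows "ev n \<phi> (\<lambda>y. \<Prod>i\<in>S. f i y) = (\<Prod>i\<in>S. ev n \<phi> (f i))"
  using f
proof (induction S rule: infinite_finite_induct)
  case (insert i S)
  then have "(\<lambda>y. \<Prod>i\<in>S. f i y) \<in> monoid_functions n"
    by (intro generated_functions_prod to_ac_range) auto
  with insert show ?case by (simp add: ev_mult[OF p])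
qed (use ev_const[OF p(1), of 1] in simp_all)

lemma ev_cong: "(\<And>t g. (t, g) \<in> TSL n \<Longrightarrow> f (t, g) = f' (t, g)) \<Longrightarrow> ev n \<phi> f = ev n \<phi> f'"
  unfolding ev_def by (rule arg_cong[of _ _ \<phi>], rule on_TSL_eqI)

lemma rho_torus:
  assumes "(t, g) \<in> TSL n"
  shows "m < n \<Longrightarrow> rho (\<lambda>j. z_coord j (t, g)) m = t $ 0 / t $ m"
proof (induction m)
  case 0
  then show ?case using TSL_nonzero[OF assms] by (simp add: rho_def)
next
  case (Suc m)
  have "rho (\<lambda>j. z_coord j (t, g)) (Suc m) = rho (\<lambda>j. z_coord j (t, g)) m * z_coord (Suc m) (t, g)"
    by (simp add: rho_def)
  then show ?case
    using Suc TSL_nonzero[OF assms, of m] by (simp add: z_coord_def simple_root_def)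
qed

lemma weight_factor_torus:
  assumes "(t, g) \<in> TSL n" "i \<le> n"
  shows "weight_factor (\<lambda>j. z_coord j (t, g)) i * fundamental_weight i t = t $ 0 ^ i"
proof -
  have "weight_factor (\<lambda>j. z_coord j (t, g)) i * fundamental_weight i t = (\<Prod>m<i. t $ 0 / t $ m * t $ m)"
    unfolding weight_factor_def fundamental_weight_def prod.distrib[symmetric]
    using assms(2) by (intro prod.cong refl) (simp add: rho_torus[OF assms(1)])
  also have "\<dots> = (\<Prod>m<i. t $ 0)"
    by (rule prod.cong[OF refl]) (use TSL_nonzero[OF assms(1)] assms(2) in simp)
  finally show ?thesis by simp
qed

lemma fundamental_weight_n:
  assumes "(t, g) \<in> TSL n"
  shows "fundamental_weight n t = 1"
  using assms by (simp add: fundamental_weight_def TSL_iff)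

lemma minor_singleton:
  assumes "g \<in> carrier_mat n n" "i < n" "j < n"
  shows "minor g {i} {j} = g $$ (i, j)"
proof -
  have p: "(LEAST a. a = i) = i" for i :: nat
    by (rule Least_equality) auto
  have "submatrix g {i} {j} = mat 1 1 (\<lambda>(p, q). g $$ (pick {i} p, pick {j} q))"
    by (subst submatrix_subset[OF assms(1)]) (use assms in auto)
  then show ?thesis using det_single[of "submatrix g {i} {j}"] by (simp add: p)
qed

lemma x_coord_1:
  assumes "(t, g) \<in> TSL n" "i < n" "j < n"
  shows "x_coord 1 {i} {j} (t, g) = t $ 0 * g $$ (i, j)"
  using assms minor_singleton[of g n i j] by (simp add: x_coord_def fundamental_weight_def TSL_iff)

lemma z_coord_function: "j \<in> {1..<n} \<Longrightarrow> z_coord j \<in> monoid_functions n"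
  by (rule generated_functions.gen) (auto simp: monoid_gens_def)

lemma x_coord_function:
  "i \<in> {1..<n} \<Longrightarrow> I \<in> subsets_of_card n i \<Longrightarrow> J \<in> subsets_of_card n i \<Longrightarrow> x_coord i I J \<in> monoid_functions n"
  by (rule generated_functions.gen) (auto simp: monoid_gens_def)

lemma singleton_subset_of_card: "i < n \<Longrightarrow> {i} \<in> subsets_of_card n 1"
  by (simp add: subsets_of_card_def)

lemma rho_function: "m < n \<Longrightarrow> (\<lambda>y. rho (\<lambda>j. z_coord j y) m) \<in> monoid_functions n"
  unfolding rho_def by (intro generated_functions_prod to_ac_range z_coord_function) auto

lemma weight_factor_function: "i \<le> n \<Longrightarrow> (\<lambda>y. weight_factor (\<lambda>j. z_coord j y) i) \<in> monoid_functions n"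
  unfolding weight_factor_def by (intro generated_functions_prod to_ac_range rho_function) auto

lemma ev_rho:
  assumes "\<phi> \<in> monoid_points n" "n \<ge> 1" "m < n"
  shows "ev n \<phi> (\<lambda>y. rho (\<lambda>j. z_coord j y) m) = rho (point_z n \<phi>) m"
  unfolding rho_def
  by (subst ev_prod[OF assms(1,2)])
    (use assms in \<open>auto intro!: z_coord_function simp: ev_def point_z_def\<close>)

lemma ev_weight_factor:
  assumes "\<phi> \<in> monoid_points n" "n \<ge> 1" "i \<le> n"
  shows "ev n \<phi> (\<lambda>y. weight_factor (\<lambda>j. z_coord j y) i) = weight_factor (point_z n \<phi>) i"
  unfolding weight_factor_def
  by (subst ev_prod[OF assms(1,2)])
    (use assms in \<open>auto intro!: rho_function simp: ev_rho\<close>)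

text \<open>The first fundamental weight is the first entry of \<open>t\<close>, so the component
  \<open>x_1\<close> already is \<open>t_1 g\<close>. For \<open>n = 1\<close> there is no such
  component, and the only element of \<open>SL_1\<close> is taken.\<close>

definition point_mat :: "nat \<Rightarrow> 'f::field point \<Rightarrow> 'f mat" where
  "point_mat n \<phi> = (if n = 1 then 1\<^sub>m 1 else mat n n (\<lambda>(i, j). point_x n \<phi> 1 {i} {j}))"

lemma point_mat_carrier [simp]: "point_mat n \<phi> \<in> carrier_mat n n"
  by (auto simp: point_mat_def)

text \<open>On \<open>TSL\<close> the i-minor of \<open>t_1 g\<close> is
  \<open>weight_factor\<close> times the weight times the minor of \<open>g\<close>; the Leibniz
  formula makes this an identity between generators that every point respects. The function
  \<open>h\<close> is kept general to treat \<open>x_coord\<close> for \<open>i < n\<close> and the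
  constant 1 for \<open>i = n\<close> together, the latter giving the determinant.\<close>

lemma point_mat_minor_aux:
  assumes p: "\<phi> \<in> monoid_points n" and n: "n \<ge> 2" and i: "i \<le> n"
    and IJ: "I \<in> subsets_of_card n i" "J \<in> subsets_of_card n i"
    and h: "h \<in> monoid_functions n"
    and hv: "\<And>t g. (t, g) \<in> TSL n \<Longrightarrow> h (t, g) = fundamental_weight i t * minor g I J"
  shows "weight_factor (point_z n \<phi>) i * ev n \<phi> h = minor (point_mat n \<phi>) I J"
proof -
  have n1: "n \<ge> 1" using n by simp
  let ?x = "\<lambda>p q. x_coord 1 {pick I q} {pick J (p q)} :: 'a alg_closure torus_sl \<Rightarrow> 'a alg_closure"
  have pq: "pick I q < n" "pick J (p q) < n" if "p permutes {0..<i}" "q \<in> {0..<i}" for p q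
    using that IJ permutes_in_image[of p "{0..<i}" q] by (auto intro!: pick_less)
  have x: "?x p q \<in> monoid_functions n" if "p permutes {0..<i}" "q \<in> {0..<i}" for p q
    using pq[OF that] n by (intro x_coord_function singleton_subset_of_card) auto
  have sg: "(\<lambda>_. signof p) \<in> monoid_functions n" and evs: "ev n \<phi> (\<lambda>_. signof p) = signof p" for p
    using generated_functions.const[OF rangeI[of to_ac "signof p"]] ev_const[OF p, of "signof p"]
    by (simp_all add: to_ac_of_int)
  have "minor (point_mat n \<phi>) I J = (\<Sum>p | p permutes {0..<i}. signof p *
      (\<Prod>q\<in>{0..<i}. ev n \<phi> (?x p q)))"
    unfolding det_submatrix_Leibniz[OF point_mat_carrier IJ]
    by (intro sum.cong refl arg_cong2[where f = "(*)"] prod.cong)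
      (use n pq in \<open>auto simp: point_mat_def point_x_def ev_def\<close>)
  also have "\<dots> = (\<Sum>p | p permutes {0..<i}. ev n \<phi> (\<lambda>y. signof p * (\<Prod>q\<in>{0..<i}. ?x p q y)))"
  proof (rule sum.cong[OF refl])
    fix r assume "r \<in> {p. p permutes {0..<i}}"
    then have xr: "\<And>q. q \<in> {0..<i} \<Longrightarrow> ?x r q \<in> monoid_functions n" using x by simp
    have m: "(\<lambda>y. \<Prod>q\<in>{0..<i}. ?x r q y) \<in> monoid_functions n"
      by (intro generated_functions_prod to_ac_range xr)
    have pr: "ev n \<phi> (\<lambda>y. \<Prod>q\<in>{0..<i}. ?x r q y) = (\<Prod>q\<in>{0..<i}. ev n \<phi> (?x r q))"
      by (rule ev_prod[OF p n1 xr])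
    show "signof r * (\<Prod>q\<in>{0..<i}. ev n \<phi> (?x r q)) =
        ev n \<phi> (\<lambda>y. signof r * (\<Prod>q\<in>{0..<i}. ?x r q y))"
      unfolding ev_mult[OF p n1 sg m] evs pr ..
  qed
  also have "\<dots> = ev n \<phi> (\<lambda>y. \<Sum>p | p permutes {0..<i}. signof p * (\<Prod>q\<in>{0..<i}. ?x p q y))"
    by (rule ev_sum[OF p n1, symmetric])
      (use x sg in \<open>auto intro!: generated_functions_prod generated_functions.mult to_ac_range\<close>)
  also have "\<dots> = ev n \<phi> (\<lambda>y. weight_factor (\<lambda>j. z_coord j y) i * h y)"
  proof (rule ev_cong)
    fix t :: "'a alg_closure vec" and g assume tg: "(t, g) \<in> TSL n"
    have g: "g \<in> carrier_mat n n" using tg by (simp add: TSL_iff)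
    have "(\<Sum>p | p permutes {0..<i}. signof p * (\<Prod>q\<in>{0..<i}. ?x p q (t, g))) =
       (\<Sum>p | p permutes {0..<i}. t $ 0 ^ i * (signof p * (\<Prod>q\<in>{0..<i}. g $$ (pick I q, pick J (p q)))))"
    proof (rule sum.cong[OF refl])
      fix p assume "p \<in> {p. p permutes {0..<i}}"
      then have "(\<Prod>q\<in>{0..<i}. ?x p q (t, g)) = (\<Prod>q\<in>{0..<i}. t $ 0 * g $$ (pick I q, pick J (p q)))"
        by (intro prod.cong refl x_coord_1[OF tg] pq) auto
      then show "signof p * (\<Prod>q\<in>{0..<i}. ?x p q (t, g)) =
         t $ 0 ^ i * (signof p * (\<Prod>q\<in>{0..<i}. g $$ (pick I q, pick J (p q))))"
        by (simp add: prod.distrib)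
    qed
    also have "\<dots> = t $ 0 ^ i * minor g I J"
      by (simp add: det_submatrix_Leibniz[OF g IJ] sum_distrib_left)
    also have "\<dots> = weight_factor (\<lambda>j. z_coord j (t, g)) i * h (t, g)"
      by (simp add: hv[OF tg] weight_factor_torus[OF tg i, symmetric])
    finally show "(\<Sum>p | p permutes {0..<i}. signof p * (\<Prod>q\<in>{0..<i}. ?x p q (t, g))) =
        weight_factor (\<lambda>j. z_coord j (t, g)) i * h (t, g)" .
  qed
  also have "\<dots> = weight_factor (point_z n \<phi>) i * ev n \<phi> h"
    by (subst ev_mult[OF p n1 weight_factor_function[OF i] h]) (simp add: ev_weight_factor[OF p n1 i])
  finally show ?thesis ..
qed

lemma point_mat_minor:
  assumes p: "\<phi> \<in> monoid_points n" and i: "i \<in> {1..<n}"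
    and IJ: "I \<in> subsets_of_card n i" "J \<in> subsets_of_card n i"
  shows "weight_factor (point_z n \<phi>) i * point_x n \<phi> i I J = minor (point_mat n \<phi>) I J"
proof -
  have "weight_factor (point_z n \<phi>) i * ev n \<phi> (x_coord i I J) = minor (point_mat n \<phi>) I J"
    by (rule point_mat_minor_aux[OF p _ _ IJ x_coord_function[OF i IJ]])
      (use i in \<open>auto simp: x_coord_def\<close>)
  then show ?thesis by (simp add: ev_def point_x_def)
qed

lemma point_mat_det:
  assumes p: "\<phi> \<in> monoid_points n" and n: "n \<ge> 1"
  shows "det (point_mat n \<phi>) = weight_factor (point_z n \<phi>) n"
proof (cases "n = 1")
  case True
  then show ?thesis by (simp add: point_mat_def weight_factor_def rho_def)
next
  case False
  have "weight_factor (point_z n \<phi>) n * ev n \<phi> (\<lambda>_. to_ac 1) = minor (point_mat n \<phi>) {..<n} {..<n}"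
    by (rule point_mat_minor_aux[OF p])
      (use n False in \<open>auto simp: subsets_of_card_self fundamental_weight_n submatrix_self TSL_iff
         intro: generated_functions.const\<close>)
  then show ?thesis using p ev_const[OF p, of 1] by (simp add: submatrix_self)
qed

section \<open>The involution and the similitude relation\<close>

lemma inverse_mat:
  fixes H :: "'f::field mat"
  assumes H: "H \<in> carrier_mat n n" and d: "det H \<noteq> 0"
  shows "inverse_mat H \<in> carrier_mat n n" "H * inverse_mat H = 1\<^sub>m n" "inverse_mat H * H = 1\<^sub>m n"
proof -
  note adj = adj_mat[OF H]
  show "inverse_mat H \<in> carrier_mat n n"
    using adj by (simp add: inverse_mat_def)
  have 1: "inverse (det H) \<cdot>\<^sub>m (det H \<cdot>\<^sub>m 1\<^sub>m n) = 1\<^sub>m n"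
    using d by (intro eq_matI) auto
  show "H * inverse_mat H = 1\<^sub>m n"
    using adj H 1 by (simp add: inverse_mat_def mult_smult_distrib[OF H adj(1)])
  show "inverse_mat H * H = 1\<^sub>m n"
    using adj H 1 by (simp add: inverse_mat_def mult_smult_assoc_mat[OF adj(1) H])
qed

lemma tau_TSL:
  assumes "(t, g) \<in> TSL n"
  shows "tau n (t, g) \<in> TSL n"
proof -
  have g: "g \<in> carrier_mat n n" "det g = 1" using assms by (auto simp: TSL_iff)
  have "(\<Prod>i<n. inverse (t $ (n - 1 - i))) = (\<Prod>i<n. inverse (t $ i))"
    by (rule prod.reindex_bij_witness[of _ "\<lambda>i. n - 1 - i" "\<lambda>i. n - 1 - i"]) auto
  also have "\<dots> = inverse (\<Prod>i<n. t $ i)" using prod_inversef[of "\<lambda>i. t $ i" "{..<n}"] by (simp add: o_def)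
  also have "\<dots> = 1" using assms by (simp add: TSL_iff)
  finally have pr: "(\<Prod>i<n. inverse (t $ (n - 1 - i))) = 1" .
  have "(\<Prod>i<n. vec n (\<lambda>i. inverse (t $ (n - 1 - i))) $ i) = (\<Prod>i<n. inverse (t $ (n - 1 - i)))"
    by (rule prod.cong) auto
  then have "(\<Prod>i<n. vec n (\<lambda>i. inverse (t $ (n - 1 - i))) $ i) = 1"
    using pr by simp
  moreover have "det (inverse_mat g) = 1"
    using inverse_mat[OF g(1)] g det_mult[OF g(1), of "inverse_mat g"] by simp
  ultimately show ?thesis
    using inverse_mat(1)[OF g(1)] g by (auto simp: tau_def TSL_iff det_transpose)
qed

lemma insert_index_pick:
  assumes "k < n" "i < n - 1"
  shows "pick ({..<n} - {k}) i = insert_index k i"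
proof -
  have p: "pick {..<n} i = i" "pos {..<n} i = i" if "i < n" for i
  proof -
    have "{j \<in> {..<n}. j < i} = {..<i}" using that by auto
    then show "pos {..<n} i = i" by (simp add: pos_def)
    then show "pick {..<n} i = i" using pick_pos[of i "{..<n}"] that by simp
  qed
  have "insert_index k i < n" using assms by (auto simp: insert_index_def)
  then show ?thesis using pick_remove[of "{..<n}" k i] assms by (simp add: p)
qed

lemma mat_delete_eq_submatrix:
  assumes g: "g \<in> carrier_mat n n" and "k < n" "l < n"
  shows "mat_delete g k l = submatrix g ({..<n} - {k}) ({..<n} - {l})"
proof -
  have "submatrix g ({..<n} - {k}) ({..<n} - {l}) =
     mat (n - 1) (n - 1) (\<lambda>(p, q). g $$ (pick ({..<n} - {k}) p, pick ({..<n} - {l}) q))"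
    using assms by (subst submatrix_subset[OF g]) auto
  also have "\<dots> = mat_delete g k l"
    unfolding mat_delete_def using assms
    by (intro eq_matI) (auto simp: insert_index_pick insert_index_def)
  finally show ?thesis ..
qed

text \<open>Inverting and transposing \<open>g\<close> turns entries into cofactors. The first form
  shows that the pullback is up to sign a coordinate of \<open>x_{n-1}\<close>, hence a function at
  which points can be evaluated; the second is suited to matrix computations.\<close>

lemma x_coord_1_tau:
  assumes tg: "(t, g) \<in> TSL n" and kl: "k < n" "l < n"
  shows "x_coord 1 {k} {l} (tau n (t, g)) =
    (-1) ^ (k + l) * x_coord (n - 1) ({..<n} - {k}) ({..<n} - {l}) (t, g)"
    and "x_coord 1 {k} {l} (tau n (t, g)) = inverse (t $ (n - 1)) * adj_mat g $$ (l, k)"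
proof -
  have g: "g \<in> carrier_mat n n" "det g = 1" using tg by (auto simp: TSL_iff)
  have n: "n \<ge> 1" using kl by simp
  obtain t' g' where tau: "tau n (t, g) = (t', g')" by (cases "tau n (t, g)")
  then have tg': "(t', g') \<in> TSL n" using tau_TSL[OF tg] by simp
  have "x_coord 1 {k} {l} (tau n (t, g)) = t' $ 0 * g' $$ (k, l)"
    unfolding tau by (rule x_coord_1[OF tg' kl])
  also have "t' $ 0 = inverse (t $ (n - 1))" using tau n by (auto simp: tau_def)
  also have "g' $$ (k, l) = adj_mat g $$ (l, k)"
    using tau kl adj_mat(1)[OF g(1)] g by (auto simp: tau_def inverse_mat_def)
  finally show 1: "x_coord 1 {k} {l} (tau n (t, g)) = inverse (t $ (n - 1)) * adj_mat g $$ (l, k)" .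
  have "inverse (t $ (n - 1)) = fundamental_weight (n - 1) t"
    using torus_inverse[OF tg, of "n - 1"] n
    by (simp add: fundamental_weight_def) (intro prod.cong, auto)
  moreover have "adj_mat g $$ (l, k) = (-1) ^ (k + l) * minor g ({..<n} - {k}) ({..<n} - {l})"
    using kl g by (simp add: adj_mat_def cofactor_def mat_delete_eq_submatrix[OF g(1) kl])
  ultimately show "x_coord 1 {k} {l} (tau n (t, g)) =
    (-1) ^ (k + l) * x_coord (n - 1) ({..<n} - {k}) ({..<n} - {l}) (t, g)"
    unfolding 1 by (simp add: x_coord_def)
qed

text \<open>At a pair \<open>(t, g)\<close> this reads \<open>adj(g) / t_n\<close> times
  \<open>t_1 g\<close>, which is the scalar \<open>t_1 / t_n = \<rho>_{n-1}\<close> since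
  \<open>det g = 1\<close>.\<close>

lemma ev_tau_relation:
  assumes p: "\<phi> \<in> monoid_points n" and n: "n \<ge> 2" and lm: "l < n" "m < n"
  shows "(\<Sum>k<n. ev n \<phi> (\<lambda>y. x_coord 1 {k} {l} (tau n y)) * point_mat n \<phi> $$ (k, m)) =
    (if l = m then rho (point_z n \<phi>) (n - 1) else 0)"
proof -
  have n1: "n \<ge> 1" using n by simp
  let ?y = "\<lambda>k (y :: 'a alg_closure torus_sl). (to_ac ((-1) ^ (k + l)) :: 'a alg_closure) *
    x_coord (n - 1) ({..<n} - {k}) ({..<n} - {l}) y"
  have y: "?y k \<in> monoid_functions n" if "k < n" for k
    by (intro generated_functions.mult generated_functions.const rangeI x_coord_function)
      (use n lm that in \<open>auto simp: subsets_of_card_def\<close>)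
  have evy: "ev n \<phi> (\<lambda>y. x_coord 1 {k} {l} (tau n y)) = ev n \<phi> (?y k)" if "k < n" for k
    by (rule ev_cong) (simp only: x_coord_1_tau(1)[OF _ that lm(1)] to_ac_power to_ac_minus to_ac_1)
  have x: "x_coord 1 {k} {m} \<in> monoid_functions n" if "k < n" for k
    using n lm that by (intro x_coord_function singleton_subset_of_card) auto
  have "(\<Sum>k<n. ev n \<phi> (\<lambda>y. x_coord 1 {k} {l} (tau n y)) * point_mat n \<phi> $$ (k, m)) =
     (\<Sum>k<n. ev n \<phi> (\<lambda>y. ?y k y * x_coord 1 {k} {m} y))"
  proof (rule sum.cong[OF refl])
    fix k assume "k \<in> {..<n}"
    then have k: "k < n" by simp
    have "point_mat n \<phi> $$ (k, m) = ev n \<phi> (x_coord 1 {k} {m})"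
      using n k lm by (simp add: point_mat_def point_x_def ev_def)
    then show "ev n \<phi> (\<lambda>y. x_coord 1 {k} {l} (tau n y)) * point_mat n \<phi> $$ (k, m) =
      ev n \<phi> (\<lambda>y. ?y k y * x_coord 1 {k} {m} y)"
      by (simp only: evy[OF k] ev_mult[OF p n1 y[OF k] x[OF k]])
  qed
  also have "\<dots> = ev n \<phi> (\<lambda>y. \<Sum>k<n. ?y k y * x_coord 1 {k} {m} y)"
    by (rule ev_sum[OF p n1, symmetric], rule generated_functions.mult[OF y x]) simp_all
  also have "\<dots> = ev n \<phi> (\<lambda>y. (if l = m then 1 else 0) * rho (\<lambda>j. z_coord j y) (n - 1))"
  proof (rule ev_cong)
    fix t :: "'a alg_closure vec" and g assume tg: "(t, g) \<in> TSL n"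
    have g: "g \<in> carrier_mat n n" "det g = 1" using tg by (auto simp: TSL_iff)
    have "(\<Sum>k<n. ?y k (t, g) * x_coord 1 {k} {m} (t, g)) =
      (\<Sum>k<n. (inverse (t $ (n - 1)) * adj_mat g $$ (l, k)) * (t $ 0 * g $$ (k, m)))"
    proof (rule sum.cong[OF refl])
      fix k assume "k \<in> {..<n}"
      then have k: "k < n" by simp
      show "?y k (t, g) * x_coord 1 {k} {m} (t, g) =
        (inverse (t $ (n - 1)) * adj_mat g $$ (l, k)) * (t $ 0 * g $$ (k, m))"
        using x_coord_1_tau[OF tg k lm(1)] x_coord_1[OF tg k lm(2)]
        by (simp add: to_ac_power to_ac_minus)
    qed
    also have "\<dots> = t $ 0 / t $ (n - 1) * (\<Sum>k<n. adj_mat g $$ (l, k) * g $$ (k, m))"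
      by (simp add: sum_distrib_left divide_inverse mult_ac)
    also have "(\<Sum>k<n. adj_mat g $$ (l, k) * g $$ (k, m)) = (adj_mat g * g) $$ (l, m)"
      using adj_mat(1)[OF g(1)] g lm by (simp add: scalar_prod_def lessThan_atLeast0)
    also have "\<dots> = (if l = m then 1 else 0)"
      using adj_mat(3)[OF g(1)] g lm by simp
    also have "t $ 0 / t $ (n - 1) = rho (\<lambda>j. z_coord j (t, g)) (n - 1)"
      by (rule rho_torus[OF tg, symmetric]) (use n in simp)
    finally show "(\<Sum>k<n. ?y k (t, g) * x_coord 1 {k} {m} (t, g)) =
      (if l = m then 1 else 0) * rho (\<lambda>j. z_coord j (t, g)) (n - 1)" by (simp only: mult.commute)
  qed
  also have "\<dots> = ev n \<phi> (\<lambda>y. to_ac (if l = m then 1 else 0) * rho (\<lambda>j. z_coord j y) (n - 1))"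
    by (rule ev_cong) simp
  also have "\<dots> = (if l = m then 1 else 0) * rho (point_z n \<phi>) (n - 1)"
  proof -
    have "n - 1 < n" using n by simp
    note r = rho_function[OF this] and er = ev_rho[OF p n1 this]
    have "ev n \<phi> (\<lambda>y. to_ac c * rho (\<lambda>j. z_coord j y) (n - 1)) = c * rho (point_z n \<phi>) (n - 1)" for c
      unfolding ev_mult[OF p n1 generated_functions.const[OF rangeI] r] ev_const[OF p] er ..
    then show ?thesis .
  qed
  finally show ?thesis by simp
qed

lemma map_mat_hom_mult:
  assumes "field_hom s" "A \<in> carrier_mat n n" "B \<in> carrier_mat n n"
  shows "map_mat s (A * B) = map_mat s A * map_mat s B"
proof -
  interpret field_hom s by fact
  show ?thesis by (rule mat_hom_mult[OF assms(2,3)])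
qed

lemma conjugate_TSL:
  assumes tg: "(t, g) \<in> TSL n" and H: "H \<in> carrier_mat n n" "H' \<in> carrier_mat n n" "H * H' = 1\<^sub>m n"
  shows "(t, H * g * H') \<in> TSL n"
proof -
  have g: "g \<in> carrier_mat n n" "det g = 1" using tg by (auto simp: TSL_iff)
  have "det H * det H' = 1" using det_mult[OF H(1,2)] H(3) by simp
  moreover have "det (H * g * H') = det H * det g * det H'"
    using H g by (simp add: det_mult)
  ultimately show ?thesis using tg H g by (auto simp: TSL_iff)
qed

lemma to_ac_hom: "field_hom to_ac"
  by unfold_locales (auto simp: to_ac_add to_ac_mult)

lemma map_mat_to_ac_inverse:
  assumes H: "H \<in> carrier_mat n n" "H' \<in> carrier_mat n n" "H * H' = 1\<^sub>m n"
  shows "map_mat to_ac H * map_mat to_ac H' = 1\<^sub>m n"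
proof -
  interpret field_hom to_ac by (rule to_ac_hom)
  show ?thesis
    unfolding map_mat_hom_mult[OF to_ac_hom H(1,2), symmetric] H(3) by (rule mat_hom_one)
qed

lemma index_mult_mat_triple:
  fixes A B C :: "'r::comm_ring_1 mat"
  assumes "A \<in> carrier_mat n n" "B \<in> carrier_mat n n" "C \<in> carrier_mat n n" "k < n" "l < n"
  shows "(A * B * C) $$ (k, l) = (\<Sum>a<n. \<Sum>b<n. A $$ (k, b) * C $$ (a, l) * B $$ (b, a))"
  using assms by (simp del: assoc_mult_mat add: scalar_prod_def lessThan_atLeast0 sum_distrib_left mult_ac)

text \<open>The entries of the conjugate are linear combinations, with coefficients in the field, of
  the coordinates of \<open>x_1\<close>, so evaluation commutes with conjugation.\<close>

lemma ev_conjugate: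
  assumes p: "\<phi> \<in> monoid_points n" and n: "n \<ge> 2" and kl: "k < n" "l < n"
    and H: "H \<in> carrier_mat n n" "H' \<in> carrier_mat n n" "H * H' = 1\<^sub>m n"
  shows "ev n \<phi> (\<lambda>(t, g). x_coord 1 {k} {l} (t, map_mat to_ac H * g * map_mat to_ac H')) =
     (H * point_mat n \<phi> * H') $$ (k, l)"
proof -
  have n1: "n \<ge> 1" using n by simp
  let ?H = "map_mat to_ac H" and ?H' = "map_mat to_ac H'"
  have H': "?H \<in> carrier_mat n n" "?H' \<in> carrier_mat n n" "?H * ?H' = 1\<^sub>m n"
    using map_mat_to_ac_inverse[OF H] H by auto
  have x: "x_coord 1 {b} {a} \<in> monoid_functions n" if "b < n" "a < n" for a b
    using n that by (intro x_coord_function singleton_subset_of_card) auto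
  let ?f = "\<lambda>a b y. to_ac (H $$ (k, b) * H' $$ (a, l)) * x_coord 1 {b} {a} y :: 'a alg_closure"
  have f: "?f a b \<in> monoid_functions n" if "b < n" "a < n" for a b
    by (intro generated_functions.mult generated_functions.const rangeI x that)
  have "ev n \<phi> (\<lambda>(t, g). x_coord 1 {k} {l} (t, ?H * g * ?H')) =
     ev n \<phi> (\<lambda>y. \<Sum>a<n. \<Sum>b<n. ?f a b y)"
  proof (rule ev_cong)
    fix t :: "'a alg_closure vec" and g assume tg: "(t, g) \<in> TSL n"
    have g: "g \<in> carrier_mat n n" using tg by (auto simp: TSL_iff)
    have "x_coord 1 {k} {l} (t, ?H * g * ?H') = t $ 0 * (?H * g * ?H') $$ (k, l)"
      by (rule x_coord_1[OF conjugate_TSL[OF tg H'] kl])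
    also have "\<dots> = (\<Sum>a<n. \<Sum>b<n. ?f a b (t, g))"
      unfolding index_mult_mat_triple[OF H'(1) g H'(2) kl] sum_distrib_left
      by (intro sum.cong refl) (use H kl in \<open>simp add: x_coord_1[OF tg, simplified] to_ac_mult mult_ac\<close>)
    finally show "(case (t, g) of (t, g) \<Rightarrow> x_coord 1 {k} {l} (t, ?H * g * ?H')) =
       (\<Sum>a<n. \<Sum>b<n. ?f a b (t, g))" by simp
  qed
  also have "\<dots> = (\<Sum>a<n. \<Sum>b<n. ev n \<phi> (?f a b))"
    by (subst ev_sum[OF p n1], (use f in \<open>auto intro!: generated_functions_sum to_ac_range\<close>)[1])
      (intro sum.cong refl, rule ev_sum[OF p n1], use f in auto)
  also have "\<dots> = (\<Sum>a<n. \<Sum>b<n. H $$ (k, b) * H' $$ (a, l) * point_mat n \<phi> $$ (b, a))"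
  proof (intro sum.cong refl)
    fix a b assume "a \<in> {..<n}" "b \<in> {..<n}"
    then have ab: "a < n" "b < n" by auto
    have "ev n \<phi> (?f a b) = ev n \<phi> (\<lambda>_. to_ac (H $$ (k, b) * H' $$ (a, l))) * ev n \<phi> (x_coord 1 {b} {a})"
      by (rule ev_mult[OF p n1 generated_functions.const[OF rangeI] x[OF ab(2,1)]])
    also have "ev n \<phi> (x_coord 1 {b} {a}) = point_mat n \<phi> $$ (b, a)"
      using n ab by (simp add: point_mat_def point_x_def ev_def)
    finally show "ev n \<phi> (?f a b) = H $$ (k, b) * H' $$ (a, l) * point_mat n \<phi> $$ (b, a)"
      by (simp only: ev_const[OF p])
  qed
  also have "\<dots> = (H * point_mat n \<phi> * H') $$ (k, l)"
    by (rule index_mult_mat_triple[OF H(1) point_mat_carrier H(2) kl, symmetric])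
  finally show ?thesis .
qed

text \<open>Testing the twisting condition on the entries of \<open>x_1\<close> gives
  \<open>H A H^-1 = s(Y)\<close>, where \<open>Y\<close> is the matrix of \<open>x_1\<close> pulled
  back along \<open>tau\<close>. The relation \<open>Y^T A = Z\<close>, conjugated and transposed,
  then eliminates \<open>Y\<close>.\<close>

lemma twisted_point_similitude:
  assumes p: "\<phi> \<in> twisted_points n k s H" and n: "n \<ge> 1" and H: "H \<in> carrier_mat n n" "det H \<noteq> 0"
    and s: "field_hom s" and k: "0 \<in> k" "1 \<in> k" "-1 \<in> k"
  shows "adjoint_mat s (point_mat n \<phi>) * H * point_mat n \<phi> = s (rho (point_z n \<phi>) (n - 1)) \<cdot>\<^sub>m H"
proof -
  interpret field_hom s by fact
  have pm: "\<phi> \<in> monoid_points n" using p by (simp add: twisted_points_def)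
  let ?X = "point_mat n \<phi>"
  show ?thesis
  proof (cases "n = 1")
    case True
    have "H = s 1 \<cdot>\<^sub>m H" by (intro eq_matI) auto
    moreover have "adjoint_mat s (1\<^sub>m 1) = 1\<^sub>m 1"
      by (simp add: adjoint_mat_def mat_hom_one)
    ultimately show ?thesis using True H by (simp add: point_mat_def rho_def)
  next
    case False
    then have n2: "n \<ge> 2" using n by simp
    note inv = inverse_mat[OF H]
    define Y where "Y = mat n n (\<lambda>(a, b). ev n \<phi> (\<lambda>y. x_coord 1 {a} {b} (tau n y)))"
    have Y: "Y \<in> carrier_mat n n" by (simp add: Y_def)
    have X: "?X \<in> carrier_mat n n" by simp
    have HXH: "H * ?X * inverse_mat H = map_mat s Y"
    proof (rule eq_matI)
      fix a b assume "a < dim_row (map_mat s Y)" "b < dim_col (map_mat s Y)"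
      then have ab: "a < n" "b < n" using Y by auto
      let ?f = "x_coord 1 {a} {b} :: 'a alg_closure torus_sl \<Rightarrow> 'a alg_closure"
      have kk: "0 \<in> to_ac ` k" "1 \<in> to_ac ` k" "-1 \<in> to_ac ` k"
        using k image_eqI[of 0 to_ac 0 k] image_eqI[of 1 to_ac 1 k] image_eqI[of "-1" to_ac "-1" k]
        by (auto simp: to_ac_minus)
      \<comment> \<open>The twisting condition may only be tested on functions over the small
        coefficient field; the coordinates of \<open>x_1\<close> qualify, being generators.\<close>
      have "?f \<in> generated_functions (to_ac ` k) (monoid_gens n)"
        by (rule generated_functions.gen)
          (use n2 ab singleton_subset_of_card[OF ab(1)] singleton_subset_of_card[OF ab(2)] in
            \<open>auto simp: monoid_gens_def\<close>)
      then have "on_TSL n ?f \<in> monoid_ring n (to_ac ` k)"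
        by (rule image_ring_subset_monoid_ring[OF kk n])
      then have "\<phi> (on_TSL n (\<lambda>(t, g). on_TSL n ?f (t, map_mat to_ac H * g * map_mat to_ac (inverse_mat H)))) =
         s (\<phi> (on_TSL n (\<lambda>y. on_TSL n ?f (tau n y))))"
        using p unfolding twisted_points_def by blast
      also have "on_TSL n (\<lambda>y. on_TSL n ?f (tau n y)) = on_TSL n (\<lambda>y. ?f (tau n y))"
        by (rule on_TSL_eqI) (simp add: on_TSL_def tau_TSL)
      also have "on_TSL n (\<lambda>(t, g). on_TSL n ?f (t, map_mat to_ac H * g * map_mat to_ac (inverse_mat H))) =
         on_TSL n (\<lambda>(t, g). ?f (t, map_mat to_ac H * g * map_mat to_ac (inverse_mat H)))"
      proof (rule on_TSL_eqI)
        fix t :: "'a alg_closure vec" and g assume tg: "(t, g) \<in> TSL n"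
        have "(t, map_mat to_ac H * g * map_mat to_ac (inverse_mat H)) \<in> TSL n"
          using conjugate_TSL[OF tg, of "map_mat to_ac H" "map_mat to_ac (inverse_mat H)"] H inv
            map_mat_to_ac_inverse[OF H(1) inv(1,2)] by simp
        then show "(case (t, g) of (t, g) \<Rightarrow> on_TSL n ?f (t, map_mat to_ac H * g * map_mat to_ac (inverse_mat H))) =
          (case (t, g) of (t, g) \<Rightarrow> ?f (t, map_mat to_ac H * g * map_mat to_ac (inverse_mat H)))"
          by (simp add: on_TSL_def)
      qed
      finally show "(H * ?X * inverse_mat H) $$ (a, b) = map_mat s Y $$ (a, b)"
        using ev_conjugate[OF pm n2 ab H(1) inv(1,2)] ab by (simp add: ev_def Y_def)
    qed (use H inv Y in auto)
    have HX: "H * ?X = map_mat s Y * H"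
    proof -
      have "map_mat s Y * H = (H * ?X) * (inverse_mat H * H)"
        unfolding HXH[symmetric]
        by (rule assoc_mult_mat[of _ n n _ n _ n]) (use H inv X in auto)
      then show ?thesis using H X inv(3) right_mult_one_mat[of "H * ?X" n n] by simp
    qed
    let ?Z = "rho (point_z n \<phi>) (n - 1)"
    have "Y\<^sup>T * ?X = ?Z \<cdot>\<^sub>m 1\<^sub>m n"
    proof (rule eq_matI)
      fix a b assume "a < dim_row (?Z \<cdot>\<^sub>m 1\<^sub>m n)" "b < dim_col (?Z \<cdot>\<^sub>m 1\<^sub>m n)"
      then have ab: "a < n" "b < n" by auto
      have "(Y\<^sup>T * ?X) $$ (a, b) = (\<Sum>k<n. ev n \<phi> (\<lambda>y. x_coord 1 {k} {a} (tau n y)) * ?X $$ (k, b))"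
        using ab X by (simp add: Y_def scalar_prod_def lessThan_atLeast0 carrier_matD[OF X])
      then show "(Y\<^sup>T * ?X) $$ (a, b) = (?Z \<cdot>\<^sub>m 1\<^sub>m n) $$ (a, b)"
        using ev_tau_relation[OF pm n2 ab] ab by simp
    qed (use carrier_matD[OF X] carrier_matD[OF Y] in simp_all)
    moreover have scal: "map_mat s (?Z \<cdot>\<^sub>m 1\<^sub>m n) = s ?Z \<cdot>\<^sub>m 1\<^sub>m n"
      by (intro eq_matI) auto
    moreover have tr: "(s ?Z \<cdot>\<^sub>m 1\<^sub>m n)\<^sup>T = s ?Z \<cdot>\<^sub>m 1\<^sub>m n"
      by (intro eq_matI) auto
    ultimately have "map_mat s (Y\<^sup>T * ?X) = map_mat s (?Z \<cdot>\<^sub>m 1\<^sub>m n)" by simp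
    then have "map_mat s Y\<^sup>T * map_mat s ?X = s ?Z \<cdot>\<^sub>m 1\<^sub>m n"
      using map_mat_hom_mult[OF s _ X, of "Y\<^sup>T"] Y scal by simp
    then have "s ?Z \<cdot>\<^sub>m 1\<^sub>m n = (map_mat s Y\<^sup>T * map_mat s ?X)\<^sup>T" using tr by metis
    also have "\<dots> = (map_mat s ?X)\<^sup>T * (map_mat s Y\<^sup>T)\<^sup>T"
      by (rule transpose_mult[of _ n n _ n]) (use X Y in simp_all)
    also have "\<dots> = adjoint_mat s ?X * map_mat s Y"
      by (simp add: adjoint_mat_def map_mat_transpose[symmetric])
    finally have "adjoint_mat s ?X * map_mat s Y = s ?Z \<cdot>\<^sub>m 1\<^sub>m n" ..
    then have "(adjoint_mat s ?X * map_mat s Y) * H = s ?Z \<cdot>\<^sub>m H"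
      using H by (simp add: mult_smult_assoc_mat[of _ n n])
    moreover have "adjoint_mat s ?X \<in> carrier_mat n n" using X by (simp add: adjoint_mat_def)
    ultimately show ?thesis
      using HX H X Y assoc_mult_mat[of "adjoint_mat s ?X" n n H n ?X n]
        assoc_mult_mat[of "adjoint_mat s ?X" n n "map_mat s Y" n H n] by simp
  qed
qed

section \<open>Points of the monoid defined by matrices\<close>

text \<open>A double root of \<open>X^n - c\<close> would be a root of the derivative
  \<open>n X^(n-1)\<close>, hence 0, which is excluded by \<open>c \<noteq> 0\<close>.\<close>

lemma card_nth_roots:
  fixes c :: "'a::alg_closed_field"
  assumes c: "c \<noteq> 0" and n: "of_nat n \<noteq> (0 :: 'a)"
  shows "card {u. u ^ n = c} = n"
proof -
  have n0: "n > 0" using n by (cases n) auto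
  define P where "P = monom 1 n - [:c:]"
  have ev: "poly P u = u ^ n - c" for u by (simp add: P_def poly_monom)
  have cf: "coeff P n = 1" using n0 by (simp add: P_def coeff_pCons split: nat.split)
  have deg: "degree P = n"
    by (rule antisym, unfold P_def, intro degree_diff_le degree_monom_le, use cf n0 in
      \<open>auto intro: le_degree simp: P_def[symmetric]\<close>)
  have P0: "P \<noteq> 0" using cf by auto
  obtain A where A: "size A = n" "P = (\<Prod>x\<in>#A. [:-x, 1:])"
    using alg_closed_imp_factorization[OF P0] deg cf by auto
  have roots: "poly P u = 0 \<longleftrightarrow> u \<in># A" for u
    unfolding A(2) by (auto simp: poly_prod_mset prod_mset_zero_iff image_iff)
  have one: "count A x = 1" if x: "x \<in># A" for x
  proof (rule ccontr)
    assume "count A x \<noteq> 1"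
    moreover obtain B where B: "A = add_mset x B" using x by (metis mset_add)
    ultimately have "x \<in># B" by (auto simp: not_in_iff)
    then obtain C where C: "B = add_mset x C" by (metis mset_add)
    define d where "d = [:-x, 1:]"
    define Q where "Q = (\<Prod>x\<in>#C. [:-x, 1:])"
    have "P = d * (d * Q)" unfolding A(2) B C d_def Q_def by (simp only: image_mset_add_mset prod_mset.add_mset)
    moreover have "poly d x = 0" by (simp add: d_def)
    ultimately have "poly (pderiv P) x = 0" by (simp add: pderiv_mult)
    moreover have "pderiv P = monom (of_nat n) (n - 1)"
      by (simp add: P_def pderiv_diff pderiv_monom pderiv_pCons)
    ultimately have "x = 0" using n by (auto simp: poly_monom)
    moreover have "poly P x = 0" using x roots by simp
    ultimately show False using c n0 by (simp add: ev power_0_left)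
  qed
  have "{u. u ^ n = c} = set_mset A" using roots by (auto simp: ev)
  moreover have "size A = card (set_mset A)"
    unfolding size_multiset_overloaded_eq using one by simp
  ultimately show ?thesis using A(1) by simp
qed

text \<open>Otherwise \<open>q - v\<close> would be a nonzero polynomial of degree less than
  \<open>n\<close> with \<open>n\<close> roots.\<close>

lemma poly_constant_on_nth_roots:
  fixes q :: "'a::alg_closed_field poly"
  assumes c: "c \<noteq> 0" and n: "of_nat n \<noteq> (0 :: 'a)" and deg: "degree q < n"
    and v: "\<And>u. u ^ n = c \<Longrightarrow> poly q u = v"
  shows "v = coeff q 0"
proof (rule ccontr)
  assume ne: "v \<noteq> coeff q 0"
  let ?p = "q - [:v:]"
  have p0: "?p \<noteq> 0" using ne by (auto simp: poly_eq_iff coeff_pCons split: nat.splits)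
  have "n = card {u. u ^ n = c}" using card_nth_roots[OF c n] by simp
  also have "\<dots> \<le> card {u. poly ?p u = 0}"
    by (rule card_mono) (use v poly_roots_finite[OF p0] in auto)
  also have "\<dots> \<le> degree ?p" by (rule card_poly_roots_bound[OF p0])
  also have "\<dots> < n" by (rule degree_diff_less) (use deg in auto)
  finally show False by simp
qed

text \<open>A lift of \<open>B\<close> to \<open>T^sc x SL_n\<close> for an n-th root
  \<open>u\<close> of \<open>det B\<close>: the scalar \<open>u\<close> is moved from the matrix to
  the torus, so that \<open>t_1 g = B\<close> as soon as \<open>r 0 = 1\<close>. Different roots
  give lifts that differ by \<mu>_n.\<close>

definition torus_point :: "nat \<Rightarrow> (nat \<Rightarrow> 'f::field) \<Rightarrow> 'f mat \<Rightarrow> 'f alg_closure \<Rightarrow> 'f alg_closure torus_sl" where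
  "torus_point n r B u = (vec n (\<lambda>i. u * to_ac (r i)), inverse u \<cdot>\<^sub>m map_mat to_ac B)"

lemma to_ac_det: "det (map_mat to_ac B) = to_ac (det B)"
proof -
  interpret field_hom to_ac by (rule to_ac_hom)
  show ?thesis by simp
qed

lemma torus_point_TSL:
  assumes r: "det B * (\<Prod>i<n. r i) = 1" and B: "B \<in> carrier_mat n n" and u: "u ^ n = to_ac (det B)"
  shows "torus_point n r B u \<in> TSL n"
proof -
  have "(\<Prod>i<n. vec n (\<lambda>i. u * to_ac (r i)) $ i) = (\<Prod>i<n. u * to_ac (r i))"
    by (rule prod.cong) auto
  also have "\<dots> = to_ac (det B * (\<Prod>i<n. r i))"
    by (simp add: prod.distrib u to_ac_mult to_ac_prod)
  finally have "(\<Prod>i<n. vec n (\<lambda>i. u * to_ac (r i)) $ i) = 1" using r by simp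
  moreover have "det B \<noteq> 0" using r by auto
  ultimately show ?thesis
    using B u by (simp add: torus_point_def TSL_iff to_ac_det power_inverse)
qed

text \<open>All coordinates of the lift are polynomials in \<open>u\<close> over the base field. The
  conjugated data are carried along because the twisting condition compares a value with the
  conjugate of another one; constants from \<open>k\<close> are fixed by \<open>s\<close>, so one
  polynomial and its conjugate serve both points.\<close>

lemma function_at_torus_points:
  fixes s :: "'f::field \<Rightarrow> 'f"
  assumes s: "field_hom s" and k: "\<And>c. c \<in> k \<Longrightarrow> s c = c" and n: "n \<ge> 1" and D: "D \<noteq> 0"
    and B: "B \<in> carrier_mat n n" and f: "f \<in> generated_functions (to_ac ` k) (unit_gens n)"
  shows "\<exists>p. (\<forall>u. u ^ n = to_ac D \<longrightarrow> f (torus_point n r B u) = poly (map_poly to_ac p) u) \<and>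
    (\<forall>u. u ^ n = to_ac (s D) \<longrightarrow>
       f (torus_point n (\<lambda>i. s (r i)) (map_mat s B) u) = poly (map_poly to_ac (map_poly s p)) u)"
proof -
  interpret s: field_hom s by fact
  interpret ac: field_hom "to_ac :: 'f \<Rightarrow> 'f alg_closure" by (rule to_ac_hom)
  interpret sp: map_poly_comm_ring_hom s ..
  interpret acp: map_poly_comm_ring_hom "to_ac :: 'f \<Rightarrow> 'f alg_closure" ..
  show ?thesis
    using f
  proof induction
    case (const c)
    then obtain c0 where c0: "c0 \<in> k" "c = to_ac c0" by auto
    show ?case
      by (rule exI[of _ "[:c0:]"]) (simp add: c0(2) k[OF c0(1)] s.map_poly_pCons_hom ac.map_poly_pCons_hom)
  next
    case (gen f)
    then consider i where "i < n" "f = (\<lambda>(t, g). t $ i)"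
      | i j where "i < n" "j < n" "f = (\<lambda>(t, g). g $$ (i, j))"
      by (auto simp: unit_gens_def)
    then show ?case
    proof cases
      case (1 i)
      then show ?thesis
        by (intro exI[of _ "[:0, r i:]"]) (simp add: torus_point_def s.map_poly_pCons_hom ac.map_poly_pCons_hom)
    next
      case (2 i j)
      \<comment> \<open>With \<open>u ^ n = c\<close> the inverse of \<open>u\<close> is a
        polynomial in \<open>u\<close>. It produces the monomial of degree \<open>n - 1\<close>
        below, which has the coefficient \<open>inverse D\<close>.\<close>
      have inv: "inverse u = to_ac (inverse c) * u ^ (n - 1)"
        if "u ^ n = to_ac c" "c \<noteq> 0" for u and c :: 'f
      proof -
        have "u * (to_ac (inverse c) * u ^ (n - 1)) = to_ac (inverse c) * u ^ n"
          using n by (simp add: power_eq_if mult_ac)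
        also have "\<dots> = 1" using that by (simp add: to_ac_mult[symmetric] del: to_ac_inverse)
        finally show ?thesis by (rule inverse_unique)
      qed
      have sD: "s D \<noteq> 0" using D by simp
      show ?thesis
        using 2 B D sD
        by (intro exI[of _ "monom (inverse D * B $$ (i, j)) (n - 1)"])
          (simp add: torus_point_def inv s.map_poly_hom_monom ac.map_poly_hom_monom poly_monom to_ac_mult s.hom_mult s.hom_inverse mult_ac)
    qed
  next
    case (add f g)
    then obtain p q where "(\<forall>u. u ^ n = to_ac D \<longrightarrow> f (torus_point n r B u) = poly (map_poly to_ac p) u) \<and>
      (\<forall>u. u ^ n = to_ac (s D) \<longrightarrow>
       f (torus_point n (\<lambda>i. s (r i)) (map_mat s B) u) = poly (map_poly to_ac (map_poly s p)) u)"
      "(\<forall>u. u ^ n = to_ac D \<longrightarrow> g (torus_point n r B u) = poly (map_poly to_ac q) u) \<and>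
      (\<forall>u. u ^ n = to_ac (s D) \<longrightarrow>
       g (torus_point n (\<lambda>i. s (r i)) (map_mat s B) u) = poly (map_poly to_ac (map_poly s q)) u)"
      by blast
    then show ?case
      by (intro exI[of _ "p + q"]) (simp add: sp.hom_add acp.hom_add)
  next
    case (mult f g)
    then obtain p q where "(\<forall>u. u ^ n = to_ac D \<longrightarrow> f (torus_point n r B u) = poly (map_poly to_ac p) u) \<and>
      (\<forall>u. u ^ n = to_ac (s D) \<longrightarrow>
       f (torus_point n (\<lambda>i. s (r i)) (map_mat s B) u) = poly (map_poly to_ac (map_poly s p)) u)"
      "(\<forall>u. u ^ n = to_ac D \<longrightarrow> g (torus_point n r B u) = poly (map_poly to_ac q) u) \<and>
      (\<forall>u. u ^ n = to_ac (s D) \<longrightarrow>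
       g (torus_point n (\<lambda>i. s (r i)) (map_mat s B) u) = poly (map_poly to_ac (map_poly s q)) u)"
      by blast
    then show ?case
      by (intro exI[of _ "p * q"]) (simp add: sp.hom_mult acp.hom_mult)
  qed
qed

text \<open>The ratio of two n-th roots lies in \<mu>_n, and acting by it carries one lift to the
  other.\<close>

lemma unit_function_constant:
  assumes F: "F \<in> unit_group_ring n k" and r: "det B * (\<Prod>i<n. r i) = 1" and B: "B \<in> carrier_mat n n"
    and n: "n \<ge> 1" and u: "u ^ n = to_ac (det B)" and u0: "u0 ^ n = to_ac (det B)"
  shows "F (torus_point n r B u) = F (torus_point n r B u0)"
proof -
  have inv: "F (\<zeta> \<cdot>\<^sub>v t, inverse \<zeta> \<cdot>\<^sub>m g) = F (t, g)" if "\<zeta> ^ n = 1" "(t, g) \<in> TSL n" for \<zeta> t g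
    using F that unfolding unit_group_ring_def by blast
  have d: "det B \<noteq> 0" using r by auto
  then have nz: "u \<noteq> 0" "u0 \<noteq> 0" using u u0 n by (auto simp: power_0_left)
  define \<zeta> where "\<zeta> = u / u0"
  have "\<zeta> ^ n = 1" using u u0 d by (simp add: \<zeta>_def power_divide)
  moreover have "torus_point n r B u0 \<in> TSL n" by (rule torus_point_TSL[OF r B u0])
  moreover have "torus_point n r B u = (\<zeta> \<cdot>\<^sub>v vec n (\<lambda>i. u0 * to_ac (r i)), inverse \<zeta> \<cdot>\<^sub>m (inverse u0 \<cdot>\<^sub>m map_mat to_ac B))"
    using nz by (auto simp: torus_point_def \<zeta>_def field_simps intro!: eq_vecI eq_matI)
  ultimately show ?thesis
    using inv[of \<zeta> "vec n (\<lambda>i. u0 * to_ac (r i))" "inverse u0 \<cdot>\<^sub>m map_mat to_ac B"]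
    by (simp add: torus_point_def)
qed

text \<open>
  The value is \<open>\<mu>\<^sub>n\<close>-invariant, hence the constant coefficient of a polynomial of degree less than \<open>n\<close>
  that expresses it in terms of the \<open>n\<close>-th root \<open>u\<close>, so that it is rational.
\<close>

lemma unit_function_rational_value:
  fixes s :: "'f::field \<Rightarrow> 'f"
  assumes s: "field_hom s" and k: "\<And>c. c \<in> k \<Longrightarrow> s c = c" and n: "of_nat n \<noteq> (0 :: 'f)"
    and F: "F \<in> unit_group_ring n (to_ac ` k)"
    and r: "det B * (\<Prod>i<n. r i) = 1" and B: "B \<in> carrier_mat n n"
  shows "\<exists>c. (\<forall>u. u ^ n = to_ac (det B) \<longrightarrow> F (torus_point n r B u) = to_ac c) \<and>
    (\<forall>u. u ^ n = to_ac (s (det B)) \<longrightarrow>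
       F (torus_point n (\<lambda>i. s (r i)) (map_mat s B) u) = to_ac (s c))"
proof -
  interpret s: field_hom s by fact
  interpret ac: field_hom "to_ac :: 'f \<Rightarrow> 'f alg_closure" by (rule to_ac_hom)
  interpret sp: map_poly_comm_ring_hom s ..
  interpret acp: map_poly_comm_ring_hom "to_ac :: 'f \<Rightarrow> 'f alg_closure" ..
  have n1: "n \<ge> 1" using n by (cases n) auto
  let ?D = "det B"
  have D: "?D \<noteq> 0" using r by auto
  have acn: "of_nat n \<noteq> (0 :: 'f alg_closure)"
    using n to_ac_of_nat[of n] to_ac_eq_0_iff by metis
  obtain f where f: "f \<in> generated_functions (to_ac ` k) (unit_gens n)" "F = on_TSL n f"
    using F by (auto simp: unit_group_ring_def unit_gens_def)
  obtain p where p: "\<And>u. u ^ n = to_ac ?D \<Longrightarrow> f (torus_point n r B u) = poly (map_poly to_ac p) u"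
    "\<And>u. u ^ n = to_ac (s ?D) \<Longrightarrow>
       f (torus_point n (\<lambda>i. s (r i)) (map_mat s B) u) = poly (map_poly to_ac (map_poly s p)) u"
    using function_at_torus_points[OF s k n1 D B f(1), of r] by blast
  have rs: "det (map_mat s B) * (\<Prod>i<n. s (r i)) = 1"
    using arg_cong[OF r, of s] by (simp add: s.hom_mult s.hom_prod)
  have Bs: "map_mat s B \<in> carrier_mat n n" using B by simp
  \<comment> \<open>Division by \<open>X^n - det B\<close> leaves the values at the n-th roots
    unchanged. Applying \<open>s\<close> to the quotient and remainder gives the corresponding
    reduction for the conjugate point.\<close>
  define M where "M = monom 1 n - [:?D:]"
  have cf: "coeff M n = 1" using n1 by (simp add: M_def coeff_pCons split: nat.split)
  then have M0: "M \<noteq> 0" by auto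
  have degM: "degree M \<le> n"
    unfolding M_def by (intro degree_diff_le degree_monom_le) auto
  define q where "q = p mod M"
  have q: "degree q < n"
    using degree_mod_less[OF M0, of p] degM n1 by (auto simp: q_def)
  have pq: "p = p div M * M + q" by (simp add: q_def)
  have M1: "poly (map_poly to_ac M) u = 0" if "u ^ n = to_ac ?D" for u
    using that by (simp add: M_def acp.hom_minus s.map_poly_hom_monom ac.map_poly_hom_monom poly_monom
      s.map_poly_pCons_hom ac.map_poly_pCons_hom)
  have M2: "poly (map_poly to_ac (map_poly s M)) u = 0" if "u ^ n = to_ac (s ?D)" for u
    using that by (simp add: M_def sp.hom_minus acp.hom_minus s.map_poly_hom_monom ac.map_poly_hom_monom poly_monom
      s.map_poly_pCons_hom ac.map_poly_pCons_hom)
  have q1: "F (torus_point n r B u) = poly (map_poly to_ac q) u" if u: "u ^ n = to_ac ?D" for u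
  proof -
    have "F (torus_point n r B u) = poly (map_poly to_ac p) u"
      using torus_point_TSL[OF r B u] p(1)[OF u] by (simp add: f(2) on_TSL_def)
    also have "\<dots> = poly (map_poly to_ac q) u"
      by (subst pq) (simp add: acp.hom_add acp.hom_mult M1[OF u])
    finally show ?thesis .
  qed
  have q2: "F (torus_point n (\<lambda>i. s (r i)) (map_mat s B) u) = poly (map_poly to_ac (map_poly s q)) u"
    if u: "u ^ n = to_ac (s ?D)" for u
  proof -
    have "F (torus_point n (\<lambda>i. s (r i)) (map_mat s B) u) = poly (map_poly to_ac (map_poly s p)) u"
      using torus_point_TSL[OF rs Bs, of u] p(2)[OF u] u by (simp add: f(2) on_TSL_def)
    also have "\<dots> = poly (map_poly to_ac (map_poly s q)) u"
      by (subst pq) (simp add: acp.hom_add acp.hom_mult sp.hom_add sp.hom_mult M2[OF u])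
    finally show ?thesis .
  qed
  have deg1: "degree (map_poly to_ac q) < n" "degree (map_poly to_ac (map_poly s q)) < n"
    using q by simp_all
  have "F (torus_point n r B u) = to_ac (coeff q 0)" if u: "u ^ n = to_ac ?D" for u
  proof -
    have "F (torus_point n r B u) = coeff (map_poly to_ac q) 0"
      by (rule poly_constant_on_nth_roots[of "to_ac ?D" n])
        (use D acn deg1 in \<open>auto simp: q1[symmetric] intro: unit_function_constant[OF F r B n1 _ u]\<close>)
    then show ?thesis by simp
  qed
  moreover have "F (torus_point n (\<lambda>i. s (r i)) (map_mat s B) u) = to_ac (s (coeff q 0))"
    if u: "u ^ n = to_ac (s ?D)" for u
  proof -
    have "F (torus_point n (\<lambda>i. s (r i)) (map_mat s B) u) = coeff (map_poly to_ac (map_poly s q)) 0"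
      by (rule poly_constant_on_nth_roots[of "to_ac (s ?D)" n])
        (use D acn deg1 u in \<open>auto simp: q2[symmetric] intro!: unit_function_constant[OF F rs Bs n1]\<close>)
    then show ?thesis by simp
  qed
  ultimately show ?thesis by blast
qed

lemma inverse_mat_unique:
  fixes A :: "'f::field mat"
  assumes A: "A \<in> carrier_mat n n" and B: "B \<in> carrier_mat n n" and AB: "A * B = 1\<^sub>m n"
  shows "inverse_mat A = B"
proof -
  have "det A * det B = 1" using det_mult[OF A B] AB by simp
  then have d: "det A \<noteq> 0" by auto
  note inv = inverse_mat[OF A d]
  have "inverse_mat A = inverse_mat A * (A * B)" using inv AB by simp
  also have "\<dots> = (inverse_mat A * A) * B"
    by (rule assoc_mult_mat[symmetric, OF inv(1) A B])
  also have "\<dots> = B" using inv B by simp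
  finally show ?thesis .
qed

text \<open>Evaluation at a lift of \<open>B\<close>. The choice of the root does not affect values
  of elements of the coordinate ring, and on these \<open>of_ac\<close> recovers an element of the
  base field.\<close>

definition matrix_point :: "nat \<Rightarrow> (nat \<Rightarrow> 'f::field) \<Rightarrow> 'f mat \<Rightarrow> 'f point" where
  "matrix_point n z B =
     (\<lambda>f. of_ac (f (torus_point n (\<lambda>i. inverse (rho z i)) B (SOME u. u ^ n = to_ac (det B)))))"

text \<open>The product \<open>\<rho>_{n-1}\<close> splits into \<open>\<rho>_{n-1-i}\<close> and
  its last \<open>i\<close> factors; conjugation turns the latter into
  \<open>z_i, ..., z_1\<close>.\<close>

lemma rho_conjugate:
  fixes z :: "nat \<Rightarrow> 'f::field"
  assumes s: "field_hom s" and zs: "\<And>i. i \<in> {1..<n} \<Longrightarrow> z i = s (z (n - i))" and i: "i < n"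
  shows "s (rho z (n - 1 - i)) * rho z i = s (rho z (n - 1))"
proof -
  interpret s: field_hom s by fact
  have "rho z (n - 1) = rho z (n - 1 - i) * (\<Prod>j\<in>{n - i..<n}. z j)"
    unfolding rho_def using i
    by (subst prod.union_disjoint[symmetric]) (auto intro!: prod.cong)
  moreover have "s (\<Prod>j\<in>{n - i..<n}. z j) = rho z i"
  proof -
    have sz: "z (n - j) = s (z j)" if "j \<in> {1..<n}" for j
      using zs[of "n - j"] that by auto
    show ?thesis
      unfolding rho_def s.hom_prod
      by (rule prod.reindex_bij_witness[of _ "\<lambda>j. n - j" "\<lambda>j. n - j"]) (use i sz in auto)
  qed
  ultimately show ?thesis by (simp add: s.hom_mult)
qed

context
  fixes n :: nat and z :: "nat \<Rightarrow> 'f::field" and B :: "'f mat" and r :: "nat \<Rightarrow> 'f"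
    and u :: "'f alg_closure" and \<phi> :: "'f point"
  assumes n: "of_nat n \<noteq> (0 :: 'f)" and B: "B \<in> carrier_mat n n"
    and detB: "det B = weight_factor z n" and z: "\<And>i. i \<in> {1..<n} \<Longrightarrow> z i \<noteq> 0"
  defines "r \<equiv> \<lambda>i. inverse (rho z i)" and "u \<equiv> SOME u. u ^ n = to_ac (det B)"
    and "\<phi> \<equiv> matrix_point n z B"
begin

lemma n_pos: "n \<ge> 1"
  using n by (cases n) auto

lemma rho_nonzero: "i < n \<Longrightarrow> rho z i \<noteq> 0"
  using z by (auto simp: rho_def)

lemma weight_nonzero: "i \<le> n \<Longrightarrow> weight_factor z i \<noteq> 0"
  using rho_nonzero by (auto simp: weight_factor_def)

lemma det_r: "det B * (\<Prod>i<n. r i) = 1"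
proof -
  have "(\<Prod>i<n. rho z i) * (\<Prod>i<n. r i) = (\<Prod>i<n. rho z i * r i)"
    by (rule prod.distrib[symmetric])
  also have "\<dots> = 1" by (rule prod.neutral) (simp add: r_def rho_nonzero)
  finally show ?thesis by (simp add: detB weight_factor_def)
qed

lemma u_power: "u ^ n = to_ac (det B)"
  unfolding u_def by (rule someI_ex, rule nth_root_exists) (use n_pos in simp)

lemma u_nonzero: "u \<noteq> 0"
  using u_power det_r n_pos by (auto simp: power_0_left)

lemma T_TSL: "torus_point n r B u \<in> TSL n"
  by (rule torus_point_TSL[OF det_r B u_power])

lemma matrix_point_apply: "\<phi> f = of_ac (f (torus_point n r B u))"
  by (simp add: \<phi>_def matrix_point_def r_def u_def)

text \<open>Rationality of values, used with the identity as involution and all of the field as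
  coefficients.\<close>

lemma matrix_point_value:
  assumes "f \<in> monoid_ring n (range to_ac)"
  shows "to_ac (\<phi> f) = f (torus_point n r B u)"
proof -
  have f: "f \<in> unit_group_ring n (to_ac ` UNIV)" using assms by (simp add: monoid_ring_def)
  have "field_hom (id :: 'f \<Rightarrow> 'f)" by unfold_locales auto
  from unit_function_rational_value[OF this _ n f det_r B]
  obtain c where "f (torus_point n r B u) = to_ac c" using u_power by auto
  then show ?thesis by (simp add: matrix_point_apply of_ac_to_ac)
qed

lemma generated_value:
  assumes "f \<in> monoid_functions n"
  shows "to_ac (\<phi> (on_TSL n f)) = f (torus_point n r B u)"
  using matrix_point_value[OF image_ring_subset_monoid_ring[OF to_ac_range n_pos assms]] T_TSL
  by (simp add: on_TSL_def)

lemma matrix_point_in: "\<phi> \<in> monoid_points n"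
  unfolding monoid_points_def
proof (intro CollectI conjI allI ballI)
  show "\<phi> (on_TSL n (\<lambda>_. to_ac c)) = c" for c
    using T_TSL by (simp add: matrix_point_apply on_TSL_def of_ac_to_ac)
  fix f g :: "'f alg_closure torus_sl \<Rightarrow> 'f alg_closure"
  assume "f \<in> monoid_ring n (range to_ac)" "g \<in> monoid_ring n (range to_ac)"
  note v = this[THEN matrix_point_value, symmetric]
  show "\<phi> (\<lambda>y. f y + g y) = \<phi> f + \<phi> g"
    by (subst matrix_point_apply) (simp add: v to_ac_add[symmetric] of_ac_to_ac del: to_ac_add)
  show "\<phi> (\<lambda>y. f y * g y) = \<phi> f * \<phi> g"
    by (subst matrix_point_apply) (simp add: v to_ac_mult[symmetric] of_ac_to_ac del: to_ac_mult)
qed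

lemma matrix_point_z:
  assumes i: "i \<in> {1..<n}"
  shows "point_z n \<phi> i = z i"
proof -
  have "rho z i = rho z (i - 1) * z i"
  proof -
    obtain j where "i = Suc j" using i by (cases i) auto
    then show ?thesis by (simp add: rho_def)
  qed
  moreover have "rho z (i - 1) \<noteq> 0"
    by (rule rho_nonzero) (use i in auto)
  moreover have "z i \<noteq> 0" by (rule z[OF i])
  ultimately have "r (i - 1) / r i = z i"
    by (simp add: r_def field_simps)
  moreover have "to_ac (point_z n \<phi> i) = to_ac (r (i - 1) / r i)"
    unfolding point_z_def generated_value[OF z_coord_function[OF i]]
    using i u_nonzero by (auto simp: z_coord_def simple_root_def torus_point_def to_ac_divide)
  ultimately show ?thesis by simp
qed

lemma minor_map_mat_to_ac:
  assumes "I \<in> subsets_of_card n i" "J \<in> subsets_of_card n i"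
  shows "minor (map_mat to_ac B) I J = to_ac (minor B I J)"
proof -
  note Id = subsets_of_cardD[OF assms(1)] and Jd = subsets_of_cardD[OF assms(2)]
  have "submatrix (map_mat to_ac B) I J = map_mat to_ac (submatrix B I J)"
    unfolding submatrix_subset[OF B Id(1) Jd(1)]
      submatrix_subset[OF map_carrier_mat[THEN iffD2, OF B] Id(1) Jd(1)]
    using assms pick_less B by (intro eq_matI) (auto simp: Id Jd)
  then show ?thesis by (simp add: to_ac_det)
qed

lemma matrix_point_x:
  assumes i: "i \<in> {1..<n}" and IJ: "I \<in> subsets_of_card n i" "J \<in> subsets_of_card n i"
  shows "weight_factor z i * point_x n \<phi> i I J = minor B I J"
proof -
  have "(\<Prod>j<i. vec n (\<lambda>i. u * to_ac (r i)) $ j) = (\<Prod>j<i. u * to_ac (r j))"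
    using i by (intro prod.cong) auto
  then have "fundamental_weight i (vec n (\<lambda>i. u * to_ac (r i))) = u ^ i * to_ac (\<Prod>j<i. r j)"
    by (simp add: fundamental_weight_def prod.distrib to_ac_prod)
  moreover have "(\<Prod>j<i. r j) = inverse (weight_factor z i)"
    using prod_inversef[of "rho z" "{..<i}"] by (simp add: r_def weight_factor_def o_def)
  moreover have "minor (inverse u \<cdot>\<^sub>m map_mat to_ac B) I J = inverse u ^ i * to_ac (minor B I J)"
    using minor_smult[of "map_mat to_ac B" n I i J] IJ B by (simp add: minor_map_mat_to_ac)
  ultimately have "to_ac (point_x n \<phi> i I J) = to_ac (inverse (weight_factor z i) * minor B I J)"
    unfolding point_x_def generated_value[OF x_coord_function[OF i IJ]]
    using u_nonzero by (simp add: x_coord_def torus_point_def to_ac_mult power_inverse)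
  then have "point_x n \<phi> i I J = inverse (weight_factor z i) * minor B I J"
    by (simp only: to_ac_eq_iff)
  then show ?thesis using weight_nonzero[of i] i by simp
qed

text \<open>Conjugation by \<open>H\<close> and \<open>tau\<close> both send the lift of
  \<open>B\<close> to lifts of other matrices, namely of \<open>C = H B H^-1\<close> and of
  \<open>B' = Z (B^-1)^T\<close>. The similitude relation says precisely that \<open>C\<close> is
  the conjugate of \<open>B'\<close>, and a regular function takes conjugate values at conjugate
  data.\<close>

lemma matrix_point_twisted:
  assumes s: "field_hom s" and k: "\<And>c. c \<in> k \<Longrightarrow> s c = c"
    and H: "H \<in> carrier_mat n n" "det H \<noteq> 0"
    and zs: "\<And>i. i \<in> {1..<n} \<Longrightarrow> z i = s (z (n - i))"
    and sim: "adjoint_mat s B * H * B = s (rho z (n - 1)) \<cdot>\<^sub>m H"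
  shows "\<phi> \<in> twisted_points n k s H"
proof -
  interpret s: field_hom s by fact
  interpret ac: field_hom "to_ac :: 'f \<Rightarrow> 'f alg_closure" by (rule to_ac_hom)
  let ?Z = "rho z (n - 1)"
  have Z0: "?Z \<noteq> 0" using rho_nonzero n_pos by simp
  have dB: "det B \<noteq> 0" using det_r by auto
  note invH = inverse_mat[OF H] and invB = inverse_mat[OF B dB]
  let ?C = "H * B * inverse_mat H"
  \<comment> \<open>The factor \<open>Z\<close> is distributed so that the first entry of
    \<open>r'\<close> is 1, as for \<open>r\<close>: the torus part of \<open>tau\<close> is
    \<open>inverse u * rho z (n - 1 - i)\<close>, which equals \<open>u' * r' i\<close>.\<close>
  define B' where "B' = ?Z \<cdot>\<^sub>m (inverse_mat B)\<^sup>T"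
  define r' where "r' = (\<lambda>i. rho z (n - 1 - i) / ?Z)"
  define u' where "u' = inverse u * to_ac ?Z"
  have C: "?C \<in> carrier_mat n n" using H B invH by auto
  have B': "B' \<in> carrier_mat n n" using invB by (simp add: B'_def)
  have sB': "map_mat s B' = ?C"
  proof -
    let ?N = "(map_mat s (inverse_mat B))\<^sup>T"
    have N: "?N \<in> carrier_mat n n" using invB by simp
    have a: "adjoint_mat s B \<in> carrier_mat n n" using B by (simp add: adjoint_mat_def)
    have "?N * adjoint_mat s B = (map_mat s (B * inverse_mat B))\<^sup>T"
      unfolding map_mat_hom_mult[OF s B invB(1)] adjoint_mat_def
      by (rule transpose_mult[symmetric, of _ n n _ n]) (use B invB in auto)
    also have "\<dots> = 1\<^sub>m n" by (simp add: invB s.mat_hom_one)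
    finally have NB: "?N * adjoint_mat s B = 1\<^sub>m n" .
    have "adjoint_mat s B * ?C = (adjoint_mat s B * H * B) * inverse_mat H"
      using a H B invH by (simp add: assoc_mult_mat[of _ n n _ n _ n])
    also have "\<dots> = s ?Z \<cdot>\<^sub>m 1\<^sub>m n"
      unfolding sim using H invH by (simp add: mult_smult_assoc_mat[of _ n n _ n])
    finally have "?N * (adjoint_mat s B * ?C) = s ?Z \<cdot>\<^sub>m ?N"
      using N by (simp add: mult_smult_distrib[of _ n n _ n])
    moreover have "?N * (adjoint_mat s B * ?C) = ?C"
      unfolding assoc_mult_mat[OF N a C, symmetric] NB by (rule left_mult_one_mat[OF C])
    moreover have "map_mat s B' = s ?Z \<cdot>\<^sub>m ?N"
      unfolding B'_def by (intro eq_matI) (auto simp: s.hom_mult)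
    ultimately show ?thesis by simp
  qed
  have sr': "s (r' i) = r i" if "i < n" for i
    using rho_conjugate[where n = n and z = z and s = s, OF s zs that] Z0 rho_nonzero[OF that]
    by (simp add: r'_def r_def s.hom_div field_simps)
  have detC: "det ?C = det B"
  proof -
    have "det H * det (inverse_mat H) = 1"
      using det_mult[OF H(1) invH(1)] invH(2) by simp
    then show ?thesis using H B invH by (simp add: det_mult[of _ n])
  qed
  have sdet: "s (det B') = det B" using sB' detC by (metis s.hom_det)
  have "s (det B' * (\<Prod>i<n. r' i)) = det B * (\<Prod>i<n. r i)"
    by (simp add: s.hom_mult s.hom_prod sdet sr')
  then have det_r': "det B' * (\<Prod>i<n. r' i) = 1" using det_r s.eq_iff[of _ 1] by simp
  have u': "u' ^ n = to_ac (det B')"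
  proof -
    have "det B * det (inverse_mat B) = 1"
      using det_mult[OF B invB(1)] invB(2) by simp
    then have "det (inverse_mat B) = inverse (det B)" by (metis inverse_unique)
    then have "det B' = ?Z ^ n * inverse (det B)"
      using invB by (simp add: B'_def det_transpose)
    then show ?thesis
      by (simp add: u'_def power_mult_distrib power_inverse u_power to_ac_mult to_ac_power to_ac_inverse)
  qed
  have tau: "tau n (torus_point n r B u) = torus_point n r' B' u'"
  proof -
    have "inverse_mat (inverse u \<cdot>\<^sub>m map_mat to_ac B) = u \<cdot>\<^sub>m map_mat to_ac (inverse_mat B)"
    proof (rule inverse_mat_unique)
      have "(inverse u \<cdot>\<^sub>m map_mat to_ac B) * (u \<cdot>\<^sub>m map_mat to_ac (inverse_mat B)) =
         u \<cdot>\<^sub>m (inverse u \<cdot>\<^sub>m (map_mat to_ac B * map_mat to_ac (inverse_mat B)))"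
        using B invB by (simp add: mult_smult_assoc_mat[of _ n n _ n] mult_smult_distrib[of _ n n _ n])
      also have "\<dots> = 1\<^sub>m n"
        unfolding map_mat_to_ac_inverse[OF B invB(1,2)] using u_nonzero by (intro eq_matI) auto
      finally show "(inverse u \<cdot>\<^sub>m map_mat to_ac B) * (u \<cdot>\<^sub>m map_mat to_ac (inverse_mat B)) = 1\<^sub>m n" .
    qed (use B invB in auto)
    then show ?thesis
      using u_nonzero Z0 invB rho_nonzero
      by (auto simp: tau_def torus_point_def r'_def B'_def u'_def r_def to_ac_divide to_ac_inverse
          to_ac_mult intro!: eq_vecI eq_matI)
  qed
  have conj: "(case torus_point n r B u of (t, g) \<Rightarrow> f (t, map_mat to_ac H * g * map_mat to_ac (inverse_mat H))) =
      f (torus_point n r ?C u)" for f :: "'f alg_closure torus_sl \<Rightarrow> 'f alg_closure"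
  proof -
    have "map_mat to_ac H * (inverse u \<cdot>\<^sub>m map_mat to_ac B) * map_mat to_ac (inverse_mat H) =
       inverse u \<cdot>\<^sub>m (map_mat to_ac H * map_mat to_ac B * map_mat to_ac (inverse_mat H))"
      using H B invH by (simp add: mult_smult_assoc_mat[of _ n n _ n] mult_smult_distrib[of _ n n _ n])
    also have "map_mat to_ac H * map_mat to_ac B * map_mat to_ac (inverse_mat H) = map_mat to_ac ?C"
      using H B invH by (simp add: map_mat_hom_mult[OF to_ac_hom, of _ n])
    finally show ?thesis by (simp add: torus_point_def)
  qed
  have "\<phi> (on_TSL n (\<lambda>(t, g). f (t, map_mat to_ac H * g * map_mat to_ac (inverse_mat H)))) =
     s (\<phi> (on_TSL n (\<lambda>y. f (tau n y))))" if f: "f \<in> monoid_ring n (to_ac ` k)" for f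
  proof -
    have "f \<in> unit_group_ring n (to_ac ` k)" using f by (simp add: monoid_ring_def)
    \<comment> \<open>The matrix \<open>B'\<close> belongs to the \<open>tau\<close> side, and its
      conjugate to the side conjugated by \<open>H\<close>; since \<open>s (det B') = det B\<close>,
      the old root \<open>u\<close> can be used there.\<close>
    from unit_function_rational_value[OF s k n this det_r' B']
    obtain c where c: "f (torus_point n r' B' u') = to_ac c"
      "f (torus_point n (\<lambda>i. s (r' i)) (map_mat s B') u) = to_ac (s c)"
      using u' u_power sdet by auto
    have "torus_point n (\<lambda>i. s (r' i)) (map_mat s B') u = torus_point n r ?C u"
      unfolding sB' by (auto simp: torus_point_def sr' intro!: eq_vecI)
    then have "f (torus_point n r ?C u) = to_ac (s c)" using c by simp
    then show ?thesis
      using T_TSL by (simp only: matrix_point_apply on_TSL_def if_True conj tau c of_ac_to_ac)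
  qed
  then show ?thesis using matrix_point_in by (simp add: twisted_points_def)
qed

end

section \<open>Hermitian forms over a field with involution\<close>

definition herm :: "('f::field \<Rightarrow> 'f) \<Rightarrow> 'f mat \<Rightarrow> 'f vec \<Rightarrow> 'f vec \<Rightarrow> 'f" where
  "herm s H v w = map_vec s v \<bullet> (H *\<^sub>v w)"

context
  fixes n :: nat and s :: "'f::field \<Rightarrow> 'f"
  assumes s: "field_hom s" and ss: "\<And>x. s (s x) = x" and two: "(2 :: 'f) \<noteq> 0"
begin

interpretation s: field_hom s by (rule s)

lemma adjoint_mult:
  assumes "A \<in> carrier_mat n n" "B \<in> carrier_mat n n"
  shows "adjoint_mat s (A * B) = adjoint_mat s B * adjoint_mat s A"
  unfolding adjoint_mat_def map_mat_hom_mult[OF s assms]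
  by (rule transpose_mult[of _ n n _ n]) (use assms in auto)

lemma adjoint_carrier: "A \<in> carrier_mat n n \<Longrightarrow> adjoint_mat s A \<in> carrier_mat n n"
  by (simp add: adjoint_mat_def)

lemma adjoint_adjoint: "A \<in> carrier_mat n n \<Longrightarrow> adjoint_mat s (adjoint_mat s A) = A"
  by (intro eq_matI) (auto simp: adjoint_mat_def ss)

lemma det_adjoint: "A \<in> carrier_mat n n \<Longrightarrow> det (adjoint_mat s A) = s (det A)"
  by (simp add: adjoint_mat_def det_transpose)

lemma adjoint_one: "adjoint_mat s (1\<^sub>m n) = 1\<^sub>m n"
  by (simp add: adjoint_mat_def s.mat_hom_one)

lemma isometric_congruence:
  assumes H: "H \<in> hermitian_forms n s" and p: "p \<in> carrier_mat n n" "det p \<noteq> 0"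
  shows "(H, adjoint_mat s p * H * p) \<in> isometric n s"
proof -
  have Hc: "H \<in> carrier_mat n n" "adjoint_mat s H = H" "det H \<noteq> 0"
    using H by (auto simp: hermitian_forms_def)
  note a = adjoint_carrier[OF p(1)]
  have c: "adjoint_mat s p * H * p \<in> carrier_mat n n" using Hc p a by auto
  have "adjoint_mat s (adjoint_mat s p * H * p) = adjoint_mat s p * (H * p)"
    using Hc p a by (simp add: adjoint_mult[of _ p] adjoint_mult[of "adjoint_mat s p" H] adjoint_adjoint
        del: assoc_mult_mat)
  moreover have "\<dots> = adjoint_mat s p * H * p"
    by (rule assoc_mult_mat[symmetric, OF a Hc(1) p(1)])
  moreover have "det (adjoint_mat s p * H * p) \<noteq> 0"
    using Hc p a by (simp add: det_mult[of _ n] det_adjoint del: assoc_mult_mat)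
  ultimately have "adjoint_mat s p * H * p \<in> hermitian_forms n s"
    using c by (simp add: hermitian_forms_def)
  then show ?thesis using H p by (auto simp: isometric_def)
qed

lemma isometric_equiv: "equiv (hermitian_forms n s) (isometric n s)"
proof (rule equivI)
  show "isometric n s \<subseteq> hermitian_forms n s \<times> hermitian_forms n s"
    by (auto simp: isometric_def)
  show "refl_on (hermitian_forms n s) (isometric n s)"
  proof (rule refl_onI)
    fix H assume H: "H \<in> hermitian_forms n s"
    then have "H \<in> carrier_mat n n" by (simp add: hermitian_forms_def)
    then have "adjoint_mat s (1\<^sub>m n) * H * 1\<^sub>m n = H" by (simp add: adjoint_one)
    then show "(H, H) \<in> isometric n s"
      using isometric_congruence[OF H, of "1\<^sub>m n"] by simp
  qed
  show "sym (isometric n s)"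
  proof (rule symI)
    fix H H' assume "(H, H') \<in> isometric n s"
    then obtain p where H: "H \<in> hermitian_forms n s" "H' \<in> hermitian_forms n s"
      and p: "p \<in> carrier_mat n n" "det p \<noteq> 0" "H' = adjoint_mat s p * H * p"
      by (auto simp: isometric_def)
    have Hc: "H \<in> carrier_mat n n" using H by (simp add: hermitian_forms_def)
    let ?q = "inverse_mat p"
    note q = inverse_mat[OF p(1,2)] and a = adjoint_carrier[OF p(1)]
    note aq = adjoint_carrier[OF q(1)]
    have "det p * det ?q = 1" using det_mult[OF p(1) q(1)] q(2) by simp
    then have dq: "det ?q \<noteq> 0" by auto
    have "adjoint_mat s ?q * H' * ?q = (adjoint_mat s ?q * adjoint_mat s p) * H * (p * ?q)"
      unfolding p(3) using Hc p(1) q(1) a aq by (simp add: assoc_mult_mat[of _ n n _ n _ n])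
    also have "adjoint_mat s ?q * adjoint_mat s p = 1\<^sub>m n"
      unfolding adjoint_mult[OF p(1) q(1), symmetric] q(2) by (rule adjoint_one)
    finally have "adjoint_mat s ?q * H' * ?q = H" using q Hc by simp
    then show "(H', H) \<in> isometric n s"
      using isometric_congruence[OF H(2) q(1) dq] by simp
  qed
  show "trans (isometric n s)"
  proof (rule transI)
    fix H H' H'' assume "(H, H') \<in> isometric n s" "(H', H'') \<in> isometric n s"
    then obtain p q where H: "H \<in> hermitian_forms n s"
      and p: "p \<in> carrier_mat n n" "det p \<noteq> 0" "H' = adjoint_mat s p * H * p"
      and q: "q \<in> carrier_mat n n" "det q \<noteq> 0" "H'' = adjoint_mat s q * H' * q"
      by (auto simp: isometric_def)
    have Hc: "H \<in> carrier_mat n n" using H by (simp add: hermitian_forms_def)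
    have "adjoint_mat s (p * q) * H * (p * q) = H''"
      unfolding q(3) p(3) adjoint_mult[OF p(1) q(1)]
      using Hc p(1) q(1) adjoint_carrier[OF p(1)] adjoint_carrier[OF q(1)]
      by (simp add: assoc_mult_mat[of _ n n _ n _ n])
    then show "(H, H'') \<in> isometric n s"
      using isometric_congruence[OF H, of "p * q"] p q by (simp add: det_mult)
  qed
qed

lemma herm_add_right:
  assumes "H \<in> carrier_mat n n" "u \<in> carrier_vec n" "v \<in> carrier_vec n" "w \<in> carrier_vec n"
  shows "herm s H u (v + w) = herm s H u v + herm s H u w"
  using assms by (simp add: herm_def mult_add_distrib_mat_vec[of _ n n] scalar_prod_add_distrib[of _ n])

lemma herm_smult_right:
  assumes "H \<in> carrier_mat n n" "u \<in> carrier_vec n" "v \<in> carrier_vec n"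
  shows "herm s H u (c \<cdot>\<^sub>v v) = c * herm s H u v"
  using assms by (simp add: herm_def mult_mat_vec[of _ n n] scalar_prod_smult_distrib[of _ n])

lemma herm_sum:
  assumes "H \<in> carrier_mat n n" "u \<in> carrier_vec n" "v \<in> carrier_vec n"
  shows "herm s H u v = (\<Sum>i<n. \<Sum>j<n. s (u $ i) * H $$ (i, j) * v $ j)"
  using assms by (simp add: herm_def scalar_prod_def lessThan_atLeast0 sum_distrib_left mult_ac)

lemma herm_sym:
  assumes H: "H \<in> carrier_mat n n" "adjoint_mat s H = H" and u: "u \<in> carrier_vec n" and v: "v \<in> carrier_vec n"
  shows "herm s H v u = s (herm s H u v)"
proof -
  have h: "s (H $$ (i, j)) = H $$ (j, i)" if "i < n" "j < n" for i j
    using arg_cong[OF H(2), of "\<lambda>M. M $$ (j, i)"] that H(1) by (simp add: adjoint_mat_def)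
  have "s (herm s H u v) = (\<Sum>i<n. \<Sum>j<n. s (v $ j) * H $$ (j, i) * u $ i)"
    unfolding herm_sum[OF H(1) u v] s.hom_sum
    by (intro sum.cong refl) (simp add: s.hom_mult h ss mult_ac)
  also have "\<dots> = herm s H v u"
    unfolding herm_sum[OF H(1) v u] by (rule sum.swap)
  finally show ?thesis ..
qed

text \<open>
  A nonzero vector exists in the orthogonal complement of fewer than \<open>n\<close> vectors; if it is isotropic,
  it pairs nontrivially with another vector of the complement, since the form is nondegenerate there.
\<close>

lemma anisotropic_in_complement:
  assumes H: "H \<in> hermitian_forms n s" and m: "m < n"
    and v: "\<And>i. i < m \<Longrightarrow> v i \<in> carrier_vec n"
    and orth: "\<And>i j. i < m \<Longrightarrow> j < m \<Longrightarrow> i \<noteq> j \<Longrightarrow> herm s H (v i) (v j) = 0"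
    and anis: "\<And>i. i < m \<Longrightarrow> herm s H (v i) (v i) \<noteq> 0"
  shows "\<exists>w\<in>carrier_vec n. (\<forall>i<m. herm s H (v i) w = 0) \<and> herm s H w w \<noteq> 0"
proof -
  have Hc: "H \<in> carrier_mat n n" "adjoint_mat s H = H" "det H \<noteq> 0"
    using H by (auto simp: hermitian_forms_def)
  note add = herm_add_right[OF Hc(1)] and smult = herm_smult_right[OF Hc(1)] and sym = herm_sym[OF Hc(1,2)]
  \<comment> \<open>The first \<open>m\<close> rows are the functionals
    \<open>herm s H (v i)\<close> and the others vanish. As \<open>m < n\<close> there is a zero
    row, so the kernel is nonzero.\<close>
  define R where "R = mat n n (\<lambda>(i, j). if i < m then (\<Sum>k<n. s (v i $ k) * H $$ (k, j)) else 0)"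
  have Rc: "R \<in> carrier_mat n n" by (simp add: R_def)
  have "det R = 0"
    by (subst laplace_expansion_row[OF Rc m], rule sum.neutral) (use m in \<open>auto simp: R_def\<close>)
  then obtain w where w: "w \<in> carrier_vec n" "w \<noteq> 0\<^sub>v n" "R *\<^sub>v w = 0\<^sub>v n"
    using det_0_iff_vec_prod_zero_field[OF Rc] by blast
  have wo: "herm s H (v i) w = 0" if i: "i < m" for i
  proof -
    have "0 = (R *\<^sub>v w) $ i" using w i m by simp
    also have "\<dots> = (\<Sum>j<n. (\<Sum>k<n. s (v i $ k) * H $$ (k, j)) * w $ j)"
      using i m w(1) by (simp add: R_def scalar_prod_def lessThan_atLeast0)
    also have "\<dots> = (\<Sum>j<n. \<Sum>k<n. s (v i $ k) * H $$ (k, j) * w $ j)"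
      by (simp add: sum_distrib_right)
    also have "\<dots> = herm s H (v i) w"
      unfolding herm_sum[OF Hc(1) v[OF i] w(1)] by (rule sum.swap)
    finally show ?thesis ..
  qed
  show ?thesis
  proof (cases "herm s H w w = 0")
    case False
    then show ?thesis using w wo by blast
  next
    case True
    have "H *\<^sub>v w \<noteq> 0\<^sub>v n"
      using det_0_iff_vec_prod_zero_field[OF Hc(1)] Hc(3) w by blast
    moreover have "H *\<^sub>v w = 0\<^sub>v n" if "\<And>k. k < n \<Longrightarrow> (H *\<^sub>v w) $ k = 0"
      using that carrier_matD[OF Hc(1)] by (intro eq_vecI) (simp_all del: index_mult_mat_vec)
    ultimately obtain k where k: "k < n" "(H *\<^sub>v w) $ k \<noteq> 0" by blast
    define y0 :: "'f vec" where "y0 = unit_vec n k"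
    have y0: "y0 \<in> carrier_vec n" by (simp add: y0_def)
    have "map_vec s y0 = unit_vec n k" by (auto simp: y0_def unit_vec_def)
    then have y0w: "herm s H y0 w \<noteq> 0"
      using k Hc w by (simp add: herm_def scalar_prod_left_unit[of _ n])
    then have wy0: "herm s H w y0 \<noteq> 0" using sym[OF y0 w(1)] by simp
    have "\<exists>y\<in>carrier_vec n. (\<forall>i<l. herm s H (v i) y = 0) \<and> herm s H w y = herm s H w y0" if "l \<le> m" for l
      using that
    proof (induction l)
      case 0
      then show ?case using y0 by auto
    next
      case (Suc l)
      then obtain y where y: "y \<in> carrier_vec n" "\<forall>i<l. herm s H (v i) y = 0" "herm s H w y = herm s H w y0"
        by auto
      have l: "l < m" using Suc by simp
      \<comment> \<open>One Gram-Schmidt correction by \<open>v l\<close>. The vector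
        \<open>w\<close> is orthogonal to \<open>v l\<close>, so the pairing with \<open>w\<close>
        survives.\<close>
      let ?c = "- herm s H (v l) y / herm s H (v l) (v l)"
      let ?y = "y + ?c \<cdot>\<^sub>v v l"
      have e: "herm s H a ?y = herm s H a y + ?c * herm s H a (v l)" if "a \<in> carrier_vec n" for a
        using that y v[OF l] by (simp add: add smult)
      have "herm s H (v i) ?y = 0" if "i < Suc l" for i
        using that e[of "v i"] v[of i] y orth[of i l] anis[OF l] l by (cases "i = l") auto
      moreover have "herm s H w (v l) = 0" using sym[OF v[OF l] w(1)] wo[OF l] by simp
      then have "herm s H w ?y = herm s H w y0" using e[OF w(1)] y by simp
      ultimately show ?case using y v[OF l] by (intro bexI[of _ ?y]) auto
    qed
    then obtain y where y: "y \<in> carrier_vec n" "\<forall>i<m. herm s H (v i) y = 0" "herm s H w y \<noteq> 0"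
      using wy0 by force
    show ?thesis
    proof (cases "herm s H y y = 0")
      case False
      then show ?thesis using y by blast
    next
      case yy: True
      \<comment> \<open>Scaling makes \<open>w\<close> and \<open>c y\<close> a hyperbolic pair with
        pairing 1, so their sum has norm 2, which is nonzero.\<close>
      define c where "c = inverse (herm s H w y)"
      let ?x = "w + c \<cdot>\<^sub>v y"
      have x: "?x \<in> carrier_vec n" using w y by simp
      have "herm s H w ?x = 1" using w y True by (simp add: add smult c_def)
      then have xw: "herm s H ?x w = 1" using sym[OF w(1) x] by simp
      have "herm s H y ?x = s (herm s H w y)"
        using w y yy by (simp add: add smult sym[OF w(1) y(1)])
      then have xy: "herm s H ?x y = herm s H w y" using sym[OF y(1) x] ss by simp
      have "herm s H ?x ?x = herm s H ?x w + c * herm s H ?x y"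
        using x w y by (simp add: add smult)
      also have "\<dots> = 2" using xw xy y by (simp add: c_def)
      finally have "herm s H ?x ?x \<noteq> 0" using two by simp
      moreover have "\<forall>i<m. herm s H (v i) ?x = 0" using v w y wo by (simp add: add smult)
      ultimately show ?thesis using x by blast
    qed
  qed
qed

end

text \<open>The normal form of a Hermitian form when binary forms represent 1: only the last
  diagonal entry is left as an invariant.\<close>

definition almost_unit_mat :: "nat \<Rightarrow> 'f::field \<Rightarrow> 'f mat" where
  "almost_unit_mat n d = mat n n (\<lambda>(i, j). if i = j then (if i = n - 1 then d else 1) else 0)"

lemma almost_unit_carrier [simp]: "almost_unit_mat n d \<in> carrier_mat n n"
  by (simp add: almost_unit_mat_def)

lemma almost_unit_mult: "almost_unit_mat n a * almost_unit_mat n b = almost_unit_mat n (a * b)"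
proof (rule eq_matI)
  fix i j assume "i < dim_row (almost_unit_mat n (a * b))" "j < dim_col (almost_unit_mat n (a * b))"
  then have ij: "i < n" "j < n" by (auto simp: almost_unit_mat_def)
  have "(almost_unit_mat n a * almost_unit_mat n b) $$ (i, j) =
     (\<Sum>k<n. almost_unit_mat n a $$ (i, k) * almost_unit_mat n b $$ (k, j))"
    using ij carrier_matD[OF almost_unit_carrier[of n a]] carrier_matD[OF almost_unit_carrier[of n b]]
    by (simp add: scalar_prod_def lessThan_atLeast0)
  also have "\<dots> = (\<Sum>k<n. if k = i then (if i = n - 1 then a else 1) * almost_unit_mat n b $$ (i, j) else 0)"
    by (rule sum.cong[OF refl]) (use ij in \<open>auto simp: almost_unit_mat_def\<close>)
  finally show "(almost_unit_mat n a * almost_unit_mat n b) $$ (i, j) = almost_unit_mat n (a * b) $$ (i, j)"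
    using ij by (simp add: almost_unit_mat_def)
qed (auto simp: almost_unit_mat_def)

lemma det_almost_unit:
  assumes "n \<ge> 1"
  shows "det (almost_unit_mat n d) = d"
proof -
  obtain m where m: "n = Suc m" using assms by (cases n) auto
  have "det (almost_unit_mat n d) = prod_list (diag_mat (almost_unit_mat n d))"
    by (rule det_upper_triangular[of _ n]) (auto simp: almost_unit_mat_def)
  also have "\<dots> = (\<Prod>i<n. if i = n - 1 then d else 1)"
    by (simp add: diag_mat_def prod.list_conv_set_nth almost_unit_mat_def lessThan_atLeast0)
  also have "\<dots> = d" using m by simp
  finally show ?thesis .
qed

context
  fixes n :: nat and s :: "'f::field \<Rightarrow> 'f"
  assumes s: "field_hom s" and ss: "\<And>x. s (s x) = x" and two: "(2 :: 'f) \<noteq> 0"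
    and universal: "\<And>a b. a \<noteq> 0 \<Longrightarrow> b \<noteq> 0 \<Longrightarrow> s a = a \<Longrightarrow> s b = b \<Longrightarrow>
      \<exists>x y. a * (x * s x) + b * (y * s y) = 1"
    and n: "n \<ge> 1"
begin

interpretation s: field_hom s by (rule s)

text \<open>As long as the complement of the vectors found has dimension at least 2, it contains two
  orthogonal anisotropic vectors, and by \<open>universal\<close> some combination of them has norm
  1. The process therefore stops at \<open>n - 1\<close> vectors.\<close>

lemma orthonormal_exists:
  assumes H: "H \<in> hermitian_forms n s"
  shows "m < n \<Longrightarrow> \<exists>v. (\<forall>i<m. v i \<in> carrier_vec n) \<and>
    (\<forall>i<m. \<forall>j<m. herm s H (v i) (v j) = (if i = j then 1 else 0))"
proof (induction m)
  case (Suc m)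
  have Hc: "H \<in> carrier_mat n n" "adjoint_mat s H = H"
    using H by (auto simp: hermitian_forms_def)
  note add = herm_add_right[OF s ss two Hc(1)] and smult = herm_smult_right[OF s ss two Hc(1)]
    and sym = herm_sym[OF s ss two Hc]
  from Suc obtain v where v: "\<And>i. i < m \<Longrightarrow> v i \<in> carrier_vec n"
    "\<And>i j. i < m \<Longrightarrow> j < m \<Longrightarrow> herm s H (v i) (v j) = (if i = j then 1 else 0)"
    by auto
  have "m < n" using Suc.prems by simp
  from anisotropic_in_complement[OF s ss two H this v(1)] v(2)
  obtain w1 where w1: "w1 \<in> carrier_vec n" "\<forall>i<m. herm s H (v i) w1 = 0" "herm s H w1 w1 \<noteq> 0"
    by force
  have w1v: "herm s H w1 (v i) = 0" if "i < m" for i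
    using sym[OF v(1)[OF that] w1(1)] w1(2) that by simp
  \<comment> \<open>Adding \<open>w1\<close> to the family makes the second anisotropic vector
    orthogonal to it; \<open>Suc m < n\<close> leaves room for this.\<close>
  define v' where "v' = v(m := w1)"
  have "\<exists>w\<in>carrier_vec n. (\<forall>i<Suc m. herm s H (v' i) w = 0) \<and> herm s H w w \<noteq> 0"
    by (rule anisotropic_in_complement[OF s ss two H Suc.prems])
      (use v w1 w1v in \<open>auto simp: v'_def less_Suc_eq\<close>)
  then obtain w2 where w2: "w2 \<in> carrier_vec n" "\<forall>i<Suc m. herm s H (v' i) w2 = 0" "herm s H w2 w2 \<noteq> 0"
    by blast
  have vw2: "herm s H (v i) w2 = 0" if "i < m" for i
    using w2(2)[rule_format, of i] that by (simp add: v'_def)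
  have w12: "herm s H w1 w2 = 0"
    using w2(2)[rule_format, of m] by (simp add: v'_def)
  then have w21: "herm s H w2 w1 = 0" using sym[OF w1(1) w2(1)] by simp
  obtain x y where xy: "herm s H w1 w1 * (x * s x) + herm s H w2 w2 * (y * s y) = 1"
    using universal[OF w1(3) w2(3) sym[OF w1(1,1), symmetric] sym[OF w2(1,1), symmetric]] by blast
  define w where "w = x \<cdot>\<^sub>v w1 + y \<cdot>\<^sub>v w2"
  have w: "w \<in> carrier_vec n" using w1 w2 by (simp add: w_def)
  have e: "herm s H u w = x * herm s H u w1 + y * herm s H u w2" if "u \<in> carrier_vec n" for u
    using that w1 w2 by (simp add: w_def add smult)
  have "herm s H w w1 = s x * herm s H w1 w1"
    using sym[OF w1(1) w] e[OF w1(1)] w12 sym[OF w1(1,1)] by (simp add: s.hom_mult)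
  moreover have "herm s H w w2 = s y * herm s H w2 w2"
    using sym[OF w2(1) w] e[OF w2(1)] w21 sym[OF w2(1,1)] by (simp add: s.hom_mult)
  ultimately have ww: "herm s H w w = 1" using e[OF w] xy by (simp add: mult_ac)
  have vw: "herm s H (v i) w = 0" if "i < m" for i
    using e[OF v(1)[OF that]] w1(2) vw2 that by simp
  then have wv: "herm s H w (v i) = 0" if "i < m" for i
    using sym[OF v(1)[OF that] w] that by simp
  show ?case
    by (rule exI[of _ "v(m := w)"]) (use v w ww vw wv in \<open>auto simp: less_Suc_eq\<close>)
qed simp

lemma adjoint_congruence_index:
  assumes H: "H \<in> carrier_mat n n" and p: "p \<in> carrier_mat n n" and ij: "i < n" "j < n"
  shows "(adjoint_mat s p * H * p) $$ (i, j) = herm s H (col p i) (col p j)"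
proof -
  have a: "adjoint_mat s p \<in> carrier_mat n n" using p by (simp add: adjoint_mat_def)
  have "(adjoint_mat s p * H * p) $$ (i, j) = (adjoint_mat s p * (H * p)) $$ (i, j)"
    using assoc_mult_mat[OF a H p] by simp
  also have "\<dots> = row (adjoint_mat s p) i \<bullet> col (H * p) j"
    using a H p ij by (intro index_mult_mat(1)) auto
  also have "row (adjoint_mat s p) i = map_vec s (col p i)"
    using p ij by (auto simp: adjoint_mat_def intro!: eq_vecI)
  also have "col (H * p) j = H *\<^sub>v col p j"
    by (rule col_mult2[OF H p ij(2)])
  finally show ?thesis by (simp add: herm_def)
qed

text \<open>An orthonormal family of \<open>n - 1\<close> vectors is completed by any anisotropic
  vector of its complement. Comparing determinants shows that the last entry is \<open>det H\<close>
  up to a norm.\<close>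

lemma isometric_almost_unit:
  assumes H: "H \<in> hermitian_forms n s"
  shows "\<exists>c d. c \<noteq> 0 \<and> d = c * s c * det H \<and> (H, almost_unit_mat n d) \<in> isometric n s"
proof -
  have Hc: "H \<in> carrier_mat n n" "adjoint_mat s H = H"
    using H by (auto simp: hermitian_forms_def)
  note sym = herm_sym[OF s ss two Hc]
  let ?m = "n - 1"
  have m: "?m < n" using n by simp
  obtain v where v: "\<And>i. i < ?m \<Longrightarrow> v i \<in> carrier_vec n"
    "\<And>i j. i < ?m \<Longrightarrow> j < ?m \<Longrightarrow> herm s H (v i) (v j) = (if i = j then 1 else 0)"
    using orthonormal_exists[OF H m] by blast
  from anisotropic_in_complement[OF s ss two H m v(1)] v(2)
  obtain w where w: "w \<in> carrier_vec n" "\<forall>i<?m. herm s H (v i) w = 0" "herm s H w w \<noteq> 0"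
    by force
  have wv: "herm s H w (v i) = 0" if "i < ?m" for i
    using sym[OF v(1)[OF that] w(1)] w(2) that by simp
  define d where "d = herm s H w w"
  define p where "p = mat n n (\<lambda>(i, j). (if j = ?m then w else v j) $ i)"
  have p: "p \<in> carrier_mat n n" by (simp add: p_def)
  have col: "col p j = (if j = ?m then w else v j)" if "j < n" for j
  proof -
    have "j < ?m \<or> j = ?m" using that by auto
    then have "(if j = ?m then w else v j) \<in> carrier_vec n" using v(1)[of j] w(1) by auto
    then show ?thesis using that by (intro eq_vecI) (simp_all add: p_def carrier_vecD)
  qed
  have eq: "adjoint_mat s p * H * p = almost_unit_mat n d"
  proof (rule eq_matI)
    fix i j assume "i < dim_row (almost_unit_mat n d)" "j < dim_col (almost_unit_mat n d)"
    then have ij: "i < n" "j < n" by (auto simp: almost_unit_mat_def)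
    then have "i < ?m \<or> i = ?m" "j < ?m \<or> j = ?m" by auto
    then show "(adjoint_mat s p * H * p) $$ (i, j) = almost_unit_mat n d $$ (i, j)"
      unfolding adjoint_congruence_index[OF Hc(1) p ij] col[OF ij(1)] col[OF ij(2)]
      using ij v w wv by (auto simp: almost_unit_mat_def d_def)
  qed (use p Hc in \<open>auto simp: almost_unit_mat_def adjoint_mat_def\<close>)
  have a: "adjoint_mat s p \<in> carrier_mat n n" using p by (simp add: adjoint_mat_def)
  have "d = det (adjoint_mat s p * H * p)"
    unfolding eq det_almost_unit[OF n] ..
  also have "\<dots> = s (det p) * det H * det p"
    using det_mult[OF mult_carrier_mat[OF a Hc(1)] p] det_mult[OF a Hc(1)] det_adjoint[OF s ss two p] by simp
  finally have d: "d = det p * s (det p) * det H" by (simp add: mult_ac)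
  then have "det p \<noteq> 0" using w(3) by (auto simp: d_def)
  moreover from isometric_congruence[OF s ss two H p this]
  have "(H, almost_unit_mat n d) \<in> isometric n s" by (simp only: eq)
  ultimately show ?thesis using d by blast
qed

lemma isometric_almost_unit_norm:
  assumes D: "almost_unit_mat n d \<in> hermitian_forms n s" and c: "c \<noteq> 0"
  shows "(almost_unit_mat n d, almost_unit_mat n (c * s c * d)) \<in> isometric n s"
proof -
  have "adjoint_mat s (almost_unit_mat n c) = almost_unit_mat n (s c)"
    by (rule eq_matI) (auto simp: almost_unit_mat_def adjoint_mat_def)
  then have "adjoint_mat s (almost_unit_mat n c) * almost_unit_mat n d * almost_unit_mat n c =
      almost_unit_mat n (c * s c * d)"
    by (simp add: almost_unit_mult mult_ac del: assoc_mult_mat)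
  then show ?thesis
    using isometric_congruence[OF s ss two D, of "almost_unit_mat n c"] c by (simp add: det_almost_unit[OF n])
qed

text \<open>A change of basis multiplies the determinant by a norm. Conversely both forms are
  brought to normal form, and a norm in the last entry is removed by rescaling the last basis
  vector.\<close>

lemma isometric_iff_det:
  assumes H: "H \<in> hermitian_forms n s" and H': "H' \<in> hermitian_forms n s"
  shows "(H, H') \<in> isometric n s \<longleftrightarrow> (\<exists>c. c \<noteq> 0 \<and> det H' = c * s c * det H)"
proof
  assume "(H, H') \<in> isometric n s"
  then obtain p where p: "p \<in> carrier_mat n n" "det p \<noteq> 0" "H' = adjoint_mat s p * H * p"
    by (auto simp: isometric_def)
  have Hc: "H \<in> carrier_mat n n" using H by (simp add: hermitian_forms_def)
  have a: "adjoint_mat s p \<in> carrier_mat n n" using p by (simp add: adjoint_mat_def)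
  have "det H' = s (det p) * det H * det p"
    using det_mult[OF mult_carrier_mat[OF a Hc] p(1)] det_mult[OF a Hc] det_adjoint[OF s ss two p(1)] p(3)
    by simp
  then show "\<exists>c. c \<noteq> 0 \<and> det H' = c * s c * det H"
    using p(2) by (intro exI[of _ "det p"]) (simp add: mult_ac)
next
  assume "\<exists>c. c \<noteq> 0 \<and> det H' = c * s c * det H"
  then obtain c where c: "c \<noteq> 0" "det H' = c * s c * det H" by blast
  note eqv = isometric_equiv[OF s ss two, of n]
  note sym = equivE[OF eqv, THEN symD, rotated 1]
  obtain a d where a: "a \<noteq> 0" "d = a * s a * det H" "(H, almost_unit_mat n d) \<in> isometric n s"
    using isometric_almost_unit[OF H] by blast
  obtain a' d' where a': "a' \<noteq> 0" "d' = a' * s a' * det H'" "(H', almost_unit_mat n d') \<in> isometric n s"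
    using isometric_almost_unit[OF H'] by blast
  \<comment> \<open>The value is forced by \<open>d = a * s a * det H\<close>,
    \<open>d' = a' * s a' * det H'\<close> and \<open>det H' = c * s c * det H\<close>.\<close>
  define e where "e = a' * c / a"
  have e0: "e \<noteq> 0" using a a' c by (simp add: e_def)
  have "d' = e * s e * d"
    using a a' c by (simp add: e_def s.hom_mult s.hom_div)
  moreover have "almost_unit_mat n d \<in> hermitian_forms n s"
    using a(3) by (simp add: isometric_def)
  ultimately have "(almost_unit_mat n d, almost_unit_mat n d') \<in> isometric n s"
    using isometric_almost_unit_norm e0 by simp
  with a(3) a'(3) eqv show "(H, H') \<in> isometric n s"
    by (meson equivE symE transE)
qed

end

section \<open>Norms in the unramified quadratic extension\<close>

locale quadratic_involution =
  fixes s :: "'l::field \<Rightarrow> 'l"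
  assumes s_hom: "field_hom s" and invol: "s (s x) = x" and nontriv: "s \<noteq> id"
    and fin: "finite (UNIV :: 'l set)" and two_nz: "(2 :: 'l) \<noteq> 0"
begin

sublocale s: field_hom s by (rule s_hom)

text \<open>With \<open>\<delta> = x - s x\<close> and fixed \<open>a, b\<close>, the norm of \<open>a + b \<delta>\<close> is \<open>a\<^sup>2 - \<delta>\<^sup>2 b\<^sup>2\<close>; squares make up more
  than half of the fixed field, so that this form represents every fixed element.\<close>

lemma finite_norm_surj:
  assumes c: "s c = c"
  shows "\<exists>y. y * s y = c"
proof -
  define K where "K = {x. s x = x}"
  define S where "S = (\<lambda>x. x * x) ` K"
  have finK: "finite K" and finS: "finite S"
    using fin finite_subset[of K UNIV] by (auto simp: S_def)
  have SK: "S \<subseteq> K" by (auto simp: S_def K_def s.hom_mult)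
  have 0: "0 \<in> K" "0 \<in> S" by (auto simp: K_def S_def image_iff intro!: bexI[of _ 0])
  have "card (K - {0}) \<le> 2 * card (S - {0})"
  proof -
    have "K - {0} = (\<Union>t\<in>S - {0}. {x \<in> K. x * x = t})"
      by (auto simp: S_def)
    then have "card (K - {0}) \<le> (\<Sum>t\<in>S - {0}. card {x \<in> K. x * x = t})"
      using finS by (simp add: card_UN_le)
    also have "\<dots> \<le> (\<Sum>t\<in>S - {0}. 2)"
    proof (rule sum_mono)
      fix t assume "t \<in> S - {0}"
      then obtain y where y: "y * y = t" by (auto simp: S_def)
      have "{x \<in> K. x * x = t} \<subseteq> {y, - y}"
      proof
        fix x assume "x \<in> {x \<in> K. x * x = t}"
        then have "(x - y) * (x + y) = 0" using y by (simp add: algebra_simps)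
        then show "x \<in> {y, - y}" by (auto simp: eq_neg_iff_add_eq_0)
      qed
      then have "card {x \<in> K. x * x = t} \<le> card {y, - y}" by (intro card_mono) auto
      also have "\<dots> \<le> 2" by (simp add: card_insert_if)
      finally show "card {x \<in> K. x * x = t} \<le> 2" .
    qed
    finally show ?thesis by simp
  qed
  moreover have "card K = Suc (card (K - {0}))" "card S = Suc (card (S - {0}))"
    using card.remove[OF finK 0(1)] card.remove[OF finS 0(2)] by simp_all
  ultimately have half: "card K < 2 * card S" by simp
  obtain x where x: "s x \<noteq> x" using nontriv by (auto simp: fun_eq_iff)
  define \<delta> where "\<delta> = x - s x"
  have \<delta>: "\<delta> \<noteq> 0" "s \<delta> = - \<delta>" using x by (auto simp: \<delta>_def s.hom_minus invol)
  define S' where "S' = (\<lambda>t. c + \<delta> * \<delta> * t) ` S"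
  have cS': "card S' = card S"
    unfolding S'_def by (rule card_image) (use \<delta> in \<open>auto simp: inj_on_def\<close>)
  have S'K: "S' \<subseteq> K"
    using SK c \<delta> by (auto simp: S'_def K_def s.hom_add s.hom_mult)
  \<comment> \<open>Both sets lie in \<open>K\<close> and each has more than half as many elements
    as \<open>K\<close>.\<close>
  have "S \<inter> S' \<noteq> {}"
  proof
    assume "S \<inter> S' = {}"
    then have "card (S \<union> S') = card S + card S'"
      using finS by (intro card_Un_disjoint) (auto simp: S'_def)
    moreover have "card (S \<union> S') \<le> card K" using SK S'K finK by (intro card_mono) auto
    ultimately show False using half cS' by simp
  qed
  then obtain a b where ab: "s a = a" "s b = b" "a * a = c + \<delta> * \<delta> * (b * b)"
    by (auto simp: S_def S'_def K_def)
  have "(a + b * \<delta>) * s (a + b * \<delta>) = a * a - \<delta> * \<delta> * (b * b)"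
    using ab \<delta> by (simp add: s.hom_add s.hom_mult algebra_simps)
  then show ?thesis using ab by auto
qed

text \<open>The coefficients of the square root with constant term 1, obtained by solving
  \<open>f * f = g\<close> for the term \<open>2 f_k\<close> in degree \<open>k\<close>. Repeating
  the range inside the sum exposes the bound on \<open>i\<close> to the termination
  argument.\<close>

function sqrt_coeff :: "'l fps \<Rightarrow> nat \<Rightarrow> 'l" where
  "sqrt_coeff g k = (if k = 0 then 1 else
     (fps_nth g k - (\<Sum>i\<in>{1..<k}. if i \<in> {1..<k} then sqrt_coeff g i * sqrt_coeff g (k - i) else 0)) / 2)"
  by pat_completeness auto
termination by (relation "measure snd") auto

declare sqrt_coeff.simps [simp del]

lemma sqrt_coeff_0: "sqrt_coeff g 0 = 1"
  by (subst sqrt_coeff.simps) simp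

lemma sqrt_coeff_Suc:
  "k > 0 \<Longrightarrow> sqrt_coeff g k = (fps_nth g k - (\<Sum>i\<in>{1..<k}. sqrt_coeff g i * sqrt_coeff g (k - i))) / 2"
  by (subst sqrt_coeff.simps) simp

text \<open>Hensel's lemma for squares when 2 is invertible. The recursion uses only field
  operations on fixed elements, so the root is fixed by \<open>s\<close> too and its square is a
  norm.\<close>

lemma fps_sqrt_exists:
  assumes g0: "fps_nth g 0 = 1" and fixed: "\<And>k. s (fps_nth g k) = fps_nth g k"
  shows "\<exists>f. f * f = g \<and> (\<forall>k. s (fps_nth f k) = fps_nth f k)"
proof (intro exI conjI allI)
  let ?f = "Abs_fps (sqrt_coeff g)"
  show "?f * ?f = g"
  proof (rule fps_ext)
    fix k
    show "fps_nth (?f * ?f) k = fps_nth g k"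
    proof (cases "k = 0")
      case True
      then show ?thesis by (simp add: g0 sqrt_coeff_0)
    next
      case False
      have "{0..k} = insert 0 (insert k {1..<k})" using False by auto
      then have "fps_nth (?f * ?f) k = sqrt_coeff g 0 * sqrt_coeff g k + (sqrt_coeff g k * sqrt_coeff g 0 +
         (\<Sum>i\<in>{1..<k}. sqrt_coeff g i * sqrt_coeff g (k - i)))"
        using False by (simp add: fps_mult_nth)
      also have "\<dots> = 2 * sqrt_coeff g k + (\<Sum>i\<in>{1..<k}. sqrt_coeff g i * sqrt_coeff g (k - i))"
        by (simp only: sqrt_coeff_0 mult_1_left mult_1_right mult_2 add.assoc)
      also have "\<dots> = fps_nth g k"
      proof -
        have "2 * (D / 2) = D" for D :: 'l 
          using two_nz by (simp only: times_divide_eq_right nonzero_mult_div_cancel_left not_False_eq_True)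
        then show ?thesis using False by (simp only: sqrt_coeff_Suc[of k] neq0_conv) simp
      qed
      finally show ?thesis .
    qed
  qed
  show "s (fps_nth ?f k) = fps_nth ?f k" for k
  proof (induction k rule: less_induct)
    case (less k)
    show ?case
    proof (cases "k = 0")
      case True
      then show ?thesis by (simp add: sqrt_coeff_0)
    next
      case False
      have "s (\<Sum>i\<in>{1..<k}. sqrt_coeff g i * sqrt_coeff g (k - i)) =
         (\<Sum>i\<in>{1..<k}. sqrt_coeff g i * sqrt_coeff g (k - i))"
        unfolding s.hom_sum s.hom_mult using less by (intro sum.cong refl) simp
      moreover have "s 2 = 2" using s.hom_add[of 1 1] by simp
      ultimately show ?thesis
        using False
        by (simp only: sqrt_coeff_Suc[of k] neq0_conv fps_nth_Abs_fps s.hom_div s.hom_minus fixed)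
    qed
  qed
qed

lemma fls_map_nth: "fls_nth (fls_map s x) k = s (fls_nth x k)"
proof -
  have "\<forall>\<^sub>\<infinity>j::nat. s (fls_nth x (- int j)) = 0"
    using MOST_fls_neg_nth_eq_0[of x] by (rule MOST_mono) simp
  then show ?thesis unfolding fls_map_def by (subst nth_Abs_fls) auto
qed

lemma fls_map_subdegree: "fls_subdegree (fls_map s x) = fls_subdegree x"
proof (cases "x = 0")
  case True
  have "fls_map s x = 0" by (rule fls_eqI) (simp add: fls_map_nth True)
  then show ?thesis using True by simp
next
  case False
  show ?thesis
    by (rule fls_subdegree_eqI) (use False in \<open>auto simp: fls_map_nth\<close>)
qed

lemma fls_map_hom: "field_hom (fls_map s)"
proof unfold_locales
  show "fls_map s 0 = 0" "fls_map s 1 = 1"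
    by (rule fls_eqI, simp add: fls_map_nth)+
  show "fls_map s (x + y) = fls_map s x + fls_map s y" for x y
    by (rule fls_eqI) (simp add: fls_map_nth s.hom_add)
  show "fls_map s (x * y) = fls_map s x * fls_map s y" for x y
    by (rule fls_eqI) (simp add: fls_map_nth fls_times_nth(1) fls_map_subdegree s.hom_sum s.hom_mult)
qed

lemma fls_map_invol: "fls_map s (fls_map s x) = x"
  by (rule fls_eqI) (simp add: fls_map_nth invol)

lemma fls_two: "(2 :: 'l fls) \<noteq> 0"
proof
  assume "(2 :: 'l fls) = 0"
  then have "fls_nth (1 + 1 :: 'l fls) 0 = 0" by simp
  then have "(1 :: 'l) + 1 = 0" by (simp only: fls_plus_nth fls_one_nth) simp
  then show False using two_nz by simp
qed

text \<open>Such an element is an even power of the uniformizer times a residue \<open>c\<close>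
  times a one-unit. The uniformizer is fixed, so the power is a norm; \<open>c\<close> is a norm
  from the finite field; and the one-unit is the square of a fixed series.\<close>

lemma fls_norm_of_even:
  assumes d: "d \<noteq> 0" "fls_map s d = d" and even: "even (fls_subdegree d)"
  shows "\<exists>y. y \<noteq> 0 \<and> y * fls_map s y = d"
proof -
  interpret S: field_hom "fls_map s" by (rule fls_map_hom)
  obtain m where m: "fls_subdegree d = 2 * m" using even by auto
  define g where "g = fls_regpart (fls_shift (2 * m) d)"
  have gn: "fps_nth g k = fls_nth d (int k + 2 * m)" for k
    by (simp add: g_def)
  define c where "c = fps_nth g 0"
  have c0: "c \<noteq> 0" using d(1) nth_fls_subdegree_nonzero[of d] by (simp add: c_def gn m)
  have fixed: "s (fps_nth g k) = fps_nth g k" for k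
    using fls_map_nth[of d] by (simp add: gn d(2))
  obtain y0 where y0: "y0 * s y0 = c" using finite_norm_surj[of c] fixed by (auto simp: c_def)
  have "\<exists>f. f * f = fps_const (inverse c) * g \<and> (\<forall>k. s (fps_nth f k) = fps_nth f k)"
    by (rule fps_sqrt_exists) (use c0 fixed in \<open>auto simp: c_def s.hom_mult s.hom_inverse\<close>)
  then obtain f where f: "f * f = fps_const (inverse c) * g" "\<And>k. s (fps_nth f k) = fps_nth f k"
    by blast
  \<comment> \<open>A shift by \<open>- m\<close> is multiplication by the m-th power of the
    uniformizer, so the three factors of \<open>y\<close> account for the three factors of
    \<open>d\<close>.\<close>
  define y where "y = fls_shift (- m) (fls_const y0 * fps_to_fls f)"
  have sy: "fls_map s y = fls_shift (- m) (fls_const (s y0) * fps_to_fls f)"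
    by (rule fls_eqI) (simp add: y_def fls_map_nth s.hom_mult f(2) fps_to_fls_nth)
  have "y * fls_map s y = fls_shift (- m + - m)
      ((fls_const y0 * fps_to_fls f) * (fls_const (s y0) * fps_to_fls f))"
    unfolding sy unfolding y_def by (rule fls_times_both_shifted_simp)
  also have "(fls_const y0 * fps_to_fls f) * (fls_const (s y0) * fps_to_fls f) =
      (fls_const y0 * fls_const (s y0)) * (fps_to_fls f * fps_to_fls f)"
    by (simp only: mult_ac)
  also have "\<dots> = fls_const c * (fls_const (inverse c) * fps_to_fls g)"
    by (simp only: fls_const_mult_const y0 fls_times_fps_to_fls[symmetric] f(1))
      (simp only: fls_times_fps_to_fls fps_const_to_fls)
  also have "\<dots> = fps_to_fls g"
    using c0 by (simp only: mult.assoc[symmetric] fls_const_mult_const right_inverse not_False_eq_True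
        fls_const_1 mult_1_left)
  also have "- m + - m = - (2 * m)" by simp
  also have "fls_shift (- (2 * m)) (fps_to_fls g) = d"
  proof (rule fls_eqI)
    fix k
    show "fls_nth (fls_shift (- (2 * m)) (fps_to_fls g)) k = fls_nth d k"
      using m by (auto simp: fps_to_fls_nth gn)
  qed
  finally show ?thesis using d(1) by auto
qed

text \<open>A coefficient of even valuation alone represents 1. If both valuations are odd,
  \<open>- a / b\<close> has even valuation and is a norm, so the form is hyperbolic and represents
  everything.\<close>

lemma fls_binary_universal:
  assumes a: "a \<noteq> 0" "fls_map s a = a" and b: "b \<noteq> 0" "fls_map s b = b"
  shows "\<exists>x y. a * (x * fls_map s x) + b * (y * fls_map s y) = 1"
proof -
  interpret S: field_hom "fls_map s" by (rule fls_map_hom)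
  have inv: "\<exists>x. c * (x * fls_map s x) = 1"
    if c: "c \<noteq> 0" "fls_map s c = c" "even (fls_subdegree c)" for c
  proof -
    have "\<exists>y. y \<noteq> 0 \<and> y * fls_map s y = inverse c"
      by (rule fls_norm_of_even) (use c in \<open>auto simp: S.hom_inverse fls_inverse_subdegree\<close>)
    then obtain y where "y * fls_map s y = inverse c" by blast
    then have "c * (y * fls_map s y) = 1" using c(1) by (simp only: right_inverse not_False_eq_True)
    then show ?thesis by blast
  qed
  consider "even (fls_subdegree a)" | "even (fls_subdegree b)" | "odd (fls_subdegree a)" "odd (fls_subdegree b)"
    by blast
  then show ?thesis
  proof cases
    case 1
    then obtain x where "a * (x * fls_map s x) = 1" using inv a by blast
    then show ?thesis by (intro exI[of _ x] exI[of _ 0]) simp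
  next
    case 2
    then obtain x where "b * (x * fls_map s x) = 1" using inv b by blast
    then show ?thesis by (intro exI[of _ 0] exI[of _ x]) simp
  next
    case 3
    have "\<exists>e. e \<noteq> 0 \<and> e * fls_map s e = - (a / b)"
      by (rule fls_norm_of_even)
        (use a b 3 in \<open>auto simp: S.hom_div S.hom_uminus fls_divide_subdegree\<close>)
    then obtain e where e: "e * fls_map s e = - (a / b)" by blast
    define c where "c = inverse a"
    have sc: "fls_map s c = c" using a by (simp add: c_def S.hom_inverse)
    have s2: "fls_map s 2 = 2" using S.hom_add[of 1 1] by simp
    \<comment> \<open>With \<open>x + w = 1\<close> and \<open>x - w = c\<close> the difference of
      squares is \<open>x^2 - w^2 = c = 1 / a\<close>; both elements are fixed, so their squares are
      their norms.\<close>
    define x where "x = (1 + c) / 2"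
    define w where "w = (1 - c) / 2"
    have sx: "fls_map s x = x" "fls_map s w = w"
      by (simp_all add: x_def w_def S.hom_div S.hom_add S.hom_minus sc s2)
    have "x + w = 1" using fls_two by (simp add: x_def w_def add_divide_distrib[symmetric])
    moreover have "x - w = c"
    proof -
      have "x - w = (2 * c) / 2" by (simp add: x_def w_def diff_divide_distrib[symmetric])
      then show ?thesis using fls_two by (simp only: nonzero_mult_div_cancel_left not_False_eq_True)
    qed
    moreover have "x * x - w * w = (x + w) * (x - w)" by (simp add: algebra_simps)
    ultimately have xw: "x * x - w * w = c" by simp
    have "b * ((e * w) * fls_map s (e * w)) = b * (e * fls_map s e) * (w * w)"
      by (simp add: S.hom_mult sx mult_ac)
    also have "\<dots> = - (a * (w * w))" using b by (simp add: e)
    finally have "a * (x * fls_map s x) + b * ((e * w) * fls_map s (e * w)) = a * (x * x - w * w)"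
      by (simp add: sx algebra_simps)
    also have "\<dots> = 1" using a by (simp add: xw c_def)
    finally show ?thesis by blast
  qed
qed

end

section \<open>Krylov determinants under a similitude\<close>

lemma mult_mat_vec_krylov_mat:
  fixes A B :: "'r::comm_ring_1 mat"
  assumes A: "A \<in> carrier_mat n n" and B: "B \<in> carrier_mat n n" and f: "f \<in> carrier_vec n"
  shows "A * krylov_mat n B f = mat n n (\<lambda>(p, q). (A *\<^sub>v krylov B f q) $ p)"
proof (rule eq_matI)
  fix i j assume "i < dim_row (mat n n (\<lambda>(p, q). (A *\<^sub>v krylov B f q) $ p))"
    "j < dim_col (mat n n (\<lambda>(p, q). (A *\<^sub>v krylov B f q) $ p))"
  then have ij: "i < n" "j < n" by auto
  have "col (krylov_mat n B f) j = krylov B f j"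
    using ij carrier_vecD[OF krylov_carrier[OF B f]] by (intro eq_vecI) (simp_all add: krylov_mat_def)
  then show "(A * krylov_mat n B f) $$ (i, j) = mat n n (\<lambda>(p, q). (A *\<^sub>v krylov B f q) $ p) $$ (i, j)"
    using ij A by (simp add: krylov_mat_def)
qed (use A in \<open>auto simp: krylov_mat_def\<close>)

text \<open>Replacing \<open>f\<close> by \<open>A f\<close> multiplies the Krylov matrix by
  \<open>A\<close> from the left.\<close>

lemma krylov_mat_shift:
  fixes A :: "'r::comm_ring_1 mat"
  assumes A: "A \<in> carrier_mat n n" and f: "f \<in> carrier_vec n"
  shows "det (krylov_mat n A (krylov A f m)) = det A ^ m * det (krylov_mat n A f)"
proof (induction m)
  case (Suc m)
  let ?g = "krylov A f m"
  have g: "?g \<in> carrier_vec n" using A f by simp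
  have c: "krylov_mat n A ?g \<in> carrier_mat n n" by (simp add: krylov_mat_def)
  have "A * krylov_mat n A ?g = krylov_mat n A (krylov A f (Suc m))"
    unfolding mult_mat_vec_krylov_mat[OF A A g]
    by (simp add: krylov_mat_def krylov_Suc[symmetric] krylov_mult[symmetric] krylov_Suc[of A f])
  then show ?case
    using det_mult[OF A c] Suc by simp
qed simp

lemma krylov_map:
  assumes s: "field_hom s" and A: "A \<in> carrier_mat n n" and f: "f \<in> carrier_vec n"
  shows "krylov (map_mat s A) (map_vec s f) j = map_vec s (krylov A f j)"
proof -
  interpret s: field_hom s by fact
  show ?thesis
  proof (induction j)
    case (Suc j)
    have "krylov A f j \<in> carrier_vec n" using A f by simp
    with Suc show ?case using A by (simp add: krylov_Suc s.mult_mat_vec_hom[of _ n n])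
  qed simp
qed

text \<open>Only the fact that the sign is \<plusminus>1 is recorded, since signs have valuation
  0.\<close>

lemma det_mat_reverse_cols:
  fixes M :: "'r::comm_ring_1 mat"
  assumes M: "M \<in> carrier_mat n n"
  shows "\<exists>e. (e = 1 \<or> e = - 1) \<and> det (mat n n (\<lambda>(i, j). M $$ (i, n - 1 - j))) = e * det M"
proof -
  define p where "p = (\<lambda>i. if i < n then n - 1 - i else i)"
  have p: "p permutes {0..<n}"
  proof (rule bij_imp_permutes)
    show "bij_betw p {0..<n} {0..<n}"
      by (rule bij_betw_byWitness[where f' = p]) (auto simp: p_def)
  qed (auto simp: p_def)
  have Mt: "M\<^sup>T \<in> carrier_mat n n" using M by simp
  have "det (mat n n (\<lambda>(i, j). M\<^sup>T $$ (p i, j))) = signof p * det M\<^sup>T"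
    by (rule det_permute_rows[OF Mt p])
  moreover have "mat n n (\<lambda>(i, j). M\<^sup>T $$ (p i, j)) = (mat n n (\<lambda>(i, j). M $$ (i, n - 1 - j)))\<^sup>T"
    using M by (intro eq_matI) (auto simp: p_def)
  moreover have "det (mat n n (\<lambda>(i, j). M $$ (i, n - 1 - j)))\<^sup>T = det (mat n n (\<lambda>(i, j). M $$ (i, n - 1 - j)))"
    by (rule det_transpose[of _ n]) simp
  ultimately have eq: "det (mat n n (\<lambda>(i, j). M $$ (i, n - 1 - j))) = signof p * det M"
    using det_transpose[OF M] by simp
  have "(signof p :: 'r) = 1 \<or> (signof p :: 'r) = - 1" by (auto simp: sign_def)
  with eq show ?thesis by (intro exI[of _ "signof p"] conjI)
qed

lemma det_scale_cols:
  fixes M :: "'r::comm_ring_1 mat"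
  assumes M: "M \<in> carrier_mat n n"
  shows "det (mat n n (\<lambda>(i, j). c j * M $$ (i, j))) = (\<Prod>j<n. c j) * det M"
proof -
  have D: "mat n n (\<lambda>(i, j). if i = j then c i else 0) \<in> carrier_mat n n" by simp
  have "mat n n (\<lambda>(i, j). c j * M $$ (i, j)) = M * mat n n (\<lambda>(i, j). if i = j then c i else 0)"
  proof (rule eq_matI)
    fix i j assume "i < dim_row (M * mat n n (\<lambda>(i, j). if i = j then c i else 0))"
      "j < dim_col (M * mat n n (\<lambda>(i, j). if i = j then c i else 0))"
    then have ij: "i < n" "j < n" using M by auto
    have "(M * mat n n (\<lambda>(i, j). if i = j then c i else 0)) $$ (i, j) =
       (\<Sum>k<n. M $$ (i, k) * (if k = j then c k else 0))"
      using ij M by (simp add: scalar_prod_def lessThan_atLeast0)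
    also have "\<dots> = (\<Sum>k<n. if k = j then c j * M $$ (i, j) else 0)"
      by (rule sum.cong[OF refl]) (simp add: mult.commute)
    finally show "mat n n (\<lambda>(i, j). c j * M $$ (i, j)) $$ (i, j) =
        (M * mat n n (\<lambda>(i, j). if i = j then c i else 0)) $$ (i, j)"
      using ij by simp
  qed (use M in auto)
  moreover have "det (mat n n (\<lambda>(i, j). if i = j then c i else 0)) = (\<Prod>j<n. c j)"
  proof -
    have "det (mat n n (\<lambda>(i, j). if i = j then c i else 0)) =
        prod_list (diag_mat (mat n n (\<lambda>(i, j). if i = j then c i else 0)))"
      by (rule det_upper_triangular[of _ n]) auto
    then show ?thesis by (simp add: diag_mat_def prod.list_conv_set_nth lessThan_atLeast0)
  qed
  ultimately show ?thesis by (simp add: det_mult[OF M D])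
qed

lemma krylov_surj:
  fixes A :: "'f::field mat"
  assumes A: "A \<in> carrier_mat n n" and d: "det A \<noteq> 0"
  shows "f \<in> carrier_vec n \<Longrightarrow> \<exists>g\<in>carrier_vec n. krylov A g m = f"
proof (induction m arbitrary: f)
  case 0
  then show ?case by auto
next
  case (Suc m)
  obtain h where h: "h \<in> carrier_vec n" "A *\<^sub>v h = f" using mat_mult_vec_surj[OF A d Suc.prems] .
  obtain g where "g \<in> carrier_vec n" "krylov A g m = h" using Suc.IH[OF h(1)] by blast
  then show ?case using h by (auto simp: krylov_Suc)
qed

text \<open>
  If \<open>A\<close> is a similitude of \<open>H\<close> with multiplier \<open>Z\<close> and \<open>e = A\<^sup>n\<^sup>-\<^sup>1 g\<close>, then the covector \<open>h(e, -)\<close>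
  composed with \<open>A\<^sup>i\<close> is \<open>Z\<^sup>i h(A\<^sup>n\<^sup>-\<^sup>1\<^sup>-\<^sup>i g, -)\<close>.
\<close>

lemma det_krylov_hermitian_covector:
  fixes A H :: "'f::field mat"
  assumes s: "field_hom s" and A: "A \<in> carrier_mat n n" and d: "det A \<noteq> 0"
    and H: "H \<in> carrier_mat n n" and e: "e \<in> carrier_vec n"
    and sim: "adjoint_mat s A * H * A = Z \<cdot>\<^sub>m H" and n: "n \<ge> 1"
  shows "\<exists>c. (c = 1 \<or> c = - 1) \<and>
    s (det A) ^ (n - 1) * det (krylov_mat n A\<^sup>T (hermitian_covector s H e)) =
    c * (\<Prod>i<n. Z ^ i) * s (det (krylov_mat n A e)) * det H"
proof -
  interpret s: field_hom s by fact
  \<comment> \<open>Pulling \<open>e\<close> back by \<open>A^(n-1)\<close> keeps every exponent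
    \<open>n - 1 - i\<close> nonnegative, so no powers of the inverse of \<open>A\<close>
    appear.\<close>
  obtain g where g: "g \<in> carrier_vec n" "krylov A g (n - 1) = e"
    using krylov_surj[OF A d e] by blast
  let ?B = "map_mat s A" and ?g = "map_vec s g"
  have B: "?B \<in> carrier_mat n n" and g': "?g \<in> carrier_vec n" using A g by auto
  have At: "A\<^sup>T \<in> carrier_mat n n" and Ht: "H\<^sup>T \<in> carrier_mat n n" using A H by auto
  have aA: "adjoint_mat s A \<in> carrier_mat n n" using A by (simp add: adjoint_mat_def)
  have sim': "A\<^sup>T *\<^sub>v (H\<^sup>T *\<^sub>v (?B *\<^sub>v v)) = Z \<cdot>\<^sub>v (H\<^sup>T *\<^sub>v v)" if v: "v \<in> carrier_vec n" for v
  proof -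
    have "(adjoint_mat s A * H * A)\<^sup>T = A\<^sup>T * (adjoint_mat s A * H)\<^sup>T"
      by (rule transpose_mult[OF mult_carrier_mat[OF aA H] A])
    also have "(adjoint_mat s A * H)\<^sup>T = H\<^sup>T * ?B"
      using transpose_mult[OF aA H] by (simp add: adjoint_mat_def)
    finally have t: "A\<^sup>T * (H\<^sup>T * ?B) = (Z \<cdot>\<^sub>m H)\<^sup>T" unfolding sim ..
    have "A\<^sup>T *\<^sub>v (H\<^sup>T *\<^sub>v (?B *\<^sub>v v)) = (A\<^sup>T * (H\<^sup>T * ?B)) *\<^sub>v v"
      using assoc_mult_mat_vec[OF At mult_carrier_mat[OF Ht B] v] assoc_mult_mat_vec[OF Ht B v] by simp
    also have "\<dots> = Z \<cdot>\<^sub>v (H\<^sup>T *\<^sub>v v)"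
      unfolding t using H v by (intro eq_vecI) (auto simp: scalar_prod_def sum_distrib_left mult_ac)
    finally show ?thesis .
  qed
  have e': "hermitian_covector s H e = H\<^sup>T *\<^sub>v krylov ?B ?g (n - 1)"
    unfolding hermitian_covector_def krylov_map[OF s A g(1)] g(2) ..
  \<comment> \<open>By the transposed similitude relation each application of the transpose of
    \<open>A\<close> cancels one application of the conjugate of \<open>A\<close> and leaves a
    factor \<open>Z\<close>; the columns thus appear in reversed order.\<close>
  have kr: "krylov A\<^sup>T (H\<^sup>T *\<^sub>v krylov ?B ?g (n - 1)) i = Z ^ i \<cdot>\<^sub>v (H\<^sup>T *\<^sub>v krylov ?B ?g (n - 1 - i))"
    if "i < n" for i
    using that
  proof (induction i)
    case 0
    show ?case by simp
  next
    case (Suc i)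
    have j: "n - 1 - i = Suc (n - 1 - Suc i)" using Suc.prems by simp
    let ?v = "krylov ?B ?g (n - 1 - Suc i)"
    have v: "?v \<in> carrier_vec n" using B g' by simp
    have "krylov A\<^sup>T (H\<^sup>T *\<^sub>v krylov ?B ?g (n - 1)) (Suc i) =
        A\<^sup>T *\<^sub>v (Z ^ i \<cdot>\<^sub>v (H\<^sup>T *\<^sub>v (?B *\<^sub>v ?v)))"
      using Suc unfolding krylov_Suc[of "A\<^sup>T"] j krylov_Suc[of ?B] by simp
    also have "\<dots> = Z ^ i \<cdot>\<^sub>v (A\<^sup>T *\<^sub>v (H\<^sup>T *\<^sub>v (?B *\<^sub>v ?v)))"
      by (rule mult_mat_vec[OF At]) (use Ht B v in auto)
    also have "\<dots> = Z ^ Suc i \<cdot>\<^sub>v (H\<^sup>T *\<^sub>v ?v)"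
      unfolding sim'[OF v] by (simp add: smult_smult_assoc mult.commute)
    finally show ?case .
  qed
  define R where "R = mat n n (\<lambda>(i, j). krylov_mat n ?B ?g $$ (i, n - 1 - j))"
  define S where "S = mat n n (\<lambda>(i, j). Z ^ j * R $$ (i, j))"
  have R: "R \<in> carrier_mat n n" and S: "S \<in> carrier_mat n n" by (simp_all add: R_def S_def)
  have "krylov_mat n A\<^sup>T (hermitian_covector s H e) = H\<^sup>T * S"
  proof (rule eq_matI)
    fix i j assume "i < dim_row (H\<^sup>T * S)" "j < dim_col (H\<^sup>T * S)"
    then have ij: "i < n" "j < n" using H S by auto
    have "col S j = Z ^ j \<cdot>\<^sub>v krylov ?B ?g (n - 1 - j)"
      using ij carrier_vecD[OF krylov_carrier[OF B g']]
      by (intro eq_vecI) (simp_all add: S_def R_def krylov_mat_def)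
    then have "(H\<^sup>T * S) $$ (i, j) = (H\<^sup>T *\<^sub>v (Z ^ j \<cdot>\<^sub>v krylov ?B ?g (n - 1 - j))) $ i"
      using ij H S by simp
    also have "\<dots> = krylov_mat n A\<^sup>T (hermitian_covector s H e) $$ (i, j)"
      using ij kr[OF ij(2)] by (simp add: krylov_mat_def e' mult_mat_vec[OF Ht krylov_carrier[OF B g']])
    finally show "krylov_mat n A\<^sup>T (hermitian_covector s H e) $$ (i, j) = (H\<^sup>T * S) $$ (i, j)" ..
  qed (use H S in \<open>auto simp: krylov_mat_def\<close>)
  then have "det (krylov_mat n A\<^sup>T (hermitian_covector s H e)) = det H * det S"
    using det_mult[OF Ht S] det_transpose[OF H] by simp
  also have "det S = (\<Prod>j<n. Z ^ j) * det R"
    unfolding S_def by (rule det_scale_cols[OF R])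
  finally have K': "det (krylov_mat n A\<^sup>T (hermitian_covector s H e)) = det H * ((\<Prod>j<n. Z ^ j) * det R)" .
  obtain c where c: "c = 1 \<or> c = - 1" "det R = c * det (krylov_mat n ?B ?g)"
    using det_mat_reverse_cols[of "krylov_mat n ?B ?g" n] by (auto simp: R_def krylov_mat_def)
  have "det (krylov_mat n A e) = det A ^ (n - 1) * det (krylov_mat n A g)"
    using krylov_mat_shift[OF A g(1), of "n - 1"] g(2) by simp
  moreover have "s (det (krylov_mat n A g)) = det (krylov_mat n ?B ?g)"
  proof -
    have "map_mat s (krylov_mat n A g) = krylov_mat n ?B ?g"
      using carrier_vecD[OF krylov_carrier[OF A g(1)]]
      by (intro eq_matI) (auto simp: krylov_mat_def krylov_map[OF s A g(1)])
    then show ?thesis by (metis s.hom_det)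
  qed
  ultimately have "s (det (krylov_mat n A e)) = s (det A) ^ (n - 1) * det (krylov_mat n ?B ?g)"
    by (simp add: s.hom_mult s.hom_power)
  then show ?thesis
    using c K' by (intro exI[of _ c]) (simp add: mult_ac)
qed

section \<open>Existence of a triple by means of a companion matrix\<close>

text \<open>Multiply the relations of \<open>rho_conjugate\<close> for the first \<open>k\<close>
  indices. The case \<open>k = n\<close> says that the norm of \<open>c_n\<close> is the n-th power
  of the conjugate of Z, the compatibility between determinant and multiplier of a
  similitude.\<close>

lemma weight_factor_conjugate:
  fixes z :: "nat \<Rightarrow> 'f::field"
  assumes s: "field_hom s" and zs: "\<And>i. i \<in> {1..<n} \<Longrightarrow> z i = s (z (n - i))"
  shows "k \<le> n \<Longrightarrow> weight_factor z k * s (weight_factor z n) = s (rho z (n - 1)) ^ k * s (weight_factor z (n - k))"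
proof (induction k)
  case (Suc k)
  interpret s: field_hom s by fact
  have "n - k = Suc (n - Suc k)" using Suc.prems by simp
  then have "weight_factor z (n - k) = weight_factor z (n - Suc k) * rho z (n - 1 - k)"
    using Suc.prems by (simp add: weight_factor_def)
  then have w: "s (weight_factor z (n - k)) = s (weight_factor z (n - Suc k)) * s (rho z (n - 1 - k))"
    by (simp add: s.hom_mult)
  have r: "s (rho z (n - 1 - k)) * rho z k = s (rho z (n - 1))"
    by (rule rho_conjugate[where n = n and z = z and s = s, OF s zs]) (use Suc.prems in auto)
  have "weight_factor z (Suc k) * s (weight_factor z n) = rho z k * (weight_factor z k * s (weight_factor z n))"
    by (simp add: weight_factor_def mult_ac)
  also have "weight_factor z k * s (weight_factor z n) = s (rho z (n - 1)) ^ k * s (weight_factor z (n - k))"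
    using Suc by simp
  also have "rho z k * \<dots> =
      s (rho z (n - 1)) ^ k * (s (rho z (n - 1 - k)) * rho z k) * s (weight_factor z (n - Suc k))"
    unfolding w by (simp only: mult_ac)
  finally show ?case unfolding r by (simp add: mult_ac)
qed (simp add: weight_factor_def)

lemma rho_self_conjugate:
  fixes z :: "nat \<Rightarrow> 'f::field"
  assumes s: "field_hom s" and zs: "\<And>i. i \<in> {1..<n} \<Longrightarrow> z i = s (z (n - i))" and n: "n \<ge> 1"
  shows "s (rho z (n - 1)) = rho z (n - 1)"
proof -
  interpret s: field_hom s by fact
  show ?thesis using rho_conjugate[where n = n and z = z and s = s and i = "n - 1", OF s zs] n by (simp add: rho_def)
qed

text \<open>The existence counterpart of \<open>triangular_recursion_unique\<close>; each new value
  is found by dividing by the sign \<open>(-1) ^ N\<close>.\<close>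

lemma triangular_recursion_solvable:
  fixes p g :: "nat \<Rightarrow> 'f::comm_ring_1"
  assumes p: "p 0 = 1"
  shows "\<exists>mu. mu 0 = b \<and> (\<forall>i<N. (\<Sum>j\<le>i. (-1) ^ j * p (i - j) * mu (Suc j)) = g i)"
proof (induction N)
  case (Suc N)
  then obtain mu where mu: "mu 0 = b" "\<And>i. i < N \<Longrightarrow> (\<Sum>j\<le>i. (-1) ^ j * p (i - j) * mu (Suc j)) = g i"
    by blast
  define r where "r = (-1) ^ N * (g N - (\<Sum>j<N. (-1) ^ j * p (N - j) * mu (Suc j)))"
  define nu where "nu = mu(Suc N := r)"
  have "(\<Sum>j\<le>i. (-1) ^ j * p (i - j) * nu (Suc j)) = g i" if "i < N" for i
    unfolding mu(2)[OF that, symmetric] by (rule sum.cong[OF refl]) (use that in \<open>auto simp: nu_def\<close>)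
  moreover have "(\<Sum>j\<le>N. (-1) ^ j * p (N - j) * nu (Suc j)) = g N"
  proof -
    have "(\<Sum>j<N. (-1) ^ j * p (N - j) * nu (Suc j)) = (\<Sum>j<N. (-1) ^ j * p (N - j) * mu (Suc j))"
      by (rule sum.cong[OF refl]) (auto simp: nu_def)
    moreover have "nu (Suc N) = r" by (simp add: nu_def)
    ultimately have "(\<Sum>j\<le>N. (-1) ^ j * p (N - j) * nu (Suc j)) =
        (\<Sum>j<N. (-1) ^ j * p (N - j) * mu (Suc j)) + (-1) ^ N * r"
      by (simp add: lessThan_Suc_atMost[symmetric] p)
    then show ?thesis by (simp add: r_def)
  qed
  moreover have "nu 0 = b" using mu(1) by (simp add: nu_def)
  ultimately show ?case by (intro exI[of _ nu]) (auto simp: less_Suc_eq)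
qed auto

text \<open>Makes negative powers of \<open>A\<close> available: the Krylov sequence of the inverse
  runs backwards along that of \<open>A\<close>.\<close>

lemma krylov_inverse:
  fixes A B :: "'f::field mat"
  assumes A: "A \<in> carrier_mat n n" and B: "B \<in> carrier_mat n n" and BA: "B * A = 1\<^sub>m n"
    and f: "f \<in> carrier_vec n"
  shows "j \<le> t \<Longrightarrow> krylov B (krylov A f t) j = krylov A f (t - j)"
proof (induction j)
  case (Suc j)
  have "t - j = Suc (t - Suc j)" using Suc.prems by simp
  then have "krylov B (krylov A f t) (Suc j) = B *\<^sub>v (A *\<^sub>v krylov A f (t - Suc j))"
    using Suc by (simp add: krylov_Suc)
  also have "\<dots> = (B * A) *\<^sub>v krylov A f (t - Suc j)"
    by (rule assoc_mult_mat_vec[symmetric, OF B A]) (use A f in simp)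
  finally show ?case using A f by (simp add: BA)
qed simp

lemma krylov_inverse_add:
  fixes A B :: "'f::field mat"
  assumes "A \<in> carrier_mat n n" "B \<in> carrier_mat n n" "B * A = 1\<^sub>m n" "f \<in> carrier_vec n"
  shows "krylov B (krylov A f t) (t + l) = krylov B f l"
  unfolding krylov_add[symmetric] krylov_inverse[OF assms order_refl] by simp

lemma sum_alternating_reverse:
  fixes f :: "nat \<Rightarrow> 'f::comm_ring_1"
  shows "(\<Sum>j\<le>n. (-1) ^ j * f (n - j)) = (-1) ^ n * (\<Sum>j\<le>n. (-1) ^ j * f j)"
proof -
  have "(\<Sum>j\<le>n. (-1) ^ j * f (n - j)) = (\<Sum>j\<le>n. (-1) ^ (n - j) * f j)"
    by (rule sum.reindex_bij_witness[of _ "\<lambda>j. n - j" "\<lambda>j. n - j"]) auto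
  also have "\<dots> = (\<Sum>j\<le>n. (-1) ^ n * ((-1) ^ j * f j))"
  proof (rule sum.cong[OF refl])
    fix j assume "j \<in> {..n}"
    then have "n = (n - j) + j" by simp
    then have "(-1 :: 'f) ^ n = (-1) ^ (n - j) * (-1) ^ j" by (metis power_add)
    then show "(-1) ^ (n - j) * f j = (-1) ^ n * ((-1) ^ j * f j)" by (simp add: mult.assoc)
  qed
  finally show ?thesis by (simp only: sum_distrib_left)
qed

text \<open>The counterpart of \<open>has_invariants\<close> for a matrix in place of a point, with
  the denominators \<open>weight_factor\<close> cleared.\<close>

definition matrix_invariants :: "nat \<Rightarrow> 'f::field mat \<Rightarrow> 'f vec \<Rightarrow> 'f vec \<Rightarrow> 'f invs \<Rightarrow> bool" where
  "matrix_invariants n A e e' = (\<lambda>(z, a, b).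
     det A = weight_factor z n \<and> (\<forall>i\<in>{1..<n}. principal_sum n A i = weight_factor z i * a i) \<and>
     e' \<bullet> e = b 0 \<and>
     (\<forall>i. Suc i < n \<longrightarrow> bordered_trace n A e' e i = weight_factor z (Suc i) * b (Suc i)))"

context
  fixes n :: nat and z a b :: "nat \<Rightarrow> 'f::field" and s :: "'f \<Rightarrow> 'f"
  assumes s: "field_hom s" and ss: "\<And>x. s (s x) = x" and n: "n \<ge> 1"
    and z: "\<And>i. i \<in> {1..<n} \<Longrightarrow> z i \<noteq> 0"
    and zs: "\<And>i. i \<in> {1..<n} \<Longrightarrow> z i = s (z (n - i))"
    and as: "\<And>i. i \<in> {1..<n} \<Longrightarrow> a i = s (a (n - i))"
    and bs: "\<And>i. i \<in> {1..<n} \<Longrightarrow> b i = s (b 0 * a (n - i) - b (n - i))"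
    and b0: "s (b 0) = b 0"
begin

interpretation s: field_hom s by (rule s)

text \<open>The principal sums that a matrix with these invariants must have. The values
  \<open>a_0\<close> and \<open>a_n\<close>, which are not part of the tuple, count as 1.\<close>

definition char_coeff :: "nat \<Rightarrow> 'f" where
  "char_coeff i = weight_factor z i * (if i = 0 \<or> i = n then 1 else a i)"

definition companion_coeff :: "nat \<Rightarrow> 'f" where
  "companion_coeff k = - ((-1) ^ n * ((-1) ^ k * char_coeff (n - k)))"

text \<open>The last column encodes Cayley-Hamilton with the coefficients \<open>char_coeff\<close>,
  and the first basis vector is cyclic.\<close>

definition companion :: "'f mat" where
  "companion = mat n n (\<lambda>(i, j). if j = n - 1 then companion_coeff i else if i = Suc j then 1 else 0)"

abbreviation "Z \<equiv> rho z (n - 1)"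
abbreviation "C \<equiv> companion"
abbreviation "e0 \<equiv> (unit_vec n 0 :: 'f vec)"

lemma char_coeff_0: "char_coeff 0 = 1"
  by (simp add: char_coeff_def weight_factor_def)

lemma weight_factor_nz: "i \<le> n \<Longrightarrow> weight_factor z i \<noteq> 0"
  using z by (auto simp: weight_factor_def rho_def)

lemma char_coeff_n: "char_coeff n = weight_factor z n" "char_coeff n \<noteq> 0"
  using weight_factor_nz[of n] n by (simp_all add: char_coeff_def)

lemma Z_fixed: "s Z = Z"
  by (rule rho_self_conjugate[where n = n and z = z and s = s, OF s zs n])

text \<open>The functional equation of the characteristic polynomial of a similitude: its
  eigenvalues are permuted by sending an eigenvalue to Z divided by its conjugate.\<close>

lemma char_coeff_conjugate:
  assumes k: "k \<le> n"
  shows "Z ^ k * s (char_coeff (n - k)) = s (weight_factor z n) * char_coeff k"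
proof -
  have "s (if n - k = 0 \<or> n - k = n then 1 else a (n - k)) = (if k = 0 \<or> k = n then 1 else a k)"
    using k n as[of k] by auto
  moreover have "Z ^ k * s (weight_factor z (n - k)) = weight_factor z k * s (weight_factor z n)"
    using weight_factor_conjugate[where n = n and z = z and s = s, OF s zs k] Z_fixed by simp
  ultimately show ?thesis
    by (simp add: char_coeff_def s.hom_mult mult.assoc[symmetric])
qed

lemma companion_carrier: "C \<in> carrier_mat n n"
  by (simp add: companion_def)

lemma mult_unit_vec:
  fixes A :: "'f mat"
  assumes "A \<in> carrier_mat n n" "j < n"
  shows "A *\<^sub>v unit_vec n j = col A j"
  using assms by (intro eq_vecI) auto

lemma companion_krylov: "j < n \<Longrightarrow> krylov C e0 j = unit_vec n j"
proof (induction j)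
  case (Suc j)
  have "krylov C e0 (Suc j) = col C j"
    using Suc mult_unit_vec[OF companion_carrier, of j] by (simp add: krylov_Suc)
  also have "\<dots> = unit_vec n (Suc j)"
    using Suc.prems by (intro eq_vecI) (auto simp: companion_def)
  finally show ?case .
qed simp

lemma companion_krylov_Suc: "j < n \<Longrightarrow> krylov C e0 (Suc j) = col C j"
  using mult_unit_vec[OF companion_carrier] by (simp add: krylov_Suc companion_krylov)

lemma companion_relation:
  assumes v: "v \<in> carrier_vec n"
  shows "(\<Sum>j\<le>n. (-1) ^ j * char_coeff (n - j) * (v \<bullet> krylov C e0 j)) = 0"
proof -
  have "krylov C e0 n = col C (n - 1)"
    using companion_krylov_Suc[of "n - 1"] n by simp
  also have "\<dots> = vec n companion_coeff"
    using n by (intro eq_vecI) (auto simp: companion_def)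
  finally have "v \<bullet> krylov C e0 n = (\<Sum>i<n. v $ i * companion_coeff i)"
    by (simp add: scalar_prod_def lessThan_atLeast0)
  moreover have "(\<Sum>j<n. (-1) ^ j * char_coeff (n - j) * (v \<bullet> krylov C e0 j)) =
      (\<Sum>j<n. (-1) ^ j * char_coeff (n - j) * v $ j)"
    by (rule sum.cong[OF refl]) (use v in \<open>simp add: companion_krylov scalar_prod_right_unit\<close>)
  moreover have "(-1) ^ n * (\<Sum>i<n. v $ i * companion_coeff i) =
      - (\<Sum>j<n. (-1) ^ j * char_coeff (n - j) * v $ j)"
    by (simp add: sum_distrib_left companion_coeff_def sum_negf[symmetric] mult_ac)
  moreover have "(\<Sum>j\<le>n. (-1) ^ j * char_coeff (n - j) * (v \<bullet> krylov C e0 j)) =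
      (\<Sum>j<n. (-1) ^ j * char_coeff (n - j) * (v \<bullet> krylov C e0 j)) + (-1) ^ n * (v \<bullet> krylov C e0 n)"
    by (simp only: lessThan_Suc_atMost[symmetric] sum.lessThan_Suc diff_self_eq_0 char_coeff_0 mult_1_right)
  ultimately show ?thesis by simp
qed

text \<open>The trace formula and the shape of the companion matrix give two relations for the same
  Krylov vectors. Their difference is a linear relation between the columns of \<open>C\<close> with
  coefficients \<delta>, and these columns are independent.\<close>

lemma companion_principal_sum:
  assumes i: "i \<le> n"
  shows "principal_sum n C i = char_coeff i"
proof -
  define \<delta> where "\<delta> i = principal_sum n C i - char_coeff i" for i
  have e0: "e0 \<in> carrier_vec n" by simp
  have d0: "\<delta> 0 = 0" by (simp add: \<delta>_def char_coeff_0)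
  have rel: "(\<Sum>j<n. (-1) ^ j * \<delta> (n - j) * C $$ (k, j)) = 0" if k: "k < n" for k
  proof -
    have u: "unit_vec n k \<bullet> krylov C e0 (Suc j) = krylov C e0 (Suc j) $ k" for j
      by (rule scalar_prod_left_unit) (use k companion_carrier in simp_all)
    have r: "row C k \<bullet> krylov C e0 j = krylov C e0 (Suc j) $ k" for j
      using k companion_carrier by (simp add: krylov_Suc)
    have "(\<Sum>j\<le>n. (-1) ^ j * principal_sum n C (n - j) * krylov C e0 (Suc j) $ k) = 0"
      using cayley_hamilton_krylov[OF companion_carrier e0, of "unit_vec n k"] by (simp only: u)
    moreover have "(\<Sum>j\<le>n. (-1) ^ j * char_coeff (n - j) * krylov C e0 (Suc j) $ k) = 0"
      using companion_relation[of "row C k"] companion_carrier by (simp only: r row_carrier_vec carrier_matD) (metis carrier_matD(2) row_carrier)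
    ultimately have "(\<Sum>j\<le>n. (-1) ^ j * \<delta> (n - j) * krylov C e0 (Suc j) $ k) = 0"
      by (simp add: \<delta>_def left_diff_distrib right_diff_distrib sum_subtractf)
    then have "(\<Sum>j<n. (-1) ^ j * \<delta> (n - j) * krylov C e0 (Suc j) $ k) = 0"
      by (simp only: lessThan_Suc_atMost[symmetric] sum.lessThan_Suc diff_self_eq_0 d0) simp
    moreover have "(\<Sum>j<n. (-1) ^ j * \<delta> (n - j) * krylov C e0 (Suc j) $ k) =
        (\<Sum>j<n. (-1) ^ j * \<delta> (n - j) * C $$ (k, j))"
      by (rule sum.cong[OF refl]) (use k companion_carrier in \<open>simp add: companion_krylov_Suc\<close>)
    ultimately show ?thesis by simp
  qed
  define m where "m = n - 1"
  have m: "m < n" "\<And>j. j < n \<longleftrightarrow> j < m \<or> j = m" "n - m = 1" using n by (auto simp: m_def)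
  have split: "(\<Sum>j<n. f j) = (\<Sum>j<m. f j) + f m" for f :: "nat \<Rightarrow> 'f"
  proof -
    have "Suc m = n" using n by (simp add: m_def)
    then show ?thesis using sum.lessThan_Suc[of f m] by simp
  qed
  have entries: "C $$ (k, m) = companion_coeff k" "\<And>j. j < m \<Longrightarrow> C $$ (k, j) = (if k = Suc j then 1 else 0)"
    if "k < n" for k
    using that m(1) by (auto simp: companion_def m_def)
  have rel': "(\<Sum>j<m. (-1) ^ j * \<delta> (n - j) * (if k = Suc j then 1 else 0)) + (-1) ^ m * \<delta> 1 * companion_coeff k = 0"
    if k: "k < n" for k
  proof -
    have "(\<Sum>j<m. (-1) ^ j * \<delta> (n - j) * C $$ (k, j)) =
        (\<Sum>j<m. (-1) ^ j * \<delta> (n - j) * (if k = Suc j then 1 else 0))"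
      by (rule sum.cong[OF refl]) (use entries(2)[OF k] in auto)
    then show ?thesis using rel[OF k] entries(1)[OF k] m(3) by (simp add: split)
  qed
  \<comment> \<open>In row 0 only the last column is nonzero, and its entry is
    \<open>char_coeff n\<close> up to sign. Row \<open>Suc j\<close> then isolates \<delta> at
    \<open>n - j\<close>.\<close>
  have d1: "\<delta> 1 = 0"
    using rel'[of 0] n char_coeff_n(2) by (simp add: companion_coeff_def)
  have "\<delta> i = 0"
  proof (cases "i \<le> 1")
    case True
    then show ?thesis using d0 d1 by (cases i) auto
  next
    case False
    define j where "j = n - i"
    have j: "j < m" "n - j = i" "Suc j < n" using False i by (auto simp: j_def m_def)
    have "(\<Sum>j'<m. (-1) ^ j' * \<delta> (n - j') * (if Suc j = Suc j' then 1 else 0)) = (-1) ^ j * \<delta> i"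
      using j by (simp add: if_distrib[of "\<lambda>x. _ * x"] cong: if_cong)
    then have "(-1) ^ j * \<delta> i = 0" using rel'[OF j(3)] d1 by simp
    then show ?thesis by simp
  qed
  then show ?thesis by (simp add: \<delta>_def)
qed

lemma companion_det: "det C = weight_factor z n"
  using companion_principal_sum[of n] principal_sum_self[OF companion_carrier] char_coeff_n by simp

text \<open>If \<open>h(C u, C v) = Z h(u, v)\<close> and \<open>h(e0, -) = ev\<close>, then
  \<open>h(C^i e0, v) = Z^i ev(C^-i v)\<close>; as the \<open>C^i e0\<close> are the standard basis,
  this prescribes \<open>H\<close>. The work lies in proving that the resulting \<open>H\<close> is
  Hermitian, and this is what the conjugation conditions on z, a and b provide.\<close>

lemma companion_form_exists:
  "\<exists>ev H. ev \<in> carrier_vec n \<and> H \<in> carrier_mat n n \<and>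
     ev \<bullet> e0 = b 0 \<and>
     (\<forall>i. Suc i < n \<longrightarrow> bordered_trace n C ev e0 i = weight_factor z (Suc i) * b (Suc i)) \<and>
     adjoint_mat s H = H \<and> adjoint_mat s C * H * C = Z \<cdot>\<^sub>m H \<and> hermitian_covector s H e0 = ev"
proof -
  have e0: "e0 \<in> carrier_vec n" by simp
  \<comment> \<open>The prospective moments \<open>h(e0, C^j e0)\<close>, found by solving the
    triangular system for the invariants b.\<close>
  obtain mu where mu: "mu 0 = b 0" "\<And>i. i < n \<Longrightarrow>
      (\<Sum>j\<le>i. (-1) ^ j * char_coeff (i - j) * mu (Suc j)) = weight_factor z (Suc i) * b (Suc i)"
    using triangular_recursion_solvable[of char_coeff "b 0" n "\<lambda>i. weight_factor z (Suc i) * b (Suc i)"]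
      char_coeff_0 by blast
  define ev where "ev = vec n mu"
  have ev: "ev \<in> carrier_vec n" by (simp add: ev_def)
  have ev_mu: "ev \<bullet> krylov C e0 j = mu j" if "j < n" for j
    using that by (simp add: companion_krylov scalar_prod_right_unit ev_def)
  have Cc: "C \<in> carrier_mat n n" by (rule companion_carrier)
  have dC: "det C \<noteq> 0" using companion_det weight_factor_nz by simp
  define B where "B = inverse_mat C"
  have B: "B \<in> carrier_mat n n" "C * B = 1\<^sub>m n" "B * C = 1\<^sub>m n"
    using inverse_mat[OF Cc dC] by (simp_all add: B_def)
  have psum: "principal_sum n C (i - j) = char_coeff (i - j)" if "i \<le> n" for i j
    by (rule companion_principal_sum) (use that in simp)
  have bt: "bordered_trace n C ev e0 i = weight_factor z (Suc i) * b (Suc i)" if i: "Suc i < n" for i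
  proof -
    have "bordered_trace n C ev e0 i = (\<Sum>j\<le>i. (-1) ^ j * char_coeff (i - j) * mu (Suc j))"
      unfolding bordered_trace_krylov[OF Cc e0]
      by (rule sum.cong[OF refl]) (use i in \<open>simp add: psum ev_mu\<close>)
    then show ?thesis using mu(2)[of i] i by simp
  qed
  have ch: "(\<Sum>j\<le>n. (-1) ^ j * char_coeff (n - j) * (ev \<bullet> krylov C v j)) = 0"
    if v: "v \<in> carrier_vec n" for v
    using cayley_hamilton_moment[OF Cc dC v, of ev] by (simp add: moment_def psum)
  \<comment> \<open>Cayley-Hamilton at \<open>C^-n f\<close>, read backwards, is a relation between
    the negative powers.\<close>
  have ch_inv: "(\<Sum>k\<le>n. (-1) ^ k * (char_coeff k * (ev \<bullet> krylov B f k))) = 0"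
    if f: "f \<in> carrier_vec n" for f
  proof -
    have "(\<Sum>j\<le>n. (-1) ^ j * (char_coeff (n - j) * (ev \<bullet> krylov B f (n - j)))) = 0"
      using ch[OF krylov_carrier[OF B(1) f], of n]
      by (simp add: krylov_inverse[OF B(1) Cc B(2) f] mult.assoc)
    then show ?thesis
      using sum_alternating_reverse[of "\<lambda>k. char_coeff k * (ev \<bullet> krylov B f k)" n] by simp
  qed
  \<comment> \<open>These are the moments of negative index. Symmetry and similitude of a form would
    force \<open>h(e0, C^r e0) = Z^r s(m r)\<close>, which is \<open>nu r\<close>; Hermitian
    symmetry of \<open>H\<close> amounts to \<open>mu = nu\<close>.\<close>
  define m where "m r = ev \<bullet> krylov B e0 r" for r
  define nu where "nu r = Z ^ r * s (m r)" for r
  let ?D = "s (weight_factor z n)"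
  have D0: "?D \<noteq> 0" using weight_factor_nz[of n] by simp
  \<comment> \<open>Cayley-Hamilton at \<open>C^-(i+1) e0\<close> is cut at exponent 0. The
    nonnegative part is evaluated by the recursion for \<open>mu\<close> and gives
    \<open>b_0 a_{n-i-1} - b_{n-i-1}\<close>; after conjugation this is \<open>b_{i+1}\<close>,
    while the functional equation turns the negative part into the recursion for
    \<open>nu\<close>.\<close>
  have nu_rec: "(\<Sum>l\<le>i. (-1) ^ l * char_coeff (i - l) * nu (Suc l)) = weight_factor z (Suc i) * b (Suc i)"
    if i: "Suc i < n" for i
  proof -
    let ?I = "Suc i"
    have I: "?I \<in> {1..<n}" "n - ?I \<in> {1..<n}" using i by auto
    \<comment> \<open>Chosen with \<open>Suc k = n - Suc i\<close>, the complementary index; it is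
      below \<open>n\<close>, so \<open>mu\<close> computes all moments that occur.\<close>
    define k where "k = n - Suc ?I"
    have k: "Suc k = n - ?I" "Suc k < n" using i by (auto simp: k_def)
    define g where "g j = (-1) ^ j * char_coeff (n - j) * (ev \<bullet> krylov C (krylov B e0 ?I) j)" for j
    have "(\<Sum>j\<le>n. g j) = 0" unfolding g_def by (rule ch) (use B e0 in simp)
    also have "(\<Sum>j\<le>n. g j) = (\<Sum>j<?I. g j) + (\<Sum>l\<le>Suc k. g (?I + l))"
    proof -
      have "{..n} = {..<?I} \<union> {?I..n}" using i by auto
      then have "(\<Sum>j\<le>n. g j) = (\<Sum>j<?I. g j) + (\<Sum>j\<in>{?I..n}. g j)"
        by (simp add: sum.union_disjoint ivl_disj_int)
      moreover have "(\<Sum>j\<in>{?I..n}. g j) = (\<Sum>l\<le>Suc k. g (?I + l))"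
        by (rule sum.reindex_bij_witness[of _ "\<lambda>l. ?I + l" "\<lambda>j. j - ?I"]) (use k in auto)
      ultimately show ?thesis by simp
    qed
    also have "(\<Sum>j<?I. g j) = (\<Sum>j<?I. (-1) ^ j * char_coeff (n - j) * m (?I - j))"
      unfolding g_def m_def
      by (rule sum.cong[OF refl]) (simp add: krylov_inverse[OF B(1) Cc B(2) e0])
    also have "(\<Sum>l\<le>Suc k. g (?I + l)) =
        (-1) ^ ?I * (\<Sum>l\<le>Suc k. (-1) ^ l * char_coeff (Suc k - l) * mu l)"
      unfolding sum_distrib_left
    proof (rule sum.cong[OF refl])
      fix l assume l: "l \<in> {..Suc k}"
      have "n - (?I + l) = Suc k - l" using k by simp
      moreover have "krylov C (krylov B e0 ?I) (?I + l) = krylov C e0 l"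
        by (rule krylov_inverse_add[OF B(1) Cc B(2) e0])
      ultimately show "g (?I + l) = (-1) ^ ?I * ((-1) ^ l * char_coeff (Suc k - l) * mu l)"
        using l k ev_mu[of l] by (simp only: g_def) (simp add: power_add mult_ac)
    qed
    also have "(\<Sum>l\<le>Suc k. (-1) ^ l * char_coeff (Suc k - l) * mu l) =
        weight_factor z (n - ?I) * (b 0 * a (n - ?I) - b (n - ?I))"
    proof -
      have "(\<Sum>l\<le>Suc k. (-1) ^ l * char_coeff (Suc k - l) * mu l) =
          char_coeff (Suc k) * b 0 - (\<Sum>l\<le>k. (-1) ^ l * char_coeff (k - l) * mu (Suc l))"
        by (simp only: sum.atMost_Suc_shift) (simp add: mu(1) sum_negf)
      moreover have "char_coeff (Suc k) = weight_factor z (Suc k) * a (Suc k)"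
        using k(2) by (simp add: char_coeff_def)
      moreover have "(\<Sum>l\<le>k. (-1) ^ l * char_coeff (k - l) * mu (Suc l)) =
          weight_factor z (Suc k) * b (Suc k)"
        using mu(2)[of k] k(2) by simp
      ultimately show ?thesis unfolding k(1)[symmetric] by (simp only:) (simp only: right_diff_distrib mult_ac)
    qed
    finally have "(\<Sum>j<?I. (-1) ^ j * char_coeff (n - j) * m (?I - j)) =
        - ((-1) ^ ?I * (weight_factor z (n - ?I) * (b 0 * a (n - ?I) - b (n - ?I))))"
      by (simp only: eq_neg_iff_add_eq_0)
    then have "s (\<Sum>j<?I. (-1) ^ j * char_coeff (n - j) * m (?I - j)) =
        s (- ((-1) ^ ?I * (weight_factor z (n - ?I) * (b 0 * a (n - ?I) - b (n - ?I)))))"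
      by (rule arg_cong)
    then have sm: "(\<Sum>j<?I. (-1) ^ j * s (char_coeff (n - j)) * s (m (?I - j))) =
        - ((-1) ^ ?I * (s (weight_factor z (n - ?I)) * b ?I))"
      using bs[OF I(1)] by (simp only: s.hom_sum s.hom_mult s.hom_uminus s.hom_power s.hom_one)
    have "?D * (\<Sum>j<?I. (-1) ^ j * char_coeff j * nu (?I - j)) =
       (\<Sum>j<?I. Z ^ ?I * ((-1) ^ j * s (char_coeff (n - j)) * s (m (?I - j))))"
      unfolding sum_distrib_left
    proof (rule sum.cong[OF refl])
      fix j assume j: "j \<in> {..<?I}"
      have "?D * ((-1) ^ j * char_coeff j * nu (?I - j)) =
         (-1) ^ j * (?D * char_coeff j) * (Z ^ (?I - j) * s (m (?I - j)))"
        by (simp only: nu_def mult_ac)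
      also have "?D * char_coeff j = Z ^ j * s (char_coeff (n - j))"
        by (rule char_coeff_conjugate[symmetric]) (use j i in simp)
      also have "(-1) ^ j * (Z ^ j * s (char_coeff (n - j))) * (Z ^ (?I - j) * s (m (?I - j))) =
         (Z ^ j * Z ^ (?I - j)) * ((-1) ^ j * s (char_coeff (n - j)) * s (m (?I - j)))"
        by (simp only: mult_ac)
      also have "Z ^ j * Z ^ (?I - j) = Z ^ ?I"
        using j by (subst power_add[symmetric]) simp
      finally show "?D * ((-1) ^ j * char_coeff j * nu (?I - j)) =
         Z ^ ?I * ((-1) ^ j * s (char_coeff (n - j)) * s (m (?I - j)))" .
    qed
    also have "\<dots> = - ((-1) ^ ?I * (Z ^ ?I * s (weight_factor z (n - ?I)) * b ?I))"
      by (subst sum_distrib_left[symmetric], subst sm) (simp only: mult_minus_right mult_ac)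
    also have "Z ^ ?I * s (weight_factor z (n - ?I)) = weight_factor z ?I * ?D"
    proof -
      have "weight_factor z ?I * ?D = s Z ^ ?I * s (weight_factor z (n - ?I))"
        by (rule weight_factor_conjugate[where n = n and z = z and s = s and k = ?I, OF s zs])
          (use i in simp_all)
      then show ?thesis unfolding Z_fixed by simp
    qed
    also have "- ((-1) ^ ?I * (weight_factor z ?I * ?D * b ?I)) = ?D * ((-1) ^ i * (weight_factor z ?I * b ?I))"
      by simp
    finally have "?D * (\<Sum>j<?I. (-1) ^ j * char_coeff j * nu (?I - j)) =
        ?D * ((-1) ^ i * (weight_factor z ?I * b ?I))" .
    then have "(\<Sum>j<?I. (-1) ^ j * char_coeff j * nu (?I - j)) = (-1) ^ i * (weight_factor z ?I * b ?I)"
      by (rule mult_left_cancel[OF D0, THEN iffD1])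
    then have eq: "(\<Sum>j\<le>i. (-1) ^ j * (char_coeff j * nu (?I - j))) = (-1) ^ i * (weight_factor z ?I * b ?I)"
      by (simp only: lessThan_Suc_atMost mult.assoc)
    have "(-1) ^ i * (\<Sum>l\<le>i. (-1) ^ l * (char_coeff (i - l) * nu (Suc l))) =
       (\<Sum>j\<le>i. (-1) ^ j * (char_coeff (i - (i - j)) * nu (Suc (i - j))))"
      by (rule sum_alternating_reverse[symmetric])
    also have "\<dots> = (\<Sum>j\<le>i. (-1) ^ j * (char_coeff j * nu (?I - j)))"
      by (rule sum.cong[OF refl]) (simp add: Suc_diff_le)
    finally have "(-1) ^ i * ((-1) ^ i * (\<Sum>l\<le>i. (-1) ^ l * (char_coeff (i - l) * nu (Suc l)))) =
        (-1) ^ i * ((-1) ^ i * (weight_factor z ?I * b ?I))"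
      unfolding eq by simp
    then show ?thesis by (simp add: mult.assoc)
  qed
  have mu_nu: "mu r = nu r" if "r < n" for r
    using that
  proof (rule triangular_recursion_unique[where p = char_coeff and n = n, rotated 3])
    show "(\<Sum>j\<le>i. (-1) ^ j * char_coeff (i - j) * mu (Suc j)) =
        (\<Sum>j\<le>i. (-1) ^ j * char_coeff (i - j) * nu (Suc j))" if "Suc i < n" for i
      using mu(2)[of i] nu_rec[OF that] that by simp
    show "mu 0 = nu 0"
      using ev_mu[of 0] n mu(1) b0 by (simp add: nu_def m_def)
  qed (rule char_coeff_0)
  \<comment> \<open>Row \<open>i\<close> is the functional \<open>h(C^i e0, -)\<close> dictated by
    the similitude relation, with \<open>B\<close> the inverse of \<open>C\<close>.\<close>
  define H where "H = mat n n (\<lambda>(i, j). Z ^ i * (ev \<bullet> krylov B (unit_vec n j) i))"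
  have H: "H \<in> carrier_mat n n" by (simp add: H_def)
  \<comment> \<open>On and above the diagonal the entries involve only \<open>mu\<close>, on and
    below it only \<open>m\<close>, each depending on the distance to the diagonal up to a power of
    Z.\<close>
  have up: "H $$ (i, i + r) = Z ^ i * mu r" if "i + r < n" for i r
  proof -
    have "krylov B (unit_vec n (i + r)) i = krylov C e0 r"
      using krylov_inverse[OF Cc B(1,3) e0, of i "i + r"] companion_krylov[OF that] by simp
    then show ?thesis using that ev_mu[of r] by (simp add: H_def)
  qed
  have low: "H $$ (j + r, j) = Z ^ (j + r) * m r" if "j + r < n" for j r
  proof -
    have "krylov B (unit_vec n j) (j + r) = krylov B e0 r"
      using krylov_inverse_add[OF Cc B(1,3) e0, of j r] companion_krylov[of j] that by simp
    then show ?thesis using that by (simp add: H_def m_def)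
  qed
  have herm_le: "s (H $$ (j, i)) = H $$ (i, j)" if "i \<le> j" "j < n" for i j
  proof -
    obtain r where r: "j = i + r" using \<open>i \<le> j\<close> nat_le_iff_add by blast
    have "s (H $$ (j, i)) = s (Z ^ (i + r) * m r)" using low[of i r] that r by simp
    also have "\<dots> = Z ^ (i + r) * s (m r)" by (simp only: s.hom_mult s.hom_power Z_fixed)
    also have "\<dots> = Z ^ i * nu r" by (simp only: nu_def power_add mult_ac)
    also have "\<dots> = H $$ (i, j)" using up[of i r] mu_nu[of r] that r by simp
    finally show ?thesis .
  qed
  have herm: "adjoint_mat s H = H"
  proof (rule eq_matI)
    fix i j assume "i < dim_row H" "j < dim_col H"
    then have ij: "i < n" "j < n" using H by auto
    have "s (H $$ (j, i)) = H $$ (i, j)"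
    proof (cases "i \<le> j")
      case True
      then show ?thesis using herm_le ij by simp
    next
      case False
      then have "s (H $$ (i, j)) = H $$ (j, i)" using herm_le[of j i] ij by simp
      then show ?thesis using ss by metis
    qed
    then show "adjoint_mat s H $$ (i, j) = H $$ (i, j)" using ij H by (simp add: adjoint_mat_def)
  qed (use H in \<open>auto simp: adjoint_mat_def\<close>)
  have aC: "adjoint_mat s C \<in> carrier_mat n n" using Cc by (simp add: adjoint_mat_def)
  have sim: "adjoint_mat s C * H * C = Z \<cdot>\<^sub>m H"
  proof (rule eq_matI)
    fix i j assume "i < dim_row (Z \<cdot>\<^sub>m H)" "j < dim_col (Z \<cdot>\<^sub>m H)"
    then have ij: "i < n" "j < n" using H by auto
    let ?f = "col C j"
    have f: "?f \<in> carrier_vec n" by (rule col_carrier_vec[OF ij(2) Cc])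
    define x where "x k = ev \<bullet> krylov B ?f k" for k
    have HC: "(H * C) $$ (k, j) = Z ^ k * x k" if k: "k < n" for k
    proof -
      have row: "row H k = Z ^ k \<cdot>\<^sub>v krylov B\<^sup>T ev k"
      proof (rule eq_vecI)
        fix l assume "l < dim_vec (Z ^ k \<cdot>\<^sub>v krylov B\<^sup>T ev k)"
        then have l: "l < n" using carrier_vecD[OF krylov_carrier[of "B\<^sup>T" n ev k]] B ev by simp
        have w: "krylov B\<^sup>T ev k \<in> carrier_vec n" using B ev by simp
        have "krylov B\<^sup>T ev k $ l = krylov B\<^sup>T ev k \<bullet> krylov B (unit_vec n l) 0"
          using l scalar_prod_right_unit[OF l] by simp
        also have "\<dots> = ev \<bullet> krylov B (unit_vec n l) k"
          using krylov_transpose_scalar_prod[OF B(1) ev, of "unit_vec n l" k 0] by simp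
        finally show "row H k $ l = (Z ^ k \<cdot>\<^sub>v krylov B\<^sup>T ev k) $ l"
          using l k w by (simp add: H_def)
      qed (use B ev H in \<open>simp add: carrier_vecD[OF krylov_carrier[of "B\<^sup>T" n ev k]]\<close>)
      have w: "krylov B\<^sup>T ev k \<in> carrier_vec n" using B ev by simp
      have "(H * C) $$ (k, j) = (Z ^ k \<cdot>\<^sub>v krylov B\<^sup>T ev k) \<bullet> ?f"
        using k ij H Cc row by simp
      also have "\<dots> = Z ^ k * (krylov B\<^sup>T ev k \<bullet> krylov B ?f 0)"
        using w f by simp
      also have "krylov B\<^sup>T ev k \<bullet> krylov B ?f 0 = x k"
        using krylov_transpose_scalar_prod[OF B(1) ev f, of k 0] by (simp add: x_def)
      finally show ?thesis .
    qed
    have xS: "x (Suc k) = ev \<bullet> krylov B (unit_vec n j) k" for k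
    proof -
      have "B *\<^sub>v ?f = (B * C) *\<^sub>v unit_vec n j"
        unfolding mult_unit_vec[OF Cc ij(2), symmetric]
        by (rule assoc_mult_mat_vec[symmetric, OF B(1) Cc]) simp
      then show ?thesis by (simp add: x_def krylov_mult[symmetric] B(3))
    qed
    have HZ: "Z * H $$ (i, j) = Z ^ Suc i * x (Suc i)"
      using ij by (simp add: H_def xS)
    have "(adjoint_mat s C * H * C) $$ (i, j) = (adjoint_mat s C * (H * C)) $$ (i, j)"
      using assoc_mult_mat[OF aC H Cc] by simp
    also have "\<dots> = (\<Sum>k<n. s (C $$ (k, i)) * (H * C) $$ (k, j))"
      using aC H Cc ij by (simp add: scalar_prod_def lessThan_atLeast0 adjoint_mat_def del: assoc_mult_mat)
    also have "\<dots> = (\<Sum>k<n. s (C $$ (k, i)) * (Z ^ k * x k))"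
      by (rule sum.cong[OF refl]) (simp add: HC)
    also have "\<dots> = Z ^ Suc i * x (Suc i)"
    \<comment> \<open>A column of \<open>C\<close> other than the last is a basis vector, and the
      identity is the definition of the next row. For the last column the coefficients are
      conjugated by the functional equation and summed by the relation for negative powers.\<close>
    proof (cases "i = n - 1")
      case False
      then have Si: "Suc i < n" using ij by simp
      have "(\<Sum>k<n. s (C $$ (k, i)) * (Z ^ k * x k)) =
          (\<Sum>k<n. if k = Suc i then Z ^ Suc i * x (Suc i) else 0)"
        by (rule sum.cong[OF refl]) (use ij False in \<open>auto simp: companion_def\<close>)
      then show ?thesis using Si by simp
    next
      case True
      then have Si: "Suc i = n" using n by simp
      have "(\<Sum>k<n. s (C $$ (k, i)) * (Z ^ k * x k)) =
          (\<Sum>k<n. - ((-1) ^ n * ?D) * ((-1) ^ k * (char_coeff k * x k)))"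
      proof (rule sum.cong[OF refl])
        fix k assume k: "k \<in> {..<n}"
        have "s (C $$ (k, i)) = - ((-1) ^ n * ((-1) ^ k * s (char_coeff (n - k))))"
          using k ij True by (simp add: companion_def companion_coeff_def s.hom_mult s.hom_power s.hom_uminus)
        then have "s (C $$ (k, i)) * (Z ^ k * x k) =
            - ((-1) ^ n * ((-1) ^ k * ((Z ^ k * s (char_coeff (n - k))) * x k)))"
          by (simp only: mult_minus_left mult_minus_right mult_ac)
        also have "Z ^ k * s (char_coeff (n - k)) = ?D * char_coeff k"
          by (rule char_coeff_conjugate) (use k in simp)
        finally show "s (C $$ (k, i)) * (Z ^ k * x k) = - ((-1) ^ n * ?D) * ((-1) ^ k * (char_coeff k * x k))"
          by (simp only: mult_minus_left mult_minus_right mult_ac)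
      qed
      also have "\<dots> = - ((-1) ^ n * ?D) * (\<Sum>k<n. (-1) ^ k * (char_coeff k * x k))"
        by (simp only: sum_distrib_left)
      also have "(\<Sum>k<n. (-1) ^ k * (char_coeff k * x k)) = - ((-1) ^ n * (char_coeff n * x n))"
        using ch_inv[OF f] by (simp add: x_def lessThan_Suc_atMost[symmetric] eq_neg_iff_add_eq_0)
      also have "- ((-1) ^ n * ?D) * - ((-1) ^ n * (char_coeff n * x n)) =
          ((-1) ^ n * (-1) ^ n) * (weight_factor z n * ?D * x n)"
        by (simp only: minus_mult_minus char_coeff_n(1) mult_ac)
      also have "weight_factor z n * ?D = Z ^ n"
      proof -
        have "weight_factor z n * ?D = s Z ^ n * s (weight_factor z (n - n))"
          by (rule weight_factor_conjugate[where n = n and z = z and s = s and k = n, OF s zs]) simp_all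
        then show ?thesis unfolding Z_fixed by (simp add: weight_factor_def)
      qed
      also have "(-1) ^ n * (-1) ^ n = (1 :: 'f)" by simp
      finally show ?thesis unfolding Si by simp
    qed
    finally have "(adjoint_mat s C * H * C) $$ (i, j) = Z * H $$ (i, j)" unfolding HZ .
    then show "(adjoint_mat s C * H * C) $$ (i, j) = (Z \<cdot>\<^sub>m H) $$ (i, j)"
      using ij H by simp
  qed (use aC H Cc in auto)
  have "hermitian_covector s H e0 = ev"
  proof (rule eq_vecI)
    fix j assume "j < dim_vec ev"
    then have j: "j < n" using ev by simp
    have "map_vec s e0 = e0" by (auto simp: unit_vec_def)
    moreover have "H\<^sup>T \<in> carrier_mat n n" using H by simp
    ultimately have "hermitian_covector s H e0 $ j = H $$ (0, j)"
      using j n H mult_unit_vec[of "H\<^sup>T" 0] by (simp add: hermitian_covector_def)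
    also have "\<dots> = ev $ j"
      using j n by (simp add: H_def scalar_prod_right_unit)
    finally show "hermitian_covector s H e0 $ j = ev $ j" .
  qed (use H ev in \<open>simp add: hermitian_covector_def\<close>)
  moreover have "ev \<bullet> e0 = b 0" using ev_mu[of 0] n mu(1) by simp
  ultimately show ?thesis
    by (intro exI[of _ ev] exI[of _ H] conjI allI impI) ((rule bt, assumption) | rule ev H herm sim | assumption)+
qed

text \<open>Nondegeneracy of the form is not part of this statement; it follows later from the
  nonvanishing of Disc.\<close>

lemma hermitian_triple_exists:
  "\<exists>A e H. A \<in> carrier_mat n n \<and> e \<in> carrier_vec n \<and> H \<in> carrier_mat n n \<and> adjoint_mat s H = H \<and>
     adjoint_mat s A * H * A = rho z (n - 1) \<cdot>\<^sub>m H \<and>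
     matrix_invariants n A e (hermitian_covector s H e) (z, a, b)"
proof -
  obtain ev H where ev: "ev \<bullet> e0 = b 0"
      "\<And>i. Suc i < n \<Longrightarrow> bordered_trace n C ev e0 i = weight_factor z (Suc i) * b (Suc i)"
    and H: "H \<in> carrier_mat n n" "adjoint_mat s H = H" "adjoint_mat s C * H * C = Z \<cdot>\<^sub>m H"
      "hermitian_covector s H e0 = ev"
    using companion_form_exists by blast
  have "matrix_invariants n C e0 (hermitian_covector s H e0) (z, a, b)"
    unfolding matrix_invariants_def H(4)
    using companion_det companion_principal_sum ev by (simp add: char_coeff_def)
  then show ?thesis using H companion_carrier unit_vec_carrier by blast
qed

end

section \<open>Passage between points and matrices, and the value of Disc\<close>

lemma rho_cong:
  assumes "\<And>j. j \<in> {1..<n} \<Longrightarrow> z j = z' j" and "i < n"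
  shows "rho z i = rho z' i"
  unfolding rho_def by (rule prod.cong) (use assms in auto)

lemma weight_factor_cong:
  assumes "\<And>j. j \<in> {1..<n} \<Longrightarrow> z j = z' j" and "i \<le> n"
  shows "weight_factor z i = weight_factor z' i"
  unfolding weight_factor_def
  by (rule prod.cong[OF refl], rule rho_cong[where n = n]) (use assms in auto)

lemma weight_factor_nonzero:
  fixes z :: "nat \<Rightarrow> 'f::field"
  assumes "\<And>j. j \<in> {1..<n} \<Longrightarrow> z j \<noteq> 0" and "i \<le> n"
  shows "weight_factor z i \<noteq> 0"
  using assms by (auto simp: weight_factor_def rho_def)

lemma has_invariants_iff:
  fixes \<phi> :: "'f::field point"
  assumes z: "\<And>i. i \<in> {1..<n} \<Longrightarrow> z i \<noteq> 0" and pz: "\<And>i. i \<in> {1..<n} \<Longrightarrow> point_z n \<phi> i = z i"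
    and x: "\<And>i I J. i \<in> {1..<n} \<Longrightarrow> I \<in> subsets_of_card n i \<Longrightarrow> J \<in> subsets_of_card n i \<Longrightarrow>
      weight_factor z i * point_x n \<phi> i I J = minor A I J"
    and d: "det A = weight_factor z n" and n: "n \<ge> 1"
  shows "has_invariants n \<phi> e e' (z, a, b) \<longleftrightarrow> matrix_invariants n A e e' (z, a, b)"
proof -
  have w: "weight_factor z i \<noteq> 0" if "i \<in> {1..<n}" for i
    by (rule weight_factor_nonzero[where n = n]) (use z that in auto)
  have x': "point_x n \<phi> i I J = inverse (weight_factor z i) * minor A I J"
    if "i \<in> {1..<n}" "I \<in> subsets_of_card n i" "J \<in> subsets_of_card n i" for i I J
    using x[OF that] w[OF that(1)] by (simp add: field_simps)
  have ia: "a i = inv_a n (point_x n \<phi>) i \<longleftrightarrow> principal_sum n A i = weight_factor z i * a i"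
    if i: "i \<in> {1..<n}" for i
  proof -
    have "inv_a n (point_x n \<phi>) i = inverse (weight_factor z i) * principal_sum n A i"
      by (rule inv_a_scaled_minor) (rule x'[OF i])
    then show ?thesis using w[OF i] by (auto simp: field_simps)
  qed
  have ib: "b (Suc i) = inv_b n (point_x n \<phi>) e e' (Suc i) \<longleftrightarrow>
      bordered_trace n A e' e i = weight_factor z (Suc i) * b (Suc i)" if "Suc i < n" for i
  proof -
    have i: "Suc i \<in> {1..<n}" using that by simp
    have "inv_b n (point_x n \<phi>) e e' (Suc i) =
        inverse (weight_factor z (Suc i)) * bordered_trace n A e' e i"
      by (rule inv_b_scaled_minor) (rule x'[OF i])
    then show ?thesis using w[OF i] by (auto simp: field_simps)
  qed
  have b: "(\<forall>i<n. b i = inv_b n (point_x n \<phi>) e e' i) \<longleftrightarrow> e' \<bullet> e = b 0 \<and>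
      (\<forall>i. Suc i < n \<longrightarrow> bordered_trace n A e' e i = weight_factor z (Suc i) * b (Suc i))"
    (is "?L \<longleftrightarrow> ?R")
  proof
    assume L: ?L
    have "b 0 = e' \<bullet> e" using L[rule_format, of 0] n by (simp add: inv_b_def)
    then show ?R using L ib by auto
  next
    assume R: ?R
    show ?L
    proof (intro allI impI)
      fix i assume "i < n"
      then show "b i = inv_b n (point_x n \<phi>) e e' i"
        using R ib by (cases i) (auto simp: inv_b_def)
    qed
  qed
  show ?thesis
    unfolding has_invariants_def matrix_invariants_def split_conv b using ia pz d by auto
qed

lemma has_invariants_point_mat:
  fixes \<phi> :: "'f::field point"
  assumes p: "\<phi> \<in> monoid_points n" and n: "n \<ge> 1" and z: "\<And>i. i \<in> {1..<n} \<Longrightarrow> z i \<noteq> 0"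
    and h: "has_invariants n \<phi> e e' (z, a, b)"
  shows "matrix_invariants n (point_mat n \<phi>) e e' (z, a, b)"
proof -
  have pz: "point_z n \<phi> i = z i" if "i \<in> {1..<n}" for i
    using h that by (simp add: has_invariants_def)
  have w: "weight_factor (point_z n \<phi>) i = weight_factor z i" if "i \<le> n" for i
    by (rule weight_factor_cong[where n = n]) (use pz that in auto)
  have "has_invariants n \<phi> e e' (z, a, b) \<longleftrightarrow> matrix_invariants n (point_mat n \<phi>) e e' (z, a, b)"
  proof (rule has_invariants_iff[OF z pz])
    fix i I J assume i: "i \<in> {1..<n}" and IJ: "I \<in> subsets_of_card n i" "J \<in> subsets_of_card n i"
    then show "weight_factor z i * point_x n \<phi> i I J = minor (point_mat n \<phi>) I J"
      using point_mat_minor[OF p i IJ] w[of i] by simp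
  qed (use point_mat_det[OF p n] w[of n] n in simp_all)
  then show ?thesis using h by simp
qed

text \<open>Equal invariants give equal moments, and the product is a Hankel determinant of
  moments.\<close>

lemma krylov_product_unique:
  fixes A B :: "'f::field mat"
  assumes A: "A \<in> carrier_mat n n" "e \<in> carrier_vec n" "e' \<in> carrier_vec n"
    and B: "B \<in> carrier_mat n n" "f \<in> carrier_vec n" "f' \<in> carrier_vec n"
    and z: "\<And>i. i \<in> {1..<n} \<Longrightarrow> z i \<noteq> 0"
    and hA: "matrix_invariants n A e e' (z, a, b)" and hB: "matrix_invariants n B f f' (z, a, b)"
  shows "det (krylov_mat n A\<^sup>T e') * det (krylov_mat n A e) =
    det (krylov_mat n B\<^sup>T f') * det (krylov_mat n B f)"
proof -
  have w: "weight_factor z n \<noteq> 0" by (rule weight_factor_nonzero[where n = n]) (use z in auto)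
  have dets: "det A = weight_factor z n" "det B = weight_factor z n"
    using hA hB by (simp_all add: matrix_invariants_def)
  have "moment A e' e m = moment B f' f m" for m
  proof (rule moment_unique[where n = n])
    fix i assume i: "i \<le> n"
    consider "i = 0" | "i = n" | "i \<in> {1..<n}" using i by fastforce
    then show "principal_sum n A i = principal_sum n B i"
    proof cases
      case 1
      then show ?thesis by (simp add: principal_sum_0)
    next
      case 2
      then show ?thesis using dets principal_sum_self[OF A(1)] principal_sum_self[OF B(1)] by simp
    next
      case 3
      then show ?thesis using hA hB by (simp add: matrix_invariants_def)
    qed
  qed (use A B dets w hA hB in \<open>auto simp: matrix_invariants_def\<close>)
  then show ?thesis
    unfolding krylov_gram[OF A(1,3,2)] krylov_gram[OF B(1,3,2)] by (simp add: moment_def)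
qed

text \<open>Shows that the description in \<open>disc\<close> is well defined: any triple with the
  given invariants yields the same Hankel determinant of moments.\<close>

lemma disc_eq:
  fixes A :: "'f::field mat"
  assumes A: "A \<in> carrier_mat n n" "e \<in> carrier_vec n" "e' \<in> carrier_vec n"
    and n: "n \<ge> 1" "of_nat n \<noteq> (0 :: 'f)"
    and z: "\<And>i. i \<in> {1..<n} \<Longrightarrow> z i \<noteq> 0"
    and h: "matrix_invariants n A e e' (z, a, b)"
  shows "disc n (z, a, b) = (\<Prod>j<n. (-1) ^ j) * (\<Prod>j\<in>{1..<n}. inverse (weight_factor z j)) ^ 2 *
    (det (krylov_mat n A\<^sup>T e') * det (krylov_mat n A e))" (is "_ = ?d")
proof -
  have w: "weight_factor z i \<noteq> 0" if "i \<in> {1..<n}" for i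
    by (rule weight_factor_nonzero[where n = n]) (use z that in auto)
  have d: "det A = weight_factor z n" using h by (simp add: matrix_invariants_def)
  have val: "disc_covector n (point_x n \<phi>) f' n {..<n} * disc_vector n (point_x n \<phi>) f n {..<n} = ?d"
    if p: "\<phi> \<in> monoid_points n" and f: "f \<in> carrier_vec n" "f' \<in> carrier_vec n"
      and hp: "has_invariants n \<phi> f f' (z, a, b)" for \<phi> f f'
  proof -
    have pz: "point_z n \<phi> i = z i" if "i \<in> {1..<n}" for i
      using hp that by (simp add: has_invariants_def)
    have x: "point_x n \<phi> i I J = inverse (weight_factor z i) * minor (point_mat n \<phi>) I J"
      if i: "i \<in> {1..<n}" and IJ: "I \<in> subsets_of_card n i" "J \<in> subsets_of_card n i" for i I J
    proof -
      have "weight_factor (point_z n \<phi>) i = weight_factor z i"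
        by (rule weight_factor_cong[where n = n]) (use pz i in auto)
      then show ?thesis
        using point_mat_minor[OF p i IJ] w[OF i] by (simp add: field_simps)
    qed
    have "disc_covector n (point_x n \<phi>) f' n {..<n} * disc_vector n (point_x n \<phi>) f n {..<n} =
        (\<Prod>j<n. (-1) ^ j) * (\<Prod>j\<in>{1..<n}. inverse (weight_factor z j)) ^ 2 *
        (det (krylov_mat n (point_mat n \<phi>)\<^sup>T f') * det (krylov_mat n (point_mat n \<phi>) f))"
      by (rule disc_product_krylov[OF point_mat_carrier f x n(1)])
    also have "det (krylov_mat n (point_mat n \<phi>)\<^sup>T f') * det (krylov_mat n (point_mat n \<phi>) f) =
        det (krylov_mat n A\<^sup>T e') * det (krylov_mat n A e)"
    proof (rule krylov_product_unique[OF point_mat_carrier f A z _ h])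
      show "matrix_invariants n (point_mat n \<phi>) f f' (z, a, b)"
        by (rule has_invariants_point_mat[OF p n(1) z hp])
    qed
    finally show ?thesis .
  qed
  \<comment> \<open>The matrix itself supplies a point, hence a triple that witnesses
    existence.\<close>
  let ?\<phi> = "matrix_point n z A"
  have "has_invariants n ?\<phi> e e' (z, a, b) \<longleftrightarrow> matrix_invariants n A e e' (z, a, b)"
    by (rule has_invariants_iff[OF z matrix_point_z[OF n(2) A(1) d z] matrix_point_x[OF n(2) A(1) d z] d n(1)])
  then have ex: "has_invariants n ?\<phi> e e' (z, a, b)" using h by simp
  have mem: "?\<phi> \<in> monoid_points n" by (rule matrix_point_in[OF n(2) A(1) d z])
  show ?thesis
    unfolding disc_def
  proof (rule the_equality)
    show "\<exists>\<phi>\<in>monoid_points n. \<exists>e\<in>carrier_vec n. \<exists>e'\<in>carrier_vec n. has_invariants n \<phi> e e' (z, a, b) \<and>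
        ?d = disc_covector n (point_x n \<phi>) e' n {..<n} * disc_vector n (point_x n \<phi>) e n {..<n}"
      by (intro bexI[of _ ?\<phi>] bexI[of _ e] bexI[of _ e'] conjI ex mem val[OF mem A(2,3) ex, symmetric] A)
  next
    fix d
    assume "\<exists>\<phi>\<in>monoid_points n. \<exists>e\<in>carrier_vec n. \<exists>e'\<in>carrier_vec n. has_invariants n \<phi> e e' (z, a, b) \<and>
        d = disc_covector n (point_x n \<phi>) e' n {..<n} * disc_vector n (point_x n \<phi>) e n {..<n}"
    then show "d = ?d" using val by blast
  qed
qed

section \<open>Parity of valuations and the obstruction\<close>

context quadratic_involution
begin

lemma subdegree_unit_root:
  fixes c :: "'l fls"
  assumes "c * c = 1"
  shows "fls_subdegree c = 0"
proof -
  have c: "c \<noteq> 0" using assms by auto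
  have "fls_subdegree (c * c) = 2 * fls_subdegree c" using c by simp
  then show ?thesis unfolding assms by simp
qed

text \<open>Taking determinants in the similitude relation gives
  \<open>n val(q) = 2 val(det A)\<close>. Hence \<open>n (n - 1) / 2\<close> times
  \<open>val(q)\<close>, coming from the powers of \<open>q\<close>, cancels
  \<open>(n - 1) val(det A)\<close>, and the covector determinant exceeds the vector determinant in
  valuation by that of \<open>det H\<close>.\<close>

lemma similitude_parity:
  fixes A H :: "'l fls mat"
  assumes A: "A \<in> carrier_mat n n" and d: "det A \<noteq> 0"
    and H: "H \<in> carrier_mat n n" "det H \<noteq> 0" and e: "e \<in> carrier_vec n"
    and sim: "adjoint_mat (fls_map s) A * H * A = q \<cdot>\<^sub>m H" and n: "n \<ge> 1"
    and K: "det (krylov_mat n A e) \<noteq> 0"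
  shows "fls_subdegree (det (krylov_mat n A\<^sup>T (hermitian_covector (fls_map s) H e)) *
      det (krylov_mat n A e)) = 2 * fls_subdegree (det (krylov_mat n A e)) + fls_subdegree (det H)"
proof -
  let ?S = "fls_map s" and ?v = "fls_subdegree"
  let ?K = "det (krylov_mat n A e)" and ?K' = "det (krylov_mat n A\<^sup>T (hermitian_covector (fls_map s) H e))"
  interpret S: field_hom ?S by (rule fls_map_hom)
  have aA: "adjoint_mat ?S A \<in> carrier_mat n n" using A by (simp add: adjoint_mat_def)
  have "det (adjoint_mat ?S A) = ?S (det A)"
    using A by (simp add: adjoint_mat_def det_transpose[of _ n])
  then have "?S (det A) * det H * det A = q ^ n * det H"
    using arg_cong[OF sim, of det] A aA H by (simp add: det_mult[of _ n])
  then have qn: "q ^ n = ?S (det A) * det A" using H(2) by simp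
  have q: "q \<noteq> 0"
  proof
    assume "q = 0"
    then have "q ^ n = 0" using n by simp
    then show False unfolding qn using d by simp
  qed
  have vq: "int n * ?v q = 2 * ?v (det A)"
    using arg_cong[OF qn, of ?v] d q by (simp add: fls_map_subdegree fls_subdegree_pow)
  obtain c where c: "c = 1 \<or> c = - 1"
    and eq: "?S (det A) ^ (n - 1) * ?K' = c * (\<Prod>i<n. q ^ i) * ?S ?K * det H"
    using det_krylov_hermitian_covector[OF fls_map_hom A d H(1) e sim n] by blast
  have c0: "c \<noteq> 0" "?v c = 0" using c by (auto intro!: subdegree_unit_root)
  have P: "(\<Prod>i<n. q ^ i) = q ^ (\<Sum>i<n. i)" by (simp add: power_sum)
  have K': "?K' \<noteq> 0"
  proof
    assume "?K' = 0"
    then have "c * (\<Prod>i<n. q ^ i) * ?S ?K * det H = 0" using eq by simp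
    then show False using c0 q K H by (simp add: P)
  qed
  have "int (n - 1) * ?v (det A) + ?v ?K' = int (\<Sum>i<n. i) * ?v q + ?v ?K + ?v (det H)"
    using arg_cong[OF eq, of ?v] c0 d q K K' H(2)
    by (simp add: P fls_map_subdegree fls_subdegree_pow)
  \<comment> \<open>The equation is doubled so that the triangular number can be handled without
    division.\<close>
  moreover have "2 * (int (\<Sum>i<n. i) * ?v q) = 2 * (int (n - 1) * ?v (det A))"
  proof -
    have "2 * (\<Sum>i<n. i) = n * (n - 1)"
    proof (induction n)
      case (Suc m)
      then show ?case by (cases m) (simp_all add: algebra_simps)
    qed simp
    then have "2 * int (\<Sum>i<n. i) = int (n - 1) * int n"
      by (metis mult.commute of_nat_mult of_nat_numeral)
    then have "2 * (int (\<Sum>i<n. i) * ?v q) = int (n - 1) * (int n * ?v q)"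
      by (simp only: mult.assoc[symmetric])
    then show ?thesis unfolding vq by simp
  qed
  ultimately have "?v ?K' = ?v ?K + ?v (det H)" by linarith
  then show ?thesis using K K' by simp
qed

text \<open>Disc is a sign times a square times the product of the two Krylov determinants. If
  \<open>det H\<close> were 0, the covector determinant and with it Disc would vanish.\<close>

lemma disc_parity:
  fixes A H :: "'l fls mat"
  assumes A: "A \<in> carrier_mat n n" and H: "H \<in> carrier_mat n n" and e: "e \<in> carrier_vec n"
    and sim: "adjoint_mat (fls_map s) A * H * A = q \<cdot>\<^sub>m H"
    and n: "n \<ge> 1" "of_nat n \<noteq> (0 :: 'l fls)"
    and z: "\<And>i. i \<in> {1..<n} \<Longrightarrow> z i \<noteq> 0"
    and h: "matrix_invariants n A e (hermitian_covector (fls_map s) H e) (z, a, b)"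
    and nz: "disc n (z, a, b) \<noteq> 0"
  shows "det H \<noteq> 0" and "even (fls_subdegree (disc n (z, a, b))) \<longleftrightarrow> even (fls_subdegree (det H))"
proof -
  let ?S = "fls_map s" and ?v = "fls_subdegree"
  let ?K = "det (krylov_mat n A e)" and ?K' = "det (krylov_mat n A\<^sup>T (hermitian_covector (fls_map s) H e))"
  let ?\<epsilon> = "(\<Prod>j<n. (-1) ^ j) :: 'l fls" and ?W = "\<Prod>j\<in>{1..<n}. inverse (weight_factor z j)"
  interpret S: field_hom ?S by (rule fls_map_hom)
  have e': "hermitian_covector ?S H e \<in> carrier_vec n"
    using H e by (simp add: hermitian_covector_def)
  have D: "disc n (z, a, b) = ?\<epsilon> * ?W ^ 2 * (?K' * ?K)" by (rule disc_eq[OF A e e' n z h])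
  have d: "det A \<noteq> 0"
    using h weight_factor_nonzero[of n z n] z by (auto simp: matrix_invariants_def)
  have nz': "?K' \<noteq> 0" "?K \<noteq> 0" "?W \<noteq> 0" "?\<epsilon> \<noteq> 0" using nz unfolding D by auto
  obtain c where "?S (det A) ^ (n - 1) * ?K' = c * (\<Prod>i<n. q ^ i) * ?S ?K * det H"
    using det_krylov_hermitian_covector[OF fls_map_hom A d H e sim n(1)] by blast
  then show dH: "det H \<noteq> 0" using d nz'(1) by auto
  have "?\<epsilon> * ?\<epsilon> = 1"
    by (simp add: prod.distrib[symmetric] power_mult_distrib[symmetric])
  then have \<epsilon>: "?v ?\<epsilon> = 0" by (rule subdegree_unit_root)
  have "?v (disc n (z, a, b)) = ?v ?\<epsilon> + ?v (?W ^ 2) + ?v (?K' * ?K)"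
    unfolding D using nz' by (simp only: fls_subdegree_mult no_zero_divisors mult_eq_0_iff power_eq_0_iff simp_thms not_False_eq_True)
  also have "\<dots> = 2 * ?v ?W + (2 * ?v ?K + ?v (det H))"
    unfolding similitude_parity[OF A d H dH e sim n(1) nz'(2)] \<epsilon> by (simp add: fls_subdegree_pow)
  finally show "even (?v (disc n (z, a, b))) \<longleftrightarrow> even (?v (det H))" by presburger
qed

lemma hermitian_det_fixed:
  assumes "H \<in> hermitian_forms n (fls_map s)"
  shows "fls_map s (det H) = det H"
proof -
  interpret S: field_hom "fls_map s" by (rule fls_map_hom)
  have H: "H \<in> carrier_mat n n" "adjoint_mat (fls_map s) H = H"
    using assms by (simp_all add: hermitian_forms_def)
  have "det (adjoint_mat (fls_map s) H) = fls_map s (det H)"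
    using H(1) by (simp add: adjoint_mat_def det_transpose[of _ n])
  then show ?thesis unfolding H(2) by simp
qed

text \<open>The quotient of the two determinants is fixed by the involution, and among fixed nonzero
  elements the norms are those of even valuation.\<close>

lemma isometric_iff_parity:
  assumes n: "n \<ge> 1" and H: "H \<in> hermitian_forms n (fls_map s)" "H' \<in> hermitian_forms n (fls_map s)"
  shows "(H, H') \<in> isometric n (fls_map s) \<longleftrightarrow>
    (even (fls_subdegree (det H)) \<longleftrightarrow> even (fls_subdegree (det H')))"
proof -
  let ?S = "fls_map s"
  interpret S: field_hom ?S by (rule fls_map_hom)
  have nz: "det H \<noteq> 0" "det H' \<noteq> 0" using H by (simp_all add: hermitian_forms_def)
  have "(H, H') \<in> isometric n ?S \<longleftrightarrow> (\<exists>c. c \<noteq> 0 \<and> det H' = c * ?S c * det H)"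
    by (rule isometric_iff_det[OF fls_map_hom fls_map_invol fls_two fls_binary_universal n H])
  also have "\<dots> \<longleftrightarrow> (even (fls_subdegree (det H)) \<longleftrightarrow> even (fls_subdegree (det H')))"
  proof
    assume "\<exists>c. c \<noteq> 0 \<and> det H' = c * ?S c * det H"
    then obtain c where c: "c \<noteq> 0" "det H' = c * ?S c * det H" by blast
    have "fls_subdegree (det H') = 2 * fls_subdegree c + fls_subdegree (det H)"
      unfolding c(2) using c(1) nz by (simp add: fls_map_subdegree)
    then show "even (fls_subdegree (det H)) \<longleftrightarrow> even (fls_subdegree (det H'))" by simp
  next
    assume p: "even (fls_subdegree (det H)) \<longleftrightarrow> even (fls_subdegree (det H'))"
    have "fls_subdegree (det H' / det H) = fls_subdegree (det H') - fls_subdegree (det H)"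
      using nz by (simp add: fls_divide_subdegree)
    then have "even (fls_subdegree (det H' / det H))" using p by simp
    moreover have "?S (det H' / det H) = det H' / det H"
    proof -
      have "?S (det H' / det H) * ?S (det H) = ?S (det H')"
        unfolding S.hom_mult[symmetric] using nz by simp
      then show ?thesis
        unfolding hermitian_det_fixed[OF H(1)] hermitian_det_fixed[OF H(2)] using nz by (simp add: field_simps)
    qed
    moreover have "det H' / det H \<noteq> 0" using nz by simp
    ultimately obtain y where y: "y \<noteq> 0" "y * ?S y = det H' / det H"
      using fls_norm_of_even by blast
    have "det H' = y * ?S y * det H" unfolding y(2) using nz by simp
    then show "\<exists>c. c \<noteq> 0 \<and> det H' = c * ?S c * det H" using y(1) by blast
  qed
  finally show ?thesis .
qed

text \<open>Every form that carries a triple with the given invariants has a determinant whose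
  valuation has the parity of \<open>val(Disc)\<close>. This gives uniqueness of the class as well
  as the comparison with the unit form, whose determinant has valuation 0.\<close>

lemma obstruction_trivial_iff:
  fixes z a b :: "nat \<Rightarrow> 'l fls"
  assumes n: "n \<ge> 1" "of_nat n \<noteq> (0 :: 'l fls)"
    and k: "\<And>c. c \<in> k \<Longrightarrow> fls_map s c = c" "0 \<in> k" "1 \<in> k" "-1 \<in> k"
    and z: "\<And>i. i \<in> {1..<n} \<Longrightarrow> z i \<noteq> 0"
    and zs: "\<And>i. i \<in> {1..<n} \<Longrightarrow> z i = fls_map s (z (n - i))"
    and as: "\<And>i. i \<in> {1..<n} \<Longrightarrow> a i = fls_map s (a (n - i))"
    and bs: "\<And>i. i \<in> {1..<n} \<Longrightarrow> b i = fls_map s (b 0 * a (n - i) - b (n - i))"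
    and b0: "fls_map s (b 0) = b 0"
    and nz: "disc n (z, a, b) \<noteq> 0"
  shows "obstruction n k (fls_map s) (z, a, b) = trivial_class n (fls_map s) \<longleftrightarrow>
    even (fls_subdegree (disc n (z, a, b)))"
proof -
  let ?S = "fls_map s"
  interpret S: field_hom ?S by (rule fls_map_hom)
  let ?r = "isometric n ?S"
  have eqv: "equiv (hermitian_forms n ?S) ?r"
    using isometric_equiv[OF fls_map_hom fls_map_invol fls_two] .
  have Z: "?S (rho z (n - 1)) = rho z (n - 1)"
    by (rule rho_self_conjugate[where n = n and z = z, OF fls_map_hom zs]) (use n in simp_all)
  obtain A e H where A: "A \<in> carrier_mat n n" and e: "e \<in> carrier_vec n"
    and H: "H \<in> carrier_mat n n" "adjoint_mat ?S H = H"
    and sim: "adjoint_mat ?S A * H * A = rho z (n - 1) \<cdot>\<^sub>m H"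
    and mi: "matrix_invariants n A e (hermitian_covector ?S H e) (z, a, b)"
    using hermitian_triple_exists[where n = n and z = z and a = a and b = b and s = ?S,
        OF fls_map_hom fls_map_invol n(1) z zs as bs b0] by blast
  have dH: "det H \<noteq> 0" by (rule disc_parity(1)[OF A H(1) e sim n z mi nz])
  have par: "even (fls_subdegree (disc n (z, a, b))) \<longleftrightarrow> even (fls_subdegree (det H))"
    by (rule disc_parity(2)[OF A H(1) e sim n z mi nz])
  have Hf: "H \<in> hermitian_forms n ?S" using H dH by (simp add: hermitian_forms_def)
  have dA: "det A = weight_factor z n" using mi by (simp add: matrix_invariants_def)
  let ?\<phi> = "matrix_point n z A"
  have sim': "adjoint_mat ?S A * H * A = ?S (rho z (n - 1)) \<cdot>\<^sub>m H" unfolding Z by (rule sim)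
  have tw: "?\<phi> \<in> twisted_points n k ?S H"
    by (rule matrix_point_twisted[OF n(2) A dA z fls_map_hom k(1) H(1) dH zs sim'])
  have hi: "has_invariants n ?\<phi> e (hermitian_covector ?S H e) (z, a, b)"
    by (rule has_invariants_iff[THEN iffD2, OF z matrix_point_z[OF n(2) A dA z]
          matrix_point_x[OF n(2) A dA z] dA n(1) mi])
  define P where "P c \<longleftrightarrow> c \<in> H1_unitary n ?S \<and> (\<exists>H\<in>c. \<exists>\<phi>\<in>twisted_points n k ?S H. \<exists>e\<in>carrier_vec n.
      has_invariants n \<phi> e (hermitian_covector ?S H e) (z, a, b))" for c
  have ex: "P (?r `` {H})"
    unfolding P_def H1_unitary_def
    using quotientI[OF Hf] equiv_class_self[OF eqv Hf] tw e hi by blast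
  \<comment> \<open>No isomorphism of triples is constructed: the matrix of the other point is a
    similitude of its own form, so \<open>disc_parity\<close> applies to it, and equal parity yields
    an isometry of the forms.\<close>
  have uniq: "c = ?r `` {H}" if Pc: "P c" for c
  proof -
    obtain H' \<phi> f where c: "c \<in> hermitian_forms n ?S // ?r" "H' \<in> c"
      and \<phi>: "\<phi> \<in> twisted_points n k ?S H'" and f: "f \<in> carrier_vec n"
      and h': "has_invariants n \<phi> f (hermitian_covector ?S H' f) (z, a, b)"
      using Pc unfolding P_def H1_unitary_def by blast
    obtain H0 where H0: "H0 \<in> hermitian_forms n ?S" "c = ?r `` {H0}"
      using c(1) by (rule quotientE)
    have H0': "(H0, H') \<in> ?r" using c(2) H0(2) by simp
    then have Hf': "H' \<in> hermitian_forms n ?S" by (simp add: isometric_def)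
    then have H': "H' \<in> carrier_mat n n" "det H' \<noteq> 0" by (simp_all add: hermitian_forms_def)
    have p: "\<phi> \<in> monoid_points n" using \<phi> by (simp add: twisted_points_def)
    note sim' = twisted_point_similitude[OF \<phi> n(1) H' fls_map_hom k(2-4)]
    have mi': "matrix_invariants n (point_mat n \<phi>) f (hermitian_covector ?S H' f) (z, a, b)"
      by (rule has_invariants_point_mat[OF p n(1) z h'])
    have "even (fls_subdegree (det H)) \<longleftrightarrow> even (fls_subdegree (det H'))"
      unfolding par[symmetric] by (rule disc_parity(2)[OF point_mat_carrier H'(1) f sim' n z mi' nz])
    then have "(H, H') \<in> ?r" using isometric_iff_parity[OF n(1) Hf Hf'] by simp
    then show ?thesis
      using equiv_class_eq[OF eqv H0'] equiv_class_eq[OF eqv] H0(2) by simp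
  qed
  have "obstruction n k ?S (z, a, b) = ?r `` {H}"
    unfolding obstruction_def P_def[symmetric] by (rule the_equality[where P = P]) (rule ex, rule uniq)
  moreover have one: "1\<^sub>m n \<in> hermitian_forms n ?S"
    by (auto simp: hermitian_forms_def adjoint_one[OF fls_map_hom fls_map_invol fls_two])
  have "?r `` {H} = ?r `` {1\<^sub>m n} \<longleftrightarrow> (H, 1\<^sub>m n) \<in> ?r"
    by (rule eq_equiv_class_iff[OF eqv Hf one])
  moreover have "(H, 1\<^sub>m n) \<in> ?r \<longleftrightarrow> even (fls_subdegree (det H))"
    using isometric_iff_parity[OF n(1) Hf one] by simp
  ultimately show ?thesis using par by (simp add: trivial_class_def)
qed

end

section \<open>The quadratic extension of finite fields and the conclusion\<close>

lemma quadratic_extension_finite: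
  fixes \<iota> :: "'k::{field,finite} \<Rightarrow> 'l::field"
  assumes "quadratic_extension \<iota>"
  shows "finite (UNIV :: 'l set)"
proof -
  obtain u v where "\<forall>y. \<exists>!c. y = \<iota> (fst c) * u + \<iota> (snd c) * v"
    using assms by (auto simp: quadratic_extension_def)
  then have "UNIV \<subseteq> range (\<lambda>c. \<iota> (fst c) * u + \<iota> (snd c) * v)" by blast
  then show ?thesis by (rule finite_subset) simp
qed

text \<open>An argument by counting: sending \<open>(c, d)\<close> to
  \<open>\<iota> c + \<iota> d * y\<close> is injective because \<open>y\<close> is not in the small
  field, and source and target have the same finite size.\<close>

lemma quadratic_extension_basis:
  fixes \<iota> :: "'k::{field,finite} \<Rightarrow> 'l::field"
  assumes q: "quadratic_extension \<iota>" and y: "y \<notin> range \<iota>"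
  shows "\<exists>c d. x = \<iota> c + \<iota> d * y"
proof -
  interpret i: field_hom \<iota> using q by (simp add: quadratic_extension_def)
  obtain u v where uv: "\<forall>y. \<exists>!c. y = \<iota> (fst c) * u + \<iota> (snd c) * v"
    using q by (auto simp: quadratic_extension_def)
  define f where "f c = \<iota> (fst c) * u + \<iota> (snd c) * v" for c
  define g where "g c = \<iota> (fst c) + \<iota> (snd c) * y" for c
  have f: "bij f" unfolding bij_iff f_def using uv by metis
  have g: "inj g"
  proof (rule injI)
    fix c d assume "g c = g d"
    then have eq: "\<iota> (fst c - fst d) = \<iota> (snd d - snd c) * y"
      by (simp add: g_def i.hom_minus algebra_simps)
    have "snd d = snd c"
    proof (rule ccontr)
      assume "snd d \<noteq> snd c"
      then have nz: "snd d - snd c \<noteq> 0" by simp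
      have "y = \<iota> ((fst c - fst d) * inverse (snd d - snd c))"
      proof -
        have "\<iota> (inverse (snd d - snd c)) * \<iota> (snd d - snd c) = 1"
          unfolding i.hom_mult[symmetric] using nz by simp
        then show ?thesis unfolding i.hom_mult eq by (simp add: mult_ac)
      qed
      then show False using y by blast
    qed
    moreover from this have "fst c = fst d" using eq by simp
    ultimately show "c = d" by (simp add: prod_eq_iff)
  qed
  have "inj (inv_into UNIV f \<circ> g)" using f g by (simp add: inj_compose bij_imp_bij_inv bij_is_inj)
  then have "surj (inv_into UNIV f \<circ> g)" by (rule finite_UNIV_inj_surj[rotated]) simp
  then obtain c where c: "inv_into UNIV f x = (inv_into UNIV f \<circ> g) c" by (rule surjE)
  have "x = f (inv_into UNIV f x)" using surj_f_inv_f[OF bij_is_surj[OF f]] by simp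
  also have "\<dots> = g c" unfolding c using surj_f_inv_f[OF bij_is_surj[OF f]] by simp
  finally have "x = g c" .
  then show ?thesis by (auto simp: g_def)
qed

text \<open>An element outside the small field is a root of a monic quadratic polynomial over it,
  and its image is either itself or the other root \<open>\<iota> d - y\<close>.\<close>

lemma nontrivial_automorphism_involution:
  fixes \<iota> :: "'k::{field,finite} \<Rightarrow> 'l::field"
  assumes q: "quadratic_extension \<iota>" and \<sigma>: "nontrivial_automorphism \<iota> \<sigma>"
  shows "\<sigma> (\<sigma> y) = y"
proof (cases "y \<in> range \<iota>")
  case True
  then show ?thesis using \<sigma> by (auto simp: nontrivial_automorphism_def)
next
  case False
  interpret s: field_hom \<sigma> using \<sigma> by (simp add: nontrivial_automorphism_def)
  have fixed: "\<sigma> (\<iota> c) = \<iota> c" for c using \<sigma> by (simp add: nontrivial_automorphism_def)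
  obtain c d where y: "y * y = \<iota> c + \<iota> d * y" using quadratic_extension_basis[OF q False] by blast
  have "\<sigma> (y * y) = \<sigma> (\<iota> c + \<iota> d * y)" by (simp only: y)
  then have "\<sigma> y * \<sigma> y = \<iota> c + \<iota> d * \<sigma> y" by (simp only: s.hom_mult s.hom_add fixed)
  then have "(\<sigma> y - y) * (\<sigma> y + y - \<iota> d) = 0"
    using y by (simp add: algebra_simps)
  then have "\<sigma> y = y \<or> \<sigma> y = \<iota> d - y"
    by (simp only: mult_eq_0_iff right_minus_eq eq_diff_eq)
  then show ?thesis
  proof
    assume *: "\<sigma> y = \<iota> d - y"
    have "\<sigma> (\<sigma> y) = \<sigma> (\<iota> d - y)" by (simp only: *)
    also have "\<dots> = \<iota> d - \<sigma> y" by (simp only: s.hom_minus fixed)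
    finally show ?thesis using * by simp
  qed simp
qed

theorem proposition3p2p6:
  fixes \<iota> :: "'k::{field,finite} \<Rightarrow> 'l::field"
    and \<sigma> :: "'l \<Rightarrow> 'l"
    and n :: nat
    and a :: "'l fps invs"
  assumes "n \<ge> 1"
    and "CHAR('k) > 2 * n"
    and "quadratic_extension \<iota>"
    and "nontrivial_automorphism \<iota> \<sigma>"
    and "a \<in> base_points n (fps_map \<sigma>) (range (fps_map \<iota>))"
    and "invertible_invs n (generic_fibre a)"
    and "strongly_regular_semisimple n (generic_fibre a)"
  shows "obstruction n (range (\<lambda>c. fls_const (\<iota> c))) (fls_map \<sigma>) (generic_fibre a)
           \<noteq> trivial_class n (fls_map \<sigma>) \<longleftrightarrow>
         odd (fls_subdegree (disc n (generic_fibre a)))"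
proof -
  interpret i: field_hom \<iota> using assms(3) by (simp add: quadratic_extension_def)
  have fixed: "\<sigma> (\<iota> c) = \<iota> c" for c using assms(4) by (simp add: nontrivial_automorphism_def)
  \<comment> \<open>Used for 2, which must be invertible for square roots and Hermitian forms, and
    for \<open>n\<close>, which must be invertible for the descent from n-th roots.\<close>
  have of_nat: "of_nat m \<noteq> (0 :: 'l)" if "0 < m" "m \<le> 2 * n" for m
  proof
    assume "of_nat m = (0 :: 'l)"
    then have "\<iota> (of_nat m) = 0" by (simp add: i.hom_of_nat)
    then have "of_nat m = (0 :: 'k)" by simp
    then have "CHAR('k) dvd m" by (simp add: of_nat_eq_0_iff_char_dvd)
    then have "CHAR('k) \<le> m" using that by (intro dvd_imp_le) auto
    then show False using assms(2) that by simp
  qed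
  interpret quadratic_involution \<sigma>
  proof (rule quadratic_involution.intro)
    show "field_hom \<sigma>" "\<sigma> \<noteq> id" using assms(4) by (simp_all add: nontrivial_automorphism_def)
    show "\<sigma> (\<sigma> x) = x" for x by (rule nontrivial_automorphism_involution[OF assms(3,4)])
    show "finite (UNIV :: 'l set)" by (rule quadratic_extension_finite[OF assms(3)])
    show "(2 :: 'l) \<noteq> 0" using of_nat[of 2] assms(1) by simp
  qed
  obtain z c b where a: "a = (z, c, b)" by (cases a)
  have to_fls: "fls_map \<sigma> (fps_to_fls x) = fps_to_fls (fps_map \<sigma> x)" for x
    by (rule fls_eqI) (simp add: fls_map_nth fps_map_def)
  have bp: "z i = fps_map \<sigma> (z (n - i))" "c i = fps_map \<sigma> (c (n - i))"
      "b i = fps_map \<sigma> (b 0 * c (n - i) - b (n - i))" if "i \<in> {1..<n}" for i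
    using assms(5) that by (auto simp: a base_points_def)
  have b0: "fps_map \<sigma> (b 0) = b 0"
    using assms(5) by (auto simp: a base_points_def fps_map_def fixed fps_eq_iff)
  have "obstruction n (range (\<lambda>c. fls_const (\<iota> c))) (fls_map \<sigma>)
        (\<lambda>i. fps_to_fls (z i), \<lambda>i. fps_to_fls (c i), \<lambda>i. fps_to_fls (b i)) = trivial_class n (fls_map \<sigma>) \<longleftrightarrow>
      even (fls_subdegree (disc n (\<lambda>i. fps_to_fls (z i), \<lambda>i. fps_to_fls (c i), \<lambda>i. fps_to_fls (b i))))"
  proof (rule obstruction_trivial_iff[OF assms(1)])
    show "of_nat n \<noteq> (0 :: 'l fls)"
      using of_nat[of n] assms(1) by (simp add: fls_of_nat)
    show "fls_map \<sigma> x = x" if "x \<in> range (\<lambda>c. fls_const (\<iota> c))" for x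
      using that by (auto intro!: fls_eqI simp: fls_map_nth fixed)
    show "0 \<in> range (\<lambda>c. fls_const (\<iota> c))" by (rule range_eqI[of _ _ 0]) simp
    show "1 \<in> range (\<lambda>c. fls_const (\<iota> c))" by (rule range_eqI[of _ _ 1]) simp
    show "- 1 \<in> range (\<lambda>c. fls_const (\<iota> c))"
      by (rule range_eqI[of _ _ "- 1"]) (simp add: i.hom_uminus)
    show "fps_to_fls (z i) \<noteq> 0" if "i \<in> {1..<n}" for i
      using assms(6) that by (simp add: a generic_fibre_def invertible_invs_def)
    show "fps_to_fls (z i) = fls_map \<sigma> (fps_to_fls (z (n - i)))" if "i \<in> {1..<n}" for i
      unfolding to_fls bp(1)[OF that, symmetric] ..
    show "fps_to_fls (c i) = fls_map \<sigma> (fps_to_fls (c (n - i)))" if "i \<in> {1..<n}" for i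
      unfolding to_fls bp(2)[OF that, symmetric] ..
    show "fps_to_fls (b i) = fls_map \<sigma> (fps_to_fls (b 0) * fps_to_fls (c (n - i)) - fps_to_fls (b (n - i)))"
      if "i \<in> {1..<n}" for i
      unfolding fls_times_fps_to_fls[symmetric] fps_to_fls_minus[symmetric] to_fls
        bp(3)[OF that, symmetric] ..
    show "fls_map \<sigma> (fps_to_fls (b 0)) = fps_to_fls (b 0)" unfolding to_fls b0 ..
    show "disc n (\<lambda>i. fps_to_fls (z i), \<lambda>i. fps_to_fls (c i), \<lambda>i. fps_to_fls (b i)) \<noteq> 0"
      using assms(7) by (auto simp: a generic_fibre_def strongly_regular_semisimple_def)
  qed
  then show ?thesis by (simp add: a generic_fibre_def)
qed

end
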